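(* Suppose that for every $k$ we have a vector of independent random variables $X_0^{(k)},X_1^{(k)},\dots,X_k^{(k)}$ (complex valued) with zero mean, unit variance, and continuous distributions with densities uniformly bounded by a constant $M>0$ not depending on $k$. Let also $\alpha_0^{(k)},\alpha_1^{(k)},\dots,\alpha_k^{(k)}$ be sequences of complex numbers, where $\alpha_k^{(k)}\neq0$ for every $k$. Consider the $n\times n$ matrix polynomial of degree $k$ $$P_{n,k}(x)=\sum_{j=0}^k \alpha_j^{(k)}C_j^{(k)}x^j,$$ where, for $j=0,\dots,k$, every coefficient $C_j^{(k)}$ is an $n\times n$ random matrix whose entries are i.i.d. copies of $X_j^{(k)}$ (the matrices $C_0^{(k)},\dots,C_k^{(k)}$ being independent). If $n=n(k)=O(k^P)$ for some $P>0$, then the empirical spectral distributions of the random matrix polynomials $P_{n,k}$ converge almost surely to a probability measure $\mu$ as $k\to\infty$ when the coefficients $\alpha_j^{(k)}$ satisfy the following conditions: (i) $\alpha_k^{(k)}\neq 0$ for every $k$; (ii) for almost every $z$, there exists the limit $$U(z)=\lim_{k\to\infty}\frac{1}{2k}\ln\left(\sum_{i=0}^k\frac{|\alpha_i^{(k)}|^2}{|\alpha_k^{(k)}|^2}|z|^{2i}\right)$$ as an $L^1_{loc}$ function or a distribution; (iii) the probability measure $\mu$ satisfies $$\Delta_z U(z)=2\pi\mu$$ in the sense of distributions.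
   Context: For an $n\times n$ complex matrix polynomial $P(z)=\sum_{j=0}^k B_j z^j$ with invertible leading coefficient $B_k$, the finite eigenvalues $\lambda_1(P),\dots,\lambda_{kn}(P)$ are the $kn$ roots of $\det P(z)$ counted with multiplicity, and the empirical spectral distribution of $P$ is the probability measure $\mu_P=\frac{1}{kn}\sum_{i=1}^{kn}\delta_{\lambda_i(P)}$ on $\mathbb{C}$, where $\delta_\lambda$ is the atomic probability measure with a single atom at $\lambda$. For a random matrix polynomial whose leading coefficient is almost surely invertible (as is the case in the claim), $\mu_P$ is a random probability measure. All random variables (for all $k$) are defined on one common probability space. Densities are with respect to Lebesgue measure on $\mathbb{C}$, and the variance of a mean-zero complex random variable $X$ is $\mathbb{E}|X|^2$. Almost sure convergence of the empirical spectral distributions to $\mu$ means that with probability $1$ these measures converge weakly to $\mu$. Distributions are elements of the dual $D'(\mathbb{C})$ of the space $C_c^\infty(\mathbb{C})$ of test functions; $L^1_{loc}(\mathbb{C})$, the space of locally integrable functions, embeds in $D'(\mathbb{C})$ via $g\mapsto\left(\varphi\mapsto\int_{\mathbb{C}} g\varphi\,\mathrm{d}z\right)$, and a finite measure $\mu$ is the distribution $\varphi\mapsto\int_{\mathbb{C}}\varphi\,\mathrm{d}\mu$. The Laplacian $\Delta$ (also written $\Delta_z$) acts on distributions $T$ by $(\Delta T)(\varphi)=T(\Delta\varphi)$, where $\Delta=\partial_x^2+\partial_y^2$ on $\mathbb{C}\cong\mathbb{R}^2$. *)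

theory Defs
  imports
    "HOL-Probability.Probability"
    "HOL-Computational_Algebra.Computational_Algebra"
    "HOL-Library.Landau_Symbols"
    "Jordan_Normal_Form.Determinant"
begin

section \<open>Matrix polynomials and empirical spectral distributions\<close>

text \<open>
  Several constants carry the same short name in HOL-Analysis and in Jordan_Normal_Form; here
  matrices are always those of Jordan_Normal_Form, because their size depends on \<open>k\<close>.

  A matrix polynomial \<open>P(z) = B 0 + B 1 z + \<dots> + B k z^k\<close> is represented by the matrix
  with polynomial entries, so that its determinant is the polynomial \<open>det P(z)\<close>.
\<close>

definition matrix_polynomial :: "nat \<Rightarrow> nat \<Rightarrow> (nat \<Rightarrow> complex mat) \<Rightarrow> complex poly mat" where
  "matrix_polynomial n k B = Matrix.mat n n (\<lambda>(a, b). \<Sum>j\<le>k. monom (B j $$ (a, b)) j)"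

definition finite_eigenvalues :: "complex poly mat \<Rightarrow> complex multiset" where
  "finite_eigenvalues P = proots (Determinant.det P)"

definition empirical_spectral_distribution ::
    "nat \<Rightarrow> nat \<Rightarrow> (nat \<Rightarrow> complex mat) \<Rightarrow> complex measure" where
  "empirical_spectral_distribution n k B =
     measure_of UNIV (sets borel)
       (\<lambda>A. ennreal (1 / real (k * n)) *
            (\<Sum>l\<in>#finite_eigenvalues (matrix_polynomial n k B). emeasure (return borel l) A))"

lemma space_esd [simp]: "space (empirical_spectral_distribution n k B) = UNIV"
  by (simp add: empirical_spectral_distribution_def space_measure_of_conv)

lemma sets_esd [simp, measurable_cong]: "sets (empirical_spectral_distribution n k B) = sets borel"
  unfolding empirical_spectral_distribution_def
  by (subst sets_measure_of_conv) (simp add: sets.sigma_sets_eq[of borel, simplified])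

lemma emeasure_esd:
  assumes "A \<in> sets borel"
  shows "emeasure (empirical_spectral_distribution n k B) A =
    ennreal (1 / real (k * n)) *
      (\<Sum>l\<in>#finite_eigenvalues (matrix_polynomial n k B). emeasure (return borel l) A)"
proof (rule emeasure_measure_of[OF empirical_spectral_distribution_def])
  show "countably_additive (sets (empirical_spectral_distribution n k B))
     (\<lambda>A. ennreal (1 / real (k * n)) *
        (\<Sum>l\<in>#finite_eigenvalues (matrix_polynomial n k B). emeasure (return borel l) A))"
    unfolding countably_additive_def
  proof (intro allI impI, unfold sets_esd)
    fix F :: "nat \<Rightarrow> complex set"
    assume F: "range F \<subseteq> sets borel" "disjoint_family F"
    have "(\<Sum>i. \<Sum>l\<in>#R. emeasure (return borel l) (F i)) =
        (\<Sum>l\<in>#R. emeasure (return borel l) (\<Union>i. F i))" for R :: "complex multiset"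
    proof (induction R)
      case (add x R)
      have "(\<Sum>i. emeasure (return borel x) (F i)) = emeasure (return borel x) (\<Union>i. F i)"
        using F by (intro suminf_emeasure) auto
      with add show ?case by (simp add: suminf_add[symmetric])
    qed simp
    then show "(\<Sum>i. ennreal (1 / real (k * n)) *
          (\<Sum>l\<in>#finite_eigenvalues (matrix_polynomial n k B). emeasure (return borel l) (F i))) =
        ennreal (1 / real (k * n)) *
          (\<Sum>l\<in>#finite_eigenvalues (matrix_polynomial n k B). emeasure (return borel l) (\<Union>i. F i))"
      by (simp only: ennreal_suminf_cmult)
  qed
qed (use assms in \<open>auto simp: positive_def\<close>)

text \<open>Weak convergence; the library only has it for measures on the real line.\<close>

definition weakly_converges :: "(nat \<Rightarrow> complex measure) \<Rightarrow> complex measure \<Rightarrow> bool" where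
  "weakly_converges \<nu> \<mu> \<longleftrightarrow>
     (\<forall>f :: complex \<Rightarrow> real. continuous_on UNIV f \<and> bounded (range f) \<longrightarrow>
        (\<lambda>k. integral\<^sup>L (\<nu> k) f) \<longlonglongrightarrow> integral\<^sup>L \<mu> f)"

section \<open>Random matrices\<close>

definition bounded_density :: "'w measure \<Rightarrow> real \<Rightarrow> ('w \<Rightarrow> complex) \<Rightarrow> bool" where
  "bounded_density \<Omega> M X \<longleftrightarrow>
     (\<exists>f. distributed \<Omega> lborel X f \<and> (AE z in lborel. f z \<le> ennreal M))"

definition iid_copies_matrix ::
    "'w measure \<Rightarrow> nat \<Rightarrow> ('w \<Rightarrow> complex) \<Rightarrow> ('w \<Rightarrow> complex mat) \<Rightarrow> bool" where
  "iid_copies_matrix \<Omega> n X A \<longleftrightarrow>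
     (\<forall>\<omega>\<in>space \<Omega>. A \<omega> \<in> carrier_mat n n) \<and>
     prob_space.indep_vars \<Omega> (\<lambda>_. borel) (\<lambda>i \<omega>. A \<omega> $$ i) ({..<n} \<times> {..<n}) \<and>
     (\<forall>i\<in>{..<n} \<times> {..<n}. distr \<Omega> borel (\<lambda>\<omega>. A \<omega> $$ i) = distr \<Omega> borel X)"

text \<open>A random \<open>n \<times> n\<close> matrix is viewed as a random element of the product space of its entries.\<close>

definition indep_matrices ::
    "'w measure \<Rightarrow> nat \<Rightarrow> (nat \<Rightarrow> 'w \<Rightarrow> complex mat) \<Rightarrow> nat set \<Rightarrow> bool" where
  "indep_matrices \<Omega> n C J \<longleftrightarrow>
     prob_space.indep_vars \<Omega> (\<lambda>_. PiM ({..<n} \<times> {..<n}) (\<lambda>_. borel))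
       (\<lambda>j \<omega>. \<lambda>i\<in>{..<n} \<times> {..<n}. C j \<omega> $$ i) J"

section \<open>Distributions on the complex plane\<close>

definition partial_x :: "(complex \<Rightarrow> complex) \<Rightarrow> complex \<Rightarrow> complex" where
  "partial_x f z = frechet_derivative f (at z) 1"

definition partial_y :: "(complex \<Rightarrow> complex) \<Rightarrow> complex \<Rightarrow> complex" where
  "partial_y f z = frechet_derivative f (at z) \<i>"

text \<open>Differentiability is real differentiability: \<open>differentiable\<close> refers to real-linear
  Frechet derivatives.\<close>

primrec times_continuously_differentiable :: "nat \<Rightarrow> (complex \<Rightarrow> complex) \<Rightarrow> bool" where
  "times_continuously_differentiable 0 f \<longleftrightarrow> continuous_on UNIV f"
| "times_continuously_differentiable (Suc m) f \<longleftrightarrow>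
     (\<forall>z. f differentiable (at z)) \<and>
     times_continuously_differentiable m (partial_x f) \<and>
     times_continuously_differentiable m (partial_y f)"

definition test_functions :: "(complex \<Rightarrow> complex) set" where
  "test_functions =
     {\<phi>. (\<forall>m. times_continuously_differentiable m \<phi>) \<and> compact (closure {z. \<phi> z \<noteq> 0})}"

definition laplacian :: "(complex \<Rightarrow> complex) \<Rightarrow> complex \<Rightarrow> complex" where
  "laplacian \<phi> z = partial_x (partial_x \<phi>) z + partial_y (partial_y \<phi>) z"

text \<open>
  Distributions are functionals of which only the values on test functions matter. Continuity on
  \<open>C_c^\<infinity>\<close> is expressed by the usual seminorm estimates: for every compact set \<open>K\<close> there is an
  order \<open>m\<close> that works for all test functions supported in \<open>K\<close>.
\<close>

definition is_distribution :: "((complex \<Rightarrow> complex) \<Rightarrow> complex) \<Rightarrow> bool" where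
  "is_distribution T \<longleftrightarrow>
     (\<forall>\<phi>\<in>test_functions. \<forall>\<psi>\<in>test_functions. T (\<lambda>z. \<phi> z + \<psi> z) = T \<phi> + T \<psi>) \<and>
     (\<forall>c. \<forall>\<phi>\<in>test_functions. T (\<lambda>z. c * \<phi> z) = c * T \<phi>) \<and>
     (\<forall>K. compact K \<longrightarrow>
        (\<exists>c m. \<forall>\<phi>\<in>test_functions. closure {z. \<phi> z \<noteq> 0} \<subseteq> K \<longrightarrow>
           cmod (T \<phi>) \<le>
             c * (\<Sum>i\<le>m. \<Sum>j\<le>m. SUP z. cmod ((partial_x ^^ i) ((partial_y ^^ j) \<phi>) z))))"

definition locally_integrable :: "(complex \<Rightarrow> real) \<Rightarrow> bool" where
  "locally_integrable g \<longleftrightarrow> (\<forall>K. compact K \<longrightarrow> set_integrable lborel K g)"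

definition function_distribution :: "(complex \<Rightarrow> real) \<Rightarrow> (complex \<Rightarrow> complex) \<Rightarrow> complex" where
  "function_distribution g \<phi> = (LINT z|lborel. complex_of_real (g z) * \<phi> z)"

definition measure_distribution :: "complex measure \<Rightarrow> (complex \<Rightarrow> complex) \<Rightarrow> complex" where
  "measure_distribution \<mu> \<phi> = (LINT z|\<mu>. \<phi> z)"

definition distribution_laplacian ::
    "((complex \<Rightarrow> complex) \<Rightarrow> complex) \<Rightarrow> (complex \<Rightarrow> complex) \<Rightarrow> complex" where
  "distribution_laplacian T \<phi> = T (laplacian \<phi>)"

text \<open>
  A sequence of functions has the distribution \<open>U\<close> as its limit, in one of two senses:
  the functions converge pointwise almost everywhere to a locally integrable function
  whose distribution is \<open>U\<close>, or they converge to \<open>U\<close> as distributions.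
\<close>

definition limit_as_L1loc_function ::
    "(nat \<Rightarrow> complex \<Rightarrow> real) \<Rightarrow> ((complex \<Rightarrow> complex) \<Rightarrow> complex) \<Rightarrow> bool" where
  "limit_as_L1loc_function u U \<longleftrightarrow>
     (\<exists>g. locally_integrable g \<and>
        (AE z in lborel. (\<lambda>k. u k z) \<longlonglongrightarrow> g z) \<and>
        (\<forall>\<phi>\<in>test_functions. U \<phi> = function_distribution g \<phi>))"

definition limit_as_distribution ::
    "(nat \<Rightarrow> complex \<Rightarrow> real) \<Rightarrow> ((complex \<Rightarrow> complex) \<Rightarrow> complex) \<Rightarrow> bool" where
  "limit_as_distribution u U \<longleftrightarrow>
     (\<forall>\<phi>\<in>test_functions. (\<lambda>k. function_distribution (u k) \<phi>) \<longlonglongrightarrow> U \<phi>)"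

text \<open>
  If \<open>\<alpha> k k \<noteq> 0\<close>, the argument of \<open>ln\<close> is positive except possibly at \<open>z = 0\<close>.
\<close>

definition log_potential :: "(nat \<Rightarrow> nat \<Rightarrow> complex) \<Rightarrow> nat \<Rightarrow> complex \<Rightarrow> real" where
  "log_potential \<alpha> k z =
     1 / (2 * real k) *
       ln (\<Sum>i\<le>k. (cmod (\<alpha> k i))\<^sup>2 / (cmod (\<alpha> k k))\<^sup>2 * cmod z ^ (2 * i))"

end

(*
  Write D_k(z) = det P_{n,k}(z) and sigma_k(z)^2 = sum_j |alpha_j z^j|^2. The logarithmic potential of the
  empirical spectral distribution is (1/kn) ln |D_k(z) / det(alpha_k C_k)|, while the deterministic
  potential of the hypothesis is (1/k) ln (sigma_k(z) / |alpha_k|). It therefore suffices to compare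
  (1/n) ln |D_k(z)| with ln sigma_k(z), and (1/n) ln |det C_k| with 0, up to o(k).

  Upper bound: |det A| <= (n max |entry|)^n, and the entries have bounded first moments.
  Lower bound: D_k is affine in each entry of a coefficient matrix. Integrating out the (m,m) entry of the
  coefficient with the largest |alpha_j z^j| bounds E 1/|det A_{m+1}| by a constant times E 1/|det A_m| for
  the leading principal minors A_m, because the density is bounded and 1/|z| is locally integrable in the
  plane.

  Both bounds lose only powers of k and n, so the second moment of the error divided by k is
  O((ln k / k)^2), which is summable. By Tonelli the errors tend to 0 almost surely in L^2 of every disc,
  hence as distributions. Applying the Laplacian, whose fundamental solution is ln |z| / (2 pi), turns
  convergence of the potentials into convergence of the spectral distributions on test functions; for
  probability measures this is weak convergence.
*)
theory Submission
  imports Defs "Jordan_Normal_Form.Char_Poly"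
begin

section \<open>Integration over the complex plane\<close>

text \<open>The lower bound runs on the first moment of 1/|det| because this quantity iterates: each
  entry that is integrated out costs one constant factor, so n of them give an n-th power, which
  (1/n) ln reduces to a single logarithm. The inequality
  \<open>(max 0 (ln x))\<^sup>2 \<le> x\<close> then turns expectations bounded by 1 into second
  moments of logarithms. Estimates at a fixed z hold outside a null event that depends on z. Mean
  squares over discs avoid an uncountable union of such events and also absorb the logarithmic poles
  at the eigenvalues. The origin is special: sigma_k(0) vanishes when alpha_0 does, so every
  estimate is made for nonzero z and the origin is dropped as a null set. The two meanings of the
  limit U are reconciled by a Lipschitz estimate: each deterministic potential is 1-Lipschitz in ln
  |z|, with a constant independent of k, so almost everywhere convergence implies convergence as
  distributions. Conventions at 0 matter: in \<open>ennreal\<close> the inverse of 0 is infinite, so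
  singular matrices only strengthen an upper bound on the right; for reals \<open>ln 0 = 0\<close>
  and \<open>1 / 0 = 0\<close>.\<close>

lemma measurable_Complex [measurable]:
  "(\<lambda>p. Complex (fst p) (snd p)) \<in> borel_measurable (borel \<Otimes>\<^sub>M borel)"
  unfolding Complex_eq by measurable

text \<open>Lebesgue measure is determined by its values on boxes, and with basis 1, i a complex box
  is a product of two intervals. This opens the plane to iterated integration.\<close>

lemma lborel_complex_eq:
  "(lborel :: complex measure) = distr (lborel \<Otimes>\<^sub>M lborel) borel (\<lambda>p. Complex (fst p) (snd p))"
proof (rule lborel_eqI)
  fix l u :: complex
  assume le: "\<And>b. b \<in> Basis \<Longrightarrow> inner l b \<le> inner u b"
  have "Re l \<le> Re u" "Im l \<le> Im u"
    using le[of 1] le[of \<i>] by (auto simp: Basis_complex_def inner_complex_def)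
  moreover have "(\<lambda>p. Complex (fst p) (snd p)) -` box l u = {Re l<..<Re u} \<times> {Im l<..<Im u}"
    by (auto simp: in_box_complex_iff)
  ultimately show "emeasure (distr (lborel \<Otimes>\<^sub>M lborel) borel (\<lambda>p. Complex (fst p) (snd p))) (box l u)
      = ennreal (\<Prod>b\<in>Basis. inner (u - l) b)"
    by (simp add: emeasure_distr space_pair_measure lborel.emeasure_pair_measure_Times
        Basis_complex_def inner_complex_def ennreal_mult'')
qed simp

lemma nn_integral_complex:
  assumes [measurable]: "f \<in> borel_measurable (borel :: complex measure)"
  shows "(\<integral>\<^sup>+z. f z \<partial>lborel) = (\<integral>\<^sup>+x. \<integral>\<^sup>+y. f (Complex x y) \<partial>lborel \<partial>lborel)"
proof -
  have "(\<integral>\<^sup>+z. f z \<partial>lborel) = (\<integral>\<^sup>+p. f (Complex (fst p) (snd p)) \<partial>(lborel \<Otimes>\<^sub>M lborel))"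
    by (subst lborel_complex_eq) (simp add: nn_integral_distr)
  also have "\<dots> = (\<integral>\<^sup>+x. \<integral>\<^sup>+y. f (Complex x y) \<partial>lborel \<partial>lborel)"
    by (subst lborel.nn_integral_fst[symmetric]) auto
  finally show ?thesis .
qed

lemma
  fixes f :: "complex \<Rightarrow> complex"
  assumes f: "integrable lborel f"
  shows lborel_integral_complex: "(LINT z|lborel. f z) = (LINT x|lborel. LINT y|lborel. f (Complex x y))"
    and lborel_integral_complex': "(LINT z|lborel. f z) = (LINT y|lborel. LINT x|lborel. f (Complex x y))"
proof -
  have [measurable]: "f \<in> borel_measurable borel" using f by auto
  have int: "integrable (lborel \<Otimes>\<^sub>M lborel) (\<lambda>(x, y). f (Complex x y))"
    using f by (subst (asm) lborel_complex_eq) (simp add: integrable_distr_eq case_prod_unfold)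
  have eq: "(LINT z|lborel. f z) = (LINT p|(lborel \<Otimes>\<^sub>M lborel). (\<lambda>(x, y). f (Complex x y)) p)"
    by (subst lborel_complex_eq) (simp add: integral_distr case_prod_unfold)
  show "(LINT z|lborel. f z) = (LINT x|lborel. LINT y|lborel. f (Complex x y))"
    unfolding eq using lborel_pair.integral_fst[OF int] by simp
  show "(LINT z|lborel. f z) = (LINT y|lborel. LINT x|lborel. f (Complex x y))"
    unfolding eq using lborel_pair.integral_snd[OF int] by simp
qed

lemma integral_derivative_eq_0:
  fixes h h' :: "real \<Rightarrow> complex"
  assumes h: "\<And>x. (h has_vector_derivative h' x) (at x)"
    and cont: "continuous_on UNIV h'"
    and 0: "\<And>x. R \<le> \<bar>x\<bar> \<Longrightarrow> h x = 0" "\<And>x. R \<le> \<bar>x\<bar> \<Longrightarrow> h' x = 0"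
  shows "(LINT x|lborel. h' x) = 0"
proof -
  define b where "b = \<bar>R\<bar>"
  have "(LINT x|lborel. h' x) = (LINT x|lborel. indicator {-b..b} x *\<^sub>R h' x)"
    by (intro Bochner_Integration.integral_cong) (auto simp: indicator_def 0 b_def)
  also have "\<dots> = h b - h (-b)"
    by (rule integral_FTC_Icc)
       (auto simp: b_def intro: has_vector_derivative_at_within[OF h] continuous_on_subset[OF cont])
  also have "\<dots> = 0"
    by (simp add: 0 b_def)
  finally show ?thesis .
qed

lemma integrable_continuous_bounded_support:
  fixes f :: "complex \<Rightarrow> 'b::{banach, second_countable_topology}"
  assumes cont: "continuous_on UNIV f" and 0: "\<And>z. R \<le> cmod z \<Longrightarrow> f z = 0"
  shows "integrable lborel f"
proof -
  have "integrable lborel (\<lambda>z. indicator (cball 0 R) z *\<^sub>R f z)"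
    by (intro borel_integrable_compact continuous_on_subset[OF cont]) auto
  also have "(\<lambda>z. indicator (cball 0 R) z *\<^sub>R f z) = f"
    using 0 by (auto simp: fun_eq_iff indicator_def)
  finally show ?thesis .
qed

lemma continuous_on_Complex_coordinate: "continuous_on UNIV (\<lambda>x. Complex x y)" "continuous_on UNIV (Complex x)"
  unfolding Complex_eq by (intro continuous_intros)+

lemma integral_horizontal_derivative_eq_0:
  fixes h h' :: "complex \<Rightarrow> complex"
  assumes h: "\<And>x y. ((\<lambda>x. h (Complex x y)) has_vector_derivative h' (Complex x y)) (at x)"
    and cont: "continuous_on UNIV h'"
    and 0: "\<And>z. R \<le> cmod z \<Longrightarrow> h z = 0" "\<And>z. R \<le> cmod z \<Longrightarrow> h' z = 0"
  shows "(LINT z|lborel. h' z) = 0"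
proof -
  have R: "R \<le> cmod (Complex x y)" if "R \<le> \<bar>x\<bar>" for x y
    using that abs_Re_le_cmod[of "Complex x y"] by simp
  have "(LINT x|lborel. h' (Complex x y)) = 0" for y
    using integral_derivative_eq_0[of "\<lambda>x. h (Complex x y)" "\<lambda>x. h' (Complex x y)" R]
      continuous_on_compose2[OF cont continuous_on_Complex_coordinate(1)] h R 0 by auto
  then show ?thesis
    by (subst lborel_integral_complex') (auto intro: integrable_continuous_bounded_support[OF cont 0(2)])
qed

lemma integral_vertical_derivative_eq_0:
  fixes h h' :: "complex \<Rightarrow> complex"
  assumes h: "\<And>x y. ((\<lambda>y. h (Complex x y)) has_vector_derivative h' (Complex x y)) (at y)"
    and cont: "continuous_on UNIV h'"
    and 0: "\<And>z. R \<le> cmod z \<Longrightarrow> h z = 0" "\<And>z. R \<le> cmod z \<Longrightarrow> h' z = 0"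
  shows "(LINT z|lborel. h' z) = 0"
proof -
  have R: "R \<le> cmod (Complex x y)" if "R \<le> \<bar>y\<bar>" for x y
    using that abs_Im_le_cmod[of "Complex x y"] by simp
  have "(LINT y|lborel. h' (Complex x y)) = 0" for x
    using integral_derivative_eq_0[of "\<lambda>y. h (Complex x y)" "\<lambda>y. h' (Complex x y)" R]
      continuous_on_compose2[OF cont continuous_on_Complex_coordinate(2)] h R 0 by auto
  then show ?thesis
    by (subst lborel_integral_complex) (auto intro: integrable_continuous_bounded_support[OF cont 0(2)])
qed

lemma nn_integral_FTC_whole_line:
  fixes f F :: "real \<Rightarrow> real"
  assumes F: "\<And>x. (F has_real_derivative f x) (at x)"
    and f: "continuous_on UNIV f" "\<And>x. 0 \<le> f x"
    and lim: "(F \<longlongrightarrow> A) at_bot" "(F \<longlongrightarrow> B) at_top"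
  shows "(\<integral>\<^sup>+x. ennreal (f x) \<partial>lborel) = ennreal (B - A)"
proof -
  have [simp]: "einterval (-\<infinity>) \<infinity> = UNIV"
    by (auto simp: einterval_def)
  have "set_integrable lborel (einterval (-\<infinity>) \<infinity>) f" "(LBINT x=-\<infinity>..\<infinity>. f x) = B - A"
    using interval_integral_FTC_nonneg[of "-\<infinity>" \<infinity> F f A B] F f lim
    by (auto simp: ereal_tendsto_simps continuous_on_eq_continuous_at)
  then have "integrable lborel f" "(LINT x|lborel. f x) = B - A"
    by (auto simp: set_integrable_def interval_lebesgue_integral_def set_lebesgue_integral_def)
  then show ?thesis
    using nn_integral_eq_integral[of lborel f] f by auto
qed

text \<open>Serves as the inner integral of the kernel below, with
  \<open>a = sqrt (1 + x\<^sup>2)\<close> at a fixed real part x.\<close>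

lemma nn_integral_inverse_square:
  fixes a :: real
  assumes "a > 0"
  shows "(\<integral>\<^sup>+y. ennreal (2 / (a\<^sup>2 + y\<^sup>2)\<^sup>2) \<partial>lborel) = ennreal (pi / a ^ 3)"
proof -
  \<comment> \<open>The textbook antiderivative by reduction to arctan. The rational part vanishes
    at both ends, so arctan alone yields the value.\<close>
  define F where "F = (\<lambda>y. y / (a\<^sup>2 * (a\<^sup>2 + y\<^sup>2)) + arctan (y / a) / a ^ 3)"
  have pos: "a\<^sup>2 + y\<^sup>2 > 0" for y using assms by (simp add: add_pos_nonneg)
  have "(F has_real_derivative 2 / (a\<^sup>2 + y\<^sup>2)\<^sup>2) (at y)" for y
  proof -
    let ?q = "(1 * (a\<^sup>2 * (a\<^sup>2 + y\<^sup>2)) - y * (a\<^sup>2 * (2 * y))) / (a\<^sup>2 * (a\<^sup>2 + y\<^sup>2))\<^sup>2"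
    have [simp]: "a\<^sup>2 \<noteq> 0" using assms by simp
    have *: "1 + (y / a)\<^sup>2 = (a\<^sup>2 + y\<^sup>2) / a\<^sup>2" using assms by (simp add: field_simps)
    have "(F has_real_derivative
       ?q +
       (1 / a) * inverse (1 + (y / a)\<^sup>2) / a ^ 3) (at y)"
    proof -
      have "((\<lambda>y. y / (a\<^sup>2 * (a\<^sup>2 + y\<^sup>2))) has_real_derivative
          ?q) (at y)"
        using assms pos[of y] by (auto intro!: derivative_eq_intros simp: power2_eq_square mult_ac)
      moreover have "((\<lambda>y. arctan (y / a)) has_real_derivative (1 / a) * inverse (1 + (y / a)\<^sup>2)) (at y)"
        by (auto intro!: derivative_eq_intros simp: mult_ac divide_inverse)
      ultimately show ?thesis
        unfolding F_def by (intro DERIV_add DERIV_cdivide)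
    qed
    also have "?q +
       (1 / a) * inverse (1 + (y / a)\<^sup>2) / a ^ 3 = 2 / (a\<^sup>2 + y\<^sup>2)\<^sup>2"
    proof -
      have "?q
          = (a\<^sup>2 * (a\<^sup>2 - y\<^sup>2)) / (a\<^sup>2 * (a\<^sup>2 * (a\<^sup>2 + y\<^sup>2)\<^sup>2))"
        by (rule arg_cong2[where f = "(/)"]) (simp_all add: algebra_simps power2_eq_square)
      then have "?q
          = (a\<^sup>2 - y\<^sup>2) / (a\<^sup>2 * (a\<^sup>2 + y\<^sup>2)\<^sup>2)"
        by (simp only: mult_divide_mult_cancel_left[OF \<open>a\<^sup>2 \<noteq> 0\<close>])
      moreover have "(1 / a) * inverse (1 + (y / a)\<^sup>2) / a ^ 3 = (a\<^sup>2 + y\<^sup>2) / (a\<^sup>2 * (a\<^sup>2 + y\<^sup>2)\<^sup>2)"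
      proof -
        have "(1 / a) * inverse (S / a\<^sup>2) / a ^ 3 = S / (a\<^sup>2 * S\<^sup>2)" if "S > 0" for S
          using assms that by (simp add: field_simps power2_eq_square power3_eq_cube)
        from this[OF pos] show ?thesis unfolding * .
      qed
      ultimately show ?thesis
        using assms pos[of y] by (simp add: add_divide_distrib[symmetric])
    qed
    finally show ?thesis .
  qed
  moreover have "continuous_on UNIV (\<lambda>y. 2 / (a\<^sup>2 + y\<^sup>2)\<^sup>2)"
    by (intro continuous_intros) (metis pos less_irrefl power_not_zero)
  moreover have "(F \<longlongrightarrow> 0 + - (pi / 2) / a ^ 3) at_bot"
  proof -
    have "((\<lambda>y. y / (a\<^sup>2 * (a\<^sup>2 + y\<^sup>2))) \<longlongrightarrow> 0) at_bot"
      using assms by real_asymp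
    moreover have "filterlim (\<lambda>y. y / a) at_bot at_bot"
      using assms by real_asymp
    then have "((\<lambda>y. arctan (y / a)) \<longlongrightarrow> - (pi / 2)) at_bot"
      by (rule filterlim_compose[OF tendsto_arctan_at_bot])
    ultimately show ?thesis
      unfolding F_def using assms by (intro tendsto_add tendsto_divide tendsto_const) auto
  qed
  moreover have "(F \<longlongrightarrow> 0 + (pi / 2) / a ^ 3) at_top"
  proof -
    have "((\<lambda>y. y / (a\<^sup>2 * (a\<^sup>2 + y\<^sup>2))) \<longlongrightarrow> 0) at_top"
      using assms by real_asymp
    moreover have "filterlim (\<lambda>y. y / a) at_top at_top"
      using assms by real_asymp
    then have "((\<lambda>y. arctan (y / a)) \<longlongrightarrow> (pi / 2)) at_top"
      by (rule filterlim_compose[OF tendsto_arctan_at_top])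
    ultimately show ?thesis
      unfolding F_def using assms by (intro tendsto_add tendsto_divide tendsto_const) auto
  qed
  ultimately have "(\<integral>\<^sup>+y. ennreal (2 / (a\<^sup>2 + y\<^sup>2)\<^sup>2) \<partial>lborel) = ennreal ((pi / 2) / a ^ 3 - - (pi / 2) / a ^ 3)"
    by (intro nn_integral_FTC_whole_line[where F = F]) auto
  then show ?thesis by (simp add: field_simps)
qed

text \<open>Integrating out the imaginary part leaves \<open>pi / (1 + x\<^sup>2)\<close> to the
  power 3/2, which has antiderivative \<open>pi * x / sqrt (1 + x\<^sup>2)\<close>. The total 2 pi
  is the constant in the Laplacian of ln |z|.\<close>

lemma nn_integral_fundamental_kernel:
  "(\<integral>\<^sup>+z. ennreal (2 / (1 + (cmod z)\<^sup>2)\<^sup>2) \<partial>lborel) = ennreal (2 * pi)"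
proof -
  have pos: "1 + x\<^sup>2 > 0" for x :: real by (simp add: add_pos_nonneg)
  define F where "F = (\<lambda>x::real. pi * (x / sqrt (1 + x\<^sup>2)))"
  have "(F has_real_derivative pi / (sqrt (1 + x\<^sup>2)) ^ 3) (at x)" for x
  proof -
    define s where "s = sqrt (1 + x\<^sup>2)"
    have s: "s > 0" "s * s = 1 + x * x" using pos[of x] by (auto simp: s_def power2_eq_square)
    have "((\<lambda>x. x / sqrt (1 + x\<^sup>2)) has_real_derivative
        (1 * s - x * (inverse s / 2 * (2 * x))) / (s * s)) (at x)"
      unfolding s_def using pos[of x]
      by (auto intro!: derivative_eq_intros simp: power2_eq_square)
    then have "(F has_real_derivative pi * ((1 * s - x * (inverse s / 2 * (2 * x))) / (s * s))) (at x)"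
      unfolding F_def by (rule DERIV_cmult)
    also have "pi * ((1 * s - x * (inverse s / 2 * (2 * x))) / (s * s)) = pi * ((s * s - x * x) / s ^ 3)"
      using s(1) by (simp add: field_simps power3_eq_cube)
    also have "\<dots> = pi / s ^ 3" by (simp add: s(2))
    finally show ?thesis by (simp add: s_def)
  qed
  moreover have "continuous_on UNIV (\<lambda>x. pi / (sqrt (1 + x\<^sup>2)) ^ 3)"
    by (intro continuous_intros) (simp add: less_imp_neq[OF pos, symmetric])
  moreover have "(F \<longlongrightarrow> - pi) at_bot" "(F \<longlongrightarrow> pi) at_top"
    unfolding F_def by real_asymp+
  ultimately have outer: "(\<integral>\<^sup>+x. ennreal (pi / (sqrt (1 + x\<^sup>2)) ^ 3) \<partial>lborel) = ennreal (pi - - pi)"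
    by (intro nn_integral_FTC_whole_line[where F = F]) auto
  have "(\<integral>\<^sup>+z. ennreal (2 / (1 + (cmod z)\<^sup>2)\<^sup>2) \<partial>lborel) =
      (\<integral>\<^sup>+x. \<integral>\<^sup>+y. ennreal (2 / ((sqrt (1 + x\<^sup>2))\<^sup>2 + y\<^sup>2)\<^sup>2) \<partial>lborel \<partial>lborel)"
    by (subst nn_integral_complex) (auto simp: cmod_def add_nonneg_nonneg add.assoc)
  also have "\<dots> = (\<integral>\<^sup>+x. ennreal (pi / (sqrt (1 + x\<^sup>2)) ^ 3) \<partial>lborel)"
    using pos by (subst nn_integral_inverse_square) auto
  finally show ?thesis using outer by simp
qed

lemma nn_integral_inverse_sqrt:
  "(\<integral>\<^sup>+x. indicator {-1..1} x * ennreal (1 / sqrt \<bar>x\<bar>) \<partial>lborel) < \<infinity>"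
proof -
  have deriv: "((\<lambda>x. 2 * sqrt x) has_real_derivative 1 / sqrt x) (at x)" if "x > 0" for x :: real
    using that by (auto intro!: derivative_eq_intros simp: field_simps)
  have "set_integrable lborel (einterval 0 1) (\<lambda>x. 1 / sqrt x)"
  proof (rule interval_integral_FTC_nonneg(1)[where F = "\<lambda>x. 2 * sqrt x" and A = 0 and B = 2])
    show "(((\<lambda>x. 2 * sqrt x) \<circ> real_of_ereal) \<longlongrightarrow> 0) (at_right 0)"
      unfolding zero_ereal_def ereal_tendsto_simps by real_asymp
    show "(((\<lambda>x. 2 * sqrt x) \<circ> real_of_ereal) \<longlongrightarrow> 2) (at_left 1)"
      unfolding one_ereal_def ereal_tendsto_simps
      by (intro tendsto_eq_intros) auto
    show "isCont (\<lambda>x. 1 / sqrt x) x" if "0 < ereal x" for x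
      using that by (intro continuous_intros) auto
  qed (use deriv in auto)
  moreover have "einterval 0 1 = {0<..<1}" by (auto simp: einterval_def)
  ultimately have int: "integrable lborel (\<lambda>x. indicator {0<..<1} x *\<^sub>R (1 / sqrt x))"
    by (simp add: set_integrable_def)
  define J where "J = (\<integral>\<^sup>+x. indicator {0<..<1} x * ennreal (1 / sqrt \<bar>x\<bar>) \<partial>lborel)"
  have "J = (\<integral>\<^sup>+x. ennreal (norm (indicator {0<..<1} x *\<^sub>R (1 / sqrt x))) \<partial>lborel)"
    unfolding J_def by (intro nn_integral_cong) (auto simp: indicator_def)
  with int have J: "J < \<infinity>"
    by (simp add: integrable_iff_bounded)
  have J': "(\<integral>\<^sup>+x. indicator {-1<..<0} x * ennreal (1 / sqrt \<bar>x\<bar>) \<partial>lborel) = J"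
    unfolding J_def by (subst nn_integral_real_affine[where c = "-1" and t = 0])
      (auto intro!: nn_integral_cong simp: indicator_def)
  have "AE x in lborel. x \<noteq> 1 \<and> x \<noteq> -1 \<and> x \<noteq> (0::real)"
    by (intro AE_conjI AE_lborel_singleton)
  then have "(\<integral>\<^sup>+x. indicator {-1..1} x * ennreal (1 / sqrt \<bar>x\<bar>) \<partial>lborel) \<le>
      (\<integral>\<^sup>+x. indicator {-1<..<0} x * ennreal (1 / sqrt \<bar>x\<bar>) +
        indicator {0<..<1} x * ennreal (1 / sqrt \<bar>x\<bar>) \<partial>lborel)"
    by (intro nn_integral_mono_AE) (elim eventually_mono, auto simp: indicator_def)
  also have "\<dots> = J + J"
    by (subst nn_integral_add) (auto simp: J' J_def)
  also have "\<dots> < \<infinity>" using J by simp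
  finally show ?thesis .
qed

text \<open>Since |x| |y| is at most |x + iy|^2, the function 1/|z| is dominated by a product of two
  integrable functions of one variable, and Cartesian coordinates suffice.\<close>

lemma nn_integral_inverse_norm_unit_disc:
  "(\<integral>\<^sup>+z. indicator (cball 0 1) z * ennreal (1 / cmod z) \<partial>lborel) < \<infinity>"
proof -
  define h where "h = (\<lambda>x::real. indicator {-1..1} x * ennreal (1 / sqrt \<bar>x\<bar>))"
  define c where "c = (\<integral>\<^sup>+x. h x \<partial>lborel)"
  have [measurable]: "h \<in> borel_measurable borel" unfolding h_def by measurable
  \<comment> \<open>The axes must be removed: there \<open>1 / sqrt 0 = 0\<close> makes the
    dominating product vanish while 1/|z| may be positive.\<close>
  have AE0: "AE x in lborel. x \<noteq> (0::real)" by (rule AE_lborel_singleton)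
  have "(\<integral>\<^sup>+z. indicator (cball 0 1) z * ennreal (1 / cmod z) \<partial>lborel) =
     (\<integral>\<^sup>+x. \<integral>\<^sup>+y. indicator (cball 0 1) (Complex x y) * ennreal (1 / cmod (Complex x y)) \<partial>lborel \<partial>lborel)"
    by (rule nn_integral_complex) (auto intro!: borel_measurable_times_ennreal borel_measurable_indicator)
  also have "\<dots> \<le> (\<integral>\<^sup>+x. \<integral>\<^sup>+y. h x * h y \<partial>lborel \<partial>lborel)"
  proof (rule nn_integral_mono_AE, rule AE_mp[OF AE0], rule AE_I2, rule impI,
      rule nn_integral_mono_AE, rule AE_mp[OF AE0], rule AE_I2, rule impI)
    fix x y :: real assume "x \<noteq> 0" "y \<noteq> 0"
    have "\<bar>x\<bar> * \<bar>y\<bar> \<le> (cmod (Complex x y))\<^sup>2"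
    proof -
      have "0 \<le> (\<bar>x\<bar> - \<bar>y\<bar>)\<^sup>2 + x\<^sup>2 + y\<^sup>2" by simp
      also have "\<dots> = 2 * ((cmod (Complex x y))\<^sup>2 - \<bar>x\<bar> * \<bar>y\<bar>)"
        by (simp add: cmod_def power2_diff)
      finally show ?thesis by simp
    qed
    then have "sqrt \<bar>x\<bar> * sqrt \<bar>y\<bar> \<le> cmod (Complex x y)"
      using real_le_lsqrt[of "cmod (Complex x y)" "\<bar>x\<bar> * \<bar>y\<bar>"] by (simp add: real_sqrt_mult)
    moreover have "0 < sqrt \<bar>x\<bar> * sqrt \<bar>y\<bar>"
      using \<open>x \<noteq> 0\<close> \<open>y \<noteq> 0\<close> by simp
    ultimately have "1 / cmod (Complex x y) \<le> 1 / (sqrt \<bar>x\<bar> * sqrt \<bar>y\<bar>)"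
      by (intro frac_le) auto
    then have "ennreal (1 / cmod (Complex x y)) \<le> ennreal (1 / sqrt \<bar>x\<bar> * (1 / sqrt \<bar>y\<bar>))"
      by (intro ennreal_leI) simp
    also have "\<dots> = ennreal (1 / sqrt \<bar>x\<bar>) * ennreal (1 / sqrt \<bar>y\<bar>)"
      by (rule ennreal_mult) auto
    finally have le: "ennreal (1 / cmod (Complex x y)) \<le> ennreal (1 / sqrt \<bar>x\<bar>) * ennreal (1 / sqrt \<bar>y\<bar>)" .
    show "indicator (cball 0 1) (Complex x y) * ennreal (1 / cmod (Complex x y)) \<le> h x * h y"
    proof (cases "Complex x y \<in> cball 0 1")
      case True
      then have "x \<in> {-1..1}" "y \<in> {-1..1}"
        using abs_Re_le_cmod[of "Complex x y"] abs_Im_le_cmod[of "Complex x y"] by auto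
      with True le show ?thesis by (simp add: h_def)
    qed simp
  qed
  also have "\<dots> = c * c"
    by (simp add: nn_integral_cmult nn_integral_multc c_def)
  also have "\<dots> < \<infinity>"
    using nn_integral_inverse_sqrt by (simp add: c_def h_def ennreal_mult_less_top)
  finally show ?thesis .
qed

section \<open>Test functions\<close>

lemma partial_x_eq: "(f has_derivative D) (at z) \<Longrightarrow> partial_x f z = D 1"
  and partial_y_eq: "(f has_derivative D) (at z) \<Longrightarrow> partial_y f z = D \<i>"
  by (simp_all add: partial_x_def partial_y_def frechet_derivative_at[symmetric])

lemma times_continuously_differentiable_imp_continuous:
  "times_continuously_differentiable m f \<Longrightarrow> continuous_on UNIV f"
  by (cases m) (auto intro!: continuous_at_imp_continuous_on differentiable_imp_continuous_within)

lemma times_continuously_differentiable_SucD: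
  "times_continuously_differentiable (Suc m) f \<Longrightarrow> times_continuously_differentiable m f"
proof (induction m arbitrary: f)
  case 0
  from times_continuously_differentiable_imp_continuous[OF this]
  show ?case by (simp only: times_continuously_differentiable.simps(1))
next
  case (Suc m)
  from Suc.prems have f: "\<forall>z. f differentiable (at z)"
    "times_continuously_differentiable (Suc m) (partial_x f)"
    "times_continuously_differentiable (Suc m) (partial_y f)"
    by simp_all
  with Suc.IH[OF f(2)] Suc.IH[OF f(3)] show ?case
    by (simp only: times_continuously_differentiable.simps(2) simp_thms)
qed

lemma times_continuously_differentiable_const:
  "times_continuously_differentiable m (\<lambda>_. c)"
proof (induction m arbitrary: c)
  case (Suc m)
  have "partial_x (\<lambda>_. c) = (\<lambda>_. 0)" "partial_y (\<lambda>_. c) = (\<lambda>_. 0)"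
    by (auto intro!: partial_x_eq[where D = "\<lambda>_. 0"] partial_y_eq[where D = "\<lambda>_. 0"])
  with Suc show ?case by simp
qed simp

lemma times_continuously_differentiable_bounded_linear:
  "bounded_linear f \<Longrightarrow> times_continuously_differentiable m f"
proof (cases m)
  case (Suc m)
  assume f: "bounded_linear f"
  then have D: "(f has_derivative f) (at z)" for z by (rule bounded_linear_imp_has_derivative)
  have "partial_x f = (\<lambda>_. f 1)" "partial_y f = (\<lambda>_. f \<i>)"
    using partial_x_eq[OF D] partial_y_eq[OF D] by auto
  with Suc D show ?thesis
    by (auto simp: times_continuously_differentiable_const differentiable_def)
qed (simp add: linear_continuous_on)

lemma times_continuously_differentiable_add:
  "times_continuously_differentiable m f \<Longrightarrow> times_continuously_differentiable m g \<Longrightarrow>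
    times_continuously_differentiable m (\<lambda>z. f z + g z)"
proof (induction m arbitrary: f g)
  case (Suc m)
  obtain Df Dg where D: "\<And>z. (f has_derivative Df z) (at z)" "\<And>z. (g has_derivative Dg z) (at z)"
    using Suc.prems by (auto simp: differentiable_def) metis
  have "((\<lambda>z. f z + g z) has_derivative (\<lambda>h. Df z h + Dg z h)) (at z)" for z
    by (intro has_derivative_add D)
  from partial_x_eq[OF this] partial_y_eq[OF this]
  have "partial_x (\<lambda>z. f z + g z) = (\<lambda>z. partial_x f z + partial_x g z)"
    "partial_y (\<lambda>z. f z + g z) = (\<lambda>z. partial_y f z + partial_y g z)"
    using partial_x_eq[OF D(1)] partial_x_eq[OF D(2)] partial_y_eq[OF D(1)] partial_y_eq[OF D(2)]
    by (auto simp: fun_eq_iff)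
  with Suc show ?case by auto
qed (auto intro: continuous_intros)

lemma times_continuously_differentiable_mult:
  "times_continuously_differentiable m f \<Longrightarrow> times_continuously_differentiable m g \<Longrightarrow>
    times_continuously_differentiable m (\<lambda>z. f z * g z)"
proof (induction m arbitrary: f g)
  case (Suc m)
  obtain Df Dg where D: "\<And>z. (f has_derivative Df z) (at z)" "\<And>z. (g has_derivative Dg z) (at z)"
    using Suc.prems by (auto simp: differentiable_def) metis
  have "((\<lambda>z. f z * g z) has_derivative (\<lambda>h. f z * Dg z h + Df z h * g z)) (at z)" for z
    by (intro has_derivative_mult D)
  from partial_x_eq[OF this] partial_y_eq[OF this]
  have "partial_x (\<lambda>z. f z * g z) = (\<lambda>z. f z * partial_x g z + partial_x f z * g z)"
    "partial_y (\<lambda>z. f z * g z) = (\<lambda>z. f z * partial_y g z + partial_y f z * g z)"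
    using partial_x_eq[OF D(1)] partial_x_eq[OF D(2)] partial_y_eq[OF D(1)] partial_y_eq[OF D(2)]
    by (auto simp: fun_eq_iff)
  with Suc show ?case
    using times_continuously_differentiable_SucD[OF Suc.prems(1)]
      times_continuously_differentiable_SucD[OF Suc.prems(2)]
    by (auto intro!: times_continuously_differentiable_add)
qed (auto intro: continuous_intros)

text \<open>Lets a Stone-Weierstrass polynomial become a test function once it is multiplied by a
  bump.\<close>

lemma times_continuously_differentiable_real_polynomial:
  fixes p :: "complex \<Rightarrow> real"
  assumes "real_polynomial_function p"
  shows "times_continuously_differentiable m (\<lambda>z. complex_of_real (p z))"
  using assms
proof induction
  case (linear f)
  then show ?case
    by (intro times_continuously_differentiable_bounded_linear bounded_linear_compose[OF bounded_linear_of_real])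
next
  case (const c)
  show ?case by (rule times_continuously_differentiable_const)
next
  case (add f1 f2)
  then show ?case using times_continuously_differentiable_add by simp
next
  case (mult f1 f2)
  then show ?case using times_continuously_differentiable_mult by simp
qed

lemma partial_eq_0:
  assumes "open S" "\<And>z. z \<in> S \<Longrightarrow> f z = 0" "z \<in> S"
  shows "partial_x f z = 0" "partial_y f z = 0"
proof -
  have "(f has_derivative (\<lambda>_. 0)) (at z)"
    by (rule has_derivative_transform_within_open[OF has_derivative_const assms(1,3)])
       (use assms(2) in auto)
  then show "partial_x f z = 0" "partial_y f z = 0"
    by (simp_all add: partial_x_eq partial_y_eq)
qed

text \<open>Bounded sets have compact closure in the plane, so compact support can be handled
  through a radius beyond which the function vanishes.\<close>

lemma test_functions_iff:
  "\<phi> \<in> test_functions \<longleftrightarrow>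
    (\<forall>m. times_continuously_differentiable m \<phi>) \<and> (\<exists>R. \<forall>z. R \<le> cmod z \<longrightarrow> \<phi> z = 0)"
proof -
  have "bounded {z. \<phi> z \<noteq> 0} \<longleftrightarrow> (\<exists>R. \<forall>z. R \<le> cmod z \<longrightarrow> \<phi> z = 0)"
  proof
    assume "bounded {z. \<phi> z \<noteq> 0}"
    then obtain B where "\<forall>z\<in>{z. \<phi> z \<noteq> 0}. cmod z < B" by (metis bounded_pos_less)
    then have "\<forall>z. B \<le> cmod z \<longrightarrow> \<phi> z = 0" by force
    then show "\<exists>R. \<forall>z. R \<le> cmod z \<longrightarrow> \<phi> z = 0" by blast
  next
    assume "\<exists>R. \<forall>z. R \<le> cmod z \<longrightarrow> \<phi> z = 0"
    then obtain R where "\<forall>z. R \<le> cmod z \<longrightarrow> \<phi> z = 0" by blast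
    then show "bounded {z. \<phi> z \<noteq> 0}"
      by (intro boundedI[of _ R]) (force simp: not_le)
  qed
  then show ?thesis by (simp add: test_functions_def compact_closure)
qed

lemma partial_test_functions:
  assumes "\<phi> \<in> test_functions"
  shows "partial_x \<phi> \<in> test_functions" "partial_y \<phi> \<in> test_functions"
proof -
  have tcd: "times_continuously_differentiable (Suc m) \<phi>" for m
    using assms unfolding test_functions_iff by blast
  obtain R where R: "\<And>z. R \<le> cmod z \<Longrightarrow> \<phi> z = 0"
    using assms unfolding test_functions_iff by blast
  \<comment> \<open>Partial derivatives are seen to vanish only on an open set of zeros, which
    excludes the circle of radius R; hence the radius \<open>R + 1\<close> below.\<close>
  have "open {z. R < cmod z}"
    by (intro open_Collect_less continuous_intros)
  then have 0: "partial_x \<phi> z = 0" "partial_y \<phi> z = 0" if "R + 1 \<le> cmod z" for z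
    using partial_eq_0[of "{z. R < cmod z}" \<phi> z] that R by auto
  show "partial_x \<phi> \<in> test_functions" "partial_y \<phi> \<in> test_functions"
    unfolding test_functions_iff using tcd 0 by (auto intro!: exI[of _ "R + 1"])
qed

lemma test_functions_add:
  assumes "\<phi> \<in> test_functions" "\<psi> \<in> test_functions"
  shows "(\<lambda>z. \<phi> z + \<psi> z) \<in> test_functions"
proof -
  obtain R S where "\<forall>z. R \<le> cmod z \<longrightarrow> \<phi> z = 0" "\<forall>z. S \<le> cmod z \<longrightarrow> \<psi> z = 0"
    using assms unfolding test_functions_iff by blast
  then have "\<forall>z. max R S \<le> cmod z \<longrightarrow> \<phi> z + \<psi> z = 0" by auto
  with assms show ?thesis
    unfolding test_functions_iff by (blast intro: times_continuously_differentiable_add)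
qed

lemma test_functions_mult:
  assumes "\<And>m. times_continuously_differentiable m f" "\<psi> \<in> test_functions"
  shows "(\<lambda>z. f z * \<psi> z) \<in> test_functions"
  using assms unfolding test_functions_iff
  by (auto intro: times_continuously_differentiable_mult)

lemma laplacian_test_functions:
  "\<phi> \<in> test_functions \<Longrightarrow> laplacian \<phi> \<in> test_functions"
  unfolding laplacian_def[abs_def]
  by (intro test_functions_add partial_test_functions)

lemma test_functions_continuous: "\<phi> \<in> test_functions \<Longrightarrow> continuous_on UNIV \<phi>"
  unfolding test_functions_iff using times_continuously_differentiable_imp_continuous[of 0] by metis

lemma test_functions_differentiable: "\<phi> \<in> test_functions \<Longrightarrow> \<phi> differentiable (at z)"
  unfolding test_functions_iff using times_continuously_differentiable.simps(2)[of 0] by metis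

lemma test_functions_vanish: "\<phi> \<in> test_functions \<Longrightarrow> \<exists>R. \<forall>z. R \<le> cmod z \<longrightarrow> \<phi> z = 0"
  by (simp add: test_functions_iff)

lemma test_functions_bounded:
  assumes "\<phi> \<in> test_functions"
  obtains B where "B > 0" "\<And>z. cmod (\<phi> z) \<le> B"
proof -
  obtain R where R: "\<forall>z. R \<le> cmod z \<longrightarrow> \<phi> z = 0"
    using test_functions_vanish[OF assms] by auto
  have "compact (\<phi> ` cball 0 R)"
    by (intro compact_continuous_image continuous_on_subset[OF test_functions_continuous[OF assms]]) auto
  then obtain B where B: "B > 0" "\<And>z. z \<in> \<phi> ` cball 0 R \<Longrightarrow> cmod z \<le> B"
    by (meson bounded_pos compact_imp_bounded)
  have "cmod (\<phi> z) \<le> B" for z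
    using B R by (cases "cmod z \<le> R") auto
  with B(1) show thesis by (rule that)
qed

lemma has_vector_derivative_partial_x:
  assumes "f differentiable (at (Complex x y))"
  shows "((\<lambda>x. f (Complex x y)) has_vector_derivative partial_x f (Complex x y)) (at x)"
proof -
  define D where "D = frechet_derivative f (at (Complex x y))"
  have D: "(f has_derivative D) (at (Complex x y))"
    using assms by (simp add: D_def frechet_derivative_works)
  have "((\<lambda>x. Complex x y) has_derivative (\<lambda>h. of_real h)) (at x)"
    unfolding Complex_eq by (auto intro!: derivative_eq_intros)
  from has_derivative_compose[OF this, of f D] D
  have "((\<lambda>x. f (Complex x y)) has_derivative (\<lambda>h. D (of_real h))) (at x)" by simp
  moreover have "D (of_real h) = h *\<^sub>R D 1" for h
    using linear_scale[OF has_derivative_linear[OF D], of h 1] by (simp add: scaleR_conv_of_real)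
  ultimately show ?thesis
    by (simp add: has_vector_derivative_def partial_x_def D_def)
qed

lemma has_vector_derivative_partial_y:
  assumes "f differentiable (at (Complex x y))"
  shows "((\<lambda>y. f (Complex x y)) has_vector_derivative partial_y f (Complex x y)) (at y)"
proof -
  define D where "D = frechet_derivative f (at (Complex x y))"
  have D: "(f has_derivative D) (at (Complex x y))"
    using assms by (simp add: D_def frechet_derivative_works)
  have "((\<lambda>y. Complex x y) has_derivative (\<lambda>h. \<i> * of_real h)) (at y)"
    unfolding Complex_eq by (auto intro!: derivative_eq_intros)
  from has_derivative_compose[OF this, of f D] D
  have "((\<lambda>y. f (Complex x y)) has_derivative (\<lambda>h. D (\<i> * of_real h))) (at y)" by simp
  moreover have "D (\<i> * of_real h) = h *\<^sub>R D \<i>" for h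
    using linear_scale[OF has_derivative_linear[OF D], of h \<i>] by (simp add: scaleR_conv_of_real mult.commute)
  ultimately show ?thesis
    by (simp add: has_vector_derivative_def partial_y_def D_def)
qed

text \<open>Green's second identity, one coordinate at a time: g f'' - g'' f is the derivative of g
  f' - g' f, whose integral along every line is 0 because f has compact support.\<close>

lemma integral_laplacian_by_parts:
  fixes g gx gy gxx gyy :: "complex \<Rightarrow> real"
  assumes \<phi>: "\<phi> \<in> test_functions"
    and gx: "\<And>x y. ((\<lambda>x. g (Complex x y)) has_real_derivative gx (Complex x y)) (at x)"
    and gy: "\<And>x y. ((\<lambda>y. g (Complex x y)) has_real_derivative gy (Complex x y)) (at y)"
    and gxx: "\<And>x y. ((\<lambda>x. gx (Complex x y)) has_real_derivative gxx (Complex x y)) (at x)"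
    and gyy: "\<And>x y. ((\<lambda>y. gy (Complex x y)) has_real_derivative gyy (Complex x y)) (at y)"
    and cont: "continuous_on UNIV g" "continuous_on UNIV gxx" "continuous_on UNIV gyy"
  shows "(LINT z|lborel. complex_of_real (g z) * laplacian \<phi> z) =
    (LINT z|lborel. complex_of_real (gxx z + gyy z) * \<phi> z)"
proof -
  note T = \<phi> partial_test_functions[OF \<phi>] partial_test_functions(1)[OF partial_test_functions(1)[OF \<phi>]]
    partial_test_functions(2)[OF partial_test_functions(2)[OF \<phi>]]
  note [continuous_intros] = cont T[THEN test_functions_continuous]
  obtain R1 where R1: "\<forall>z. R1 \<le> cmod z \<longrightarrow> \<phi> z = 0"
    using test_functions_vanish[OF T(1)] by auto
  obtain R2 where R2: "\<forall>z. R2 \<le> cmod z \<longrightarrow> partial_x \<phi> z = 0"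
    using test_functions_vanish[OF T(2)] by auto
  obtain R3 where R3: "\<forall>z. R3 \<le> cmod z \<longrightarrow> partial_y \<phi> z = 0"
    using test_functions_vanish[OF T(3)] by auto
  obtain R4 where R4: "\<forall>z. R4 \<le> cmod z \<longrightarrow> partial_x (partial_x \<phi>) z = 0"
    using test_functions_vanish[OF T(4)] by auto
  obtain R5 where R5: "\<forall>z. R5 \<le> cmod z \<longrightarrow> partial_y (partial_y \<phi>) z = 0"
    using test_functions_vanish[OF T(5)] by auto
  define R where "R = Max {R1, R2, R3, R4, R5}"
  have "R1 \<le> R" "R2 \<le> R" "R3 \<le> R" "R4 \<le> R" "R5 \<le> R" by (auto simp: R_def)
  then have 0: "\<phi> z = 0" "partial_x \<phi> z = 0" "partial_y \<phi> z = 0" "partial_x (partial_x \<phi>) z = 0"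
      "partial_y (partial_y \<phi>) z = 0" if "R \<le> cmod z" for z
    using that R1 R2 R3 R4 R5 by (meson order_trans)+
  define hx where "hx = (\<lambda>z. complex_of_real (g z) * partial_x (partial_x \<phi>) z - complex_of_real (gxx z) * \<phi> z)"
  define hy where "hy = (\<lambda>z. complex_of_real (g z) * partial_y (partial_y \<phi>) z - complex_of_real (gyy z) * \<phi> z)"
  have conts: "continuous_on UNIV hx" "continuous_on UNIV hy"
    unfolding hx_def hy_def by (intro continuous_intros)+
  let ?h = "\<lambda>z. complex_of_real (g z) * partial_x \<phi> z - complex_of_real (gx z) * \<phi> z"
  have hx: "(LINT z|lborel. hx z) = 0"
  proof (rule integral_horizontal_derivative_eq_0[where R = R and h = ?h])
    fix x y
    have "((\<lambda>x. ?h (Complex x y))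
      has_vector_derivative
      ((complex_of_real (g (Complex x y)) * partial_x (partial_x \<phi>) (Complex x y) +
         complex_of_real (gx (Complex x y)) * partial_x \<phi> (Complex x y)) -
       (complex_of_real (gx (Complex x y)) * partial_x \<phi> (Complex x y) +
         complex_of_real (gxx (Complex x y)) * \<phi> (Complex x y)))) (at x)"
      by (intro has_vector_derivative_diff has_vector_derivative_mult has_vector_derivative_of_real gx gxx
          has_vector_derivative_partial_x test_functions_differentiable T)
    then show "((\<lambda>x. ?h (Complex x y))
      has_vector_derivative hx (Complex x y)) (at x)"
      by (simp add: hx_def)
  qed (auto simp: hx_def 0 intro: conts(1)[unfolded hx_def])
  let ?h = "\<lambda>z. complex_of_real (g z) * partial_y \<phi> z - complex_of_real (gy z) * \<phi> z"
  have hy: "(LINT z|lborel. hy z) = 0"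
  proof (rule integral_vertical_derivative_eq_0[where R = R and h = ?h])
    fix x y
    have "((\<lambda>y. ?h (Complex x y))
      has_vector_derivative
      ((complex_of_real (g (Complex x y)) * partial_y (partial_y \<phi>) (Complex x y) +
         complex_of_real (gy (Complex x y)) * partial_y \<phi> (Complex x y)) -
       (complex_of_real (gy (Complex x y)) * partial_y \<phi> (Complex x y) +
         complex_of_real (gyy (Complex x y)) * \<phi> (Complex x y)))) (at y)"
      by (intro has_vector_derivative_diff has_vector_derivative_mult has_vector_derivative_of_real gy gyy
          has_vector_derivative_partial_y test_functions_differentiable T)
    then show "((\<lambda>y. ?h (Complex x y))
      has_vector_derivative hy (Complex x y)) (at y)"
      by (simp add: hy_def)
  qed (auto simp: hy_def 0 intro: conts(2)[unfolded hy_def])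
  have int: "integrable lborel hx" "integrable lborel hy"
      "integrable lborel (\<lambda>z. complex_of_real (gxx z + gyy z) * \<phi> z)"
    using 0 by (auto intro!: integrable_continuous_bounded_support[where R = R] conts continuous_intros
        simp: hx_def hy_def)
  have "(LINT z|lborel. complex_of_real (g z) * laplacian \<phi> z) =
      (LINT z|lborel. hx z + hy z + complex_of_real (gxx z + gyy z) * \<phi> z)"
    by (intro Bochner_Integration.integral_cong) (auto simp: hx_def hy_def laplacian_def algebra_simps)
  also have "\<dots> = (LINT z|lborel. complex_of_real (gxx z + gyy z) * \<phi> z)"
    using int hx hy by simp
  finally show ?thesis .
qed

section \<open>The fundamental solution of the Laplacian\<close>

lemma nn_integral_lborel_shift:
  fixes w :: "'a::euclidean_space"
  assumes [measurable]: "f \<in> borel_measurable borel"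
  shows "(\<integral>\<^sup>+z. f (w + z) \<partial>lborel) = (\<integral>\<^sup>+z. f z \<partial>lborel)"
proof -
  have "(\<integral>\<^sup>+z. f z \<partial>lborel) = (\<integral>\<^sup>+z. f z \<partial>distr lborel borel ((+) w))"
    by (simp add: lborel_distr_plus)
  also have "\<dots> = (\<integral>\<^sup>+z. f (w + z) \<partial>lborel)"
    by (rule nn_integral_distr) auto
  finally show ?thesis ..
qed

lemma nn_integral_inverse_norm_disc:
  "(\<integral>\<^sup>+z. indicator (cball w 1) z * ennreal (1 / cmod (z - w)) \<partial>lborel) =
    (\<integral>\<^sup>+z. indicator (cball 0 1) z * ennreal (1 / cmod z) \<partial>lborel)"
proof -
  have "(\<integral>\<^sup>+z. indicator (cball w 1) z * ennreal (1 / cmod (z - w)) \<partial>lborel) =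
      (\<integral>\<^sup>+z. indicator (cball w 1) (w + z) * ennreal (1 / cmod (w + z - w)) \<partial>lborel)"
    by (rule nn_integral_lborel_shift[symmetric])
       (auto intro!: borel_measurable_times_ennreal borel_measurable_indicator)
  also have "\<dots> = (\<integral>\<^sup>+z. indicator (cball 0 1) z * ennreal (1 / cmod z) \<partial>lborel)"
    by (intro nn_integral_cong) (auto simp: indicator_def dist_norm)
  finally show ?thesis .
qed

text \<open>Outside the unit disc around w the integrand is at most 1; inside, translation reduces
  it to the unit disc at the origin.\<close>

lemma integrable_inverse_norm_cball:
  fixes a w :: complex
  shows "integrable lborel (\<lambda>z. indicator (cball a R) z * (1 / cmod (z - w)))"
proof (rule integrableI_bounded)
  have [measurable]: "cball a R \<in> sets borel" by simp
  show "(\<lambda>z. indicator (cball a R) z * (1 / cmod (z - w))) \<in> borel_measurable lborel"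
    by measurable
  have "(\<integral>\<^sup>+z. ennreal (norm (indicator (cball a R) z * (1 / cmod (z - w)))) \<partial>lborel) \<le>
      (\<integral>\<^sup>+z. indicator (cball a R) z + indicator (cball w 1) z * ennreal (1 / cmod (z - w)) \<partial>lborel)"
  proof (rule nn_integral_mono)
    fix z :: complex
    have "ennreal (1 / cmod (z - w)) \<le> 1" if "z \<notin> cball w 1"
    proof -
      have "1 < cmod (z - w)" using that by (simp add: dist_norm norm_minus_commute)
      then show ?thesis by (simp add: divide_le_eq_1)
    qed
    then show "ennreal (norm (indicator (cball a R) z * (1 / cmod (z - w)))) \<le>
        indicator (cball a R) z + indicator (cball w 1) z * ennreal (1 / cmod (z - w))"
      by (cases "z \<in> cball a R"; cases "z \<in> cball w 1") (auto simp: indicator_def add_increasing)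
  qed
  also have "\<dots> = emeasure lborel (cball a R) +
      (\<integral>\<^sup>+z. indicator (cball 0 1) z * ennreal (1 / cmod z) \<partial>lborel)"
    unfolding nn_integral_inverse_norm_disc[of w, symmetric]
    by (subst nn_integral_add)
       (auto intro!: borel_measurable_times_ennreal borel_measurable_indicator)
  also have "\<dots> < \<infinity>"
    using nn_integral_inverse_norm_unit_disc emeasure_bounded_finite[of "cball a R"] by auto
  finally show "(\<integral>\<^sup>+z. ennreal (norm (indicator (cball a R) z * (1 / cmod (z - w)))) \<partial>lborel) < \<infinity>" .
qed

text \<open>Reduces integrability of the logarithm to that of |z - w| and 1/|z - w|. The case t = 0
  is covered by the conventions at 0.\<close>

lemma abs_ln_le:
  fixes t :: real
  assumes "0 \<le> t"
  shows "\<bar>ln t\<bar> \<le> t + 1 / t"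
proof (cases "t = 0")
  case False
  with assms have "t > 0" by simp
  then have "ln t \<le> t - 1" "ln (1 / t) \<le> 1 / t - 1"
    by (intro ln_le_minus_one; simp)+
  moreover have "ln (1 / t) = - ln t" using \<open>t > 0\<close> by (simp add: ln_div)
  moreover have "0 < t" "0 < 1 / t" using \<open>t > 0\<close> by auto
  ultimately show ?thesis by linarith
qed simp

lemma integrable_ln_cball:
  fixes a w :: complex
  shows "integrable lborel (\<lambda>z. indicator (cball a R) z * ln (cmod (z - w)))"
proof -
  have "integrable lborel (\<lambda>z. indicator (cball a R) z *\<^sub>R cmod (z - w))"
    by (intro borel_integrable_compact continuous_intros) auto
  then have "integrable lborel (\<lambda>z. indicator (cball a R) z *\<^sub>R cmod (z - w) +
      indicator (cball a R) z * (1 / cmod (z - w)))"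
    by (intro Bochner_Integration.integrable_add integrable_inverse_norm_cball)
  then show ?thesis
  proof (rule Bochner_Integration.integrable_bound)
    show "AE z in lborel. norm (indicator (cball a R) z * ln (cmod (z - w))) \<le>
      norm (indicator (cball a R) z *\<^sub>R cmod (z - w) + indicator (cball a R) z * (1 / cmod (z - w)))"
      by (rule AE_I2) (auto simp: indicator_def intro: order_trans[OF abs_ln_le])
  qed (auto intro!: borel_measurable_times borel_measurable_indicator)
qed

lemma integrable_ln_test_function:
  assumes "\<phi> \<in> test_functions"
  shows "integrable lborel (\<lambda>z. complex_of_real (ln (cmod (z - w))) * \<phi> z)"
proof -
  obtain R where R: "\<forall>z. R \<le> cmod z \<longrightarrow> \<phi> z = 0" using test_functions_vanish[OF assms] by auto
  obtain B where B: "B > 0" "\<And>z. cmod (\<phi> z) \<le> B" using test_functions_bounded[OF assms] by blast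
  have [measurable]: "\<phi> \<in> borel_measurable borel"
    using assms by (intro borel_measurable_continuous_onI test_functions_continuous)
  have "integrable lborel (\<lambda>z. B * (indicator (cball 0 R) z * ln (cmod (z - w))))"
    by (intro integrable_mult_right integrable_ln_cball)
  then show ?thesis
  proof (rule Bochner_Integration.integrable_bound)
    have "norm (complex_of_real (ln (cmod (z - w))) * \<phi> z) \<le>
        norm (B * (indicator (cball 0 R) z * ln (cmod (z - w))))" for z
      using R B by (cases "cmod z \<le> R") (auto simp: norm_mult indicator_def abs_mult mult.commute
          intro!: mult_right_mono)
    then show "AE z in lborel. norm (complex_of_real (ln (cmod (z - w))) * \<phi> z) \<le>
        norm (B * (indicator (cball 0 R) z * ln (cmod (z - w))))" by simp
  qed measurable
qed

text \<open>The Laplacian of (1/2) ln (|v|^2 + 1). Its rescalings form an approximate identity of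
  total mass 2 pi.\<close>

definition plane_kernel :: "complex \<Rightarrow> real" where
  "plane_kernel v = 2 / (1 + (cmod v)\<^sup>2)\<^sup>2"

lemma has_bochner_integral_plane_kernel: "has_bochner_integral lborel plane_kernel (2 * pi)"
  using nn_integral_fundamental_kernel
  by (intro has_bochner_integral_nn_integral) (auto simp: plane_kernel_def[abs_def])

text \<open>Substitution of \<open>w + \<epsilon> *\<^sub>R v\<close> for z, with Jacobian
  \<open>\<epsilon>\<^sup>2\<close> in the plane; the dependence on \<open>\<epsilon>\<close> moves
  from the kernel into the argument of \<open>\<phi>\<close>.\<close>

lemma integral_kernel_scaled:
  fixes \<phi> :: "complex \<Rightarrow> complex"
  assumes [measurable]: "\<phi> \<in> borel_measurable borel" and "\<epsilon> > 0"
  shows "(LINT z|lborel. complex_of_real (2 * \<epsilon>\<^sup>2 / ((cmod (z - w))\<^sup>2 + \<epsilon>\<^sup>2)\<^sup>2) * \<phi> z) =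
    (LINT v|lborel. complex_of_real (plane_kernel v) * \<phi> (w + \<epsilon> *\<^sub>R v))"
proof -
  define F where "F = (\<lambda>z. complex_of_real (2 * \<epsilon>\<^sup>2 / ((cmod (z - w))\<^sup>2 + \<epsilon>\<^sup>2)\<^sup>2) * \<phi> z)"
  have [measurable]: "F \<in> borel_measurable borel" unfolding F_def by measurable
  have "(lborel :: complex measure) = density (distr lborel borel (\<lambda>v. w + \<epsilon> *\<^sub>R v)) (\<lambda>_. ennreal (\<epsilon>\<^sup>2))"
    using lborel_affine[of \<epsilon> w] \<open>\<epsilon> > 0\<close> by simp
  then have "integral\<^sup>L lborel F = integral\<^sup>L (density (distr lborel borel (\<lambda>v. w + \<epsilon> *\<^sub>R v)) (\<lambda>_. ennreal (\<epsilon>\<^sup>2))) F"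
    by simp
  also have "\<dots> = (LINT v|distr lborel borel (\<lambda>v. w + \<epsilon> *\<^sub>R v). \<epsilon>\<^sup>2 *\<^sub>R F v)"
    by (rule integral_density) auto
  also have "\<dots> = (LINT v|lborel. \<epsilon>\<^sup>2 *\<^sub>R F (w + \<epsilon> *\<^sub>R v))"
    by (rule integral_distr) auto
  also have "\<dots> = (LINT v|lborel. complex_of_real (plane_kernel v) * \<phi> (w + \<epsilon> *\<^sub>R v))"
  proof (rule Bochner_Integration.integral_cong)
    fix v
    show "\<epsilon>\<^sup>2 *\<^sub>R F (w + \<epsilon> *\<^sub>R v) = complex_of_real (plane_kernel v) * \<phi> (w + \<epsilon> *\<^sub>R v)"
    proof -
      have "(cmod (w + \<epsilon> *\<^sub>R v - w))\<^sup>2 + \<epsilon>\<^sup>2 = \<epsilon>\<^sup>2 * (1 + (cmod v)\<^sup>2)"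
        using \<open>\<epsilon> > 0\<close> by (simp add: power_mult_distrib algebra_simps)
      then have "\<epsilon>\<^sup>2 * (2 * \<epsilon>\<^sup>2 / ((cmod (w + \<epsilon> *\<^sub>R v - w))\<^sup>2 + \<epsilon>\<^sup>2)\<^sup>2) = plane_kernel v"
        using \<open>\<epsilon> > 0\<close> by (simp add: plane_kernel_def power_mult_distrib power2_eq_square)
      then show ?thesis
        unfolding F_def scaleR_conv_of_real mult.assoc[symmetric] of_real_mult[symmetric] by simp
    qed
  qed simp
  finally show ?thesis by (simp add: F_def)
qed

text \<open>The bound does not depend on \<open>\<epsilon>\<close>, so it dominates the whole
  regularised family by an integrable function.\<close>

lemma regularised_ln_bound:
  fixes t \<epsilon> :: real
  assumes "0 < t" "0 < \<epsilon>" "\<epsilon> \<le> 1"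
  shows "\<bar>ln (t\<^sup>2 + \<epsilon>\<^sup>2) / 2\<bar> \<le> \<bar>ln t\<bar> + 1"
proof -
  have t2: "ln (t\<^sup>2) = 2 * ln t" using assms by (simp add: ln_realpow)
  have e2: "0 < \<epsilon>\<^sup>2" "\<epsilon>\<^sup>2 \<le> 1" using assms by (auto simp: power_le_one)
  have "ln (t\<^sup>2) \<le> ln (t\<^sup>2 + \<epsilon>\<^sup>2)" using assms e2 by (subst ln_le_cancel_iff) (auto intro: add_pos_pos)
  moreover have "ln (t\<^sup>2 + \<epsilon>\<^sup>2) \<le> ln (2 * max 1 (t\<^sup>2))"
    using assms e2 by (subst ln_le_cancel_iff) (auto intro: add_pos_pos)
  moreover have "ln (2 * max 1 (t\<^sup>2)) = ln 2 + ln (max 1 (t\<^sup>2))"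
    by (simp add: ln_mult_pos)
  moreover have "ln (max 1 (t\<^sup>2)) \<le> 2 * \<bar>ln t\<bar>"
    using t2 by (auto simp: max_def)
  moreover have "ln 2 \<le> (1::real)" using ln_2_less_1 by simp
  ultimately show ?thesis using t2 by linarith
qed

text \<open>The regularised logarithm is smooth across w, so Green's identity applies without a
  boundary term at the singularity. In the sum of the second derivatives the squares cancel against
  s and leave \<open>2 * \<epsilon>\<^sup>2\<close>.\<close>

lemma integral_regularised_ln_laplacian:
  assumes \<phi>: "\<phi> \<in> test_functions" and "\<epsilon> > 0"
  shows "(LINT z|lborel. complex_of_real (ln ((cmod (z - w))\<^sup>2 + \<epsilon>\<^sup>2) / 2) * laplacian \<phi> z) =
    (LINT z|lborel. complex_of_real (2 * \<epsilon>\<^sup>2 / ((cmod (z - w))\<^sup>2 + \<epsilon>\<^sup>2)\<^sup>2) * \<phi> z)"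
proof -
  define s where "s z = (cmod (z - w))\<^sup>2 + \<epsilon>\<^sup>2" for z
  have s: "s z = (Re z - Re w)\<^sup>2 + (Im z - Im w)\<^sup>2 + \<epsilon>\<^sup>2" for z
    by (simp add: s_def cmod_power2)
  have pos: "s z > 0" for z using \<open>\<epsilon> > 0\<close> by (simp add: s_def add_nonneg_pos)
  then have ne: "s z \<noteq> 0" for z by (metis less_irrefl)
  have dsx: "((\<lambda>x. s (Complex x y)) has_real_derivative 2 * (x - Re w)) (at x)" for x y
    unfolding s by (auto intro!: derivative_eq_intros)
  have dsy: "((\<lambda>y. s (Complex x y)) has_real_derivative 2 * (y - Im w)) (at y)" for x y
    unfolding s by (auto intro!: derivative_eq_intros)
  have cs: "continuous_on UNIV s" unfolding s by (intro continuous_intros)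
  define gx where "gx z = (Re z - Re w) / s z" for z
  define gy where "gy z = (Im z - Im w) / s z" for z
  define gxx where "gxx z = (s z - 2 * (Re z - Re w)\<^sup>2) / (s z * s z)" for z
  define gyy where "gyy z = (s z - 2 * (Im z - Im w)\<^sup>2) / (s z * s z)" for z
  have "(LINT z|lborel. complex_of_real (ln (s z) / 2) * laplacian \<phi> z) =
      (LINT z|lborel. complex_of_real (gxx z + gyy z) * \<phi> z)"
  proof (rule integral_laplacian_by_parts[OF \<phi>])
    fix x y
    show "((\<lambda>x. ln (s (Complex x y)) / 2) has_real_derivative gx (Complex x y)) (at x)"
      using pos by (auto intro!: derivative_eq_intros dsx simp: gx_def field_simps ne)
    show "((\<lambda>y. ln (s (Complex x y)) / 2) has_real_derivative gy (Complex x y)) (at y)"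
      using pos by (auto intro!: derivative_eq_intros dsy simp: gy_def field_simps ne)
    have "((\<lambda>x. (x - Re w) / s (Complex x y)) has_real_derivative
        (1 * s (Complex x y) - (x - Re w) * (2 * (x - Re w))) / (s (Complex x y) * s (Complex x y))) (at x)"
      by (intro DERIV_divide dsx ne) (auto intro!: derivative_eq_intros)
    then show "((\<lambda>x. gx (Complex x y)) has_real_derivative gxx (Complex x y)) (at x)"
      by (simp add: gx_def gxx_def power2_eq_square algebra_simps)
    have "((\<lambda>y. (y - Im w) / s (Complex x y)) has_real_derivative
        (1 * s (Complex x y) - (y - Im w) * (2 * (y - Im w))) / (s (Complex x y) * s (Complex x y))) (at y)"
      by (intro DERIV_divide dsy ne) (auto intro!: derivative_eq_intros)
    then show "((\<lambda>y. gy (Complex x y)) has_real_derivative gyy (Complex x y)) (at y)"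
      by (simp add: gy_def gyy_def power2_eq_square algebra_simps)
  next
    show "continuous_on UNIV (\<lambda>z. ln (s z) / 2)" "continuous_on UNIV gxx" "continuous_on UNIV gyy"
      unfolding gxx_def[abs_def] gyy_def[abs_def] using pos ne by (auto intro!: continuous_intros cs)
  qed
  moreover have "gxx z + gyy z = 2 * \<epsilon>\<^sup>2 / (s z)\<^sup>2" for z
  proof -
    have "gxx z + gyy z = (2 * s z - 2 * ((Re z - Re w)\<^sup>2 + (Im z - Im w)\<^sup>2)) / (s z)\<^sup>2"
      unfolding gxx_def gyy_def add_divide_distrib[symmetric] power2_eq_square by (simp add: algebra_simps)
    also have "2 * s z - 2 * ((Re z - Re w)\<^sup>2 + (Im z - Im w)\<^sup>2) = 2 * \<epsilon>\<^sup>2" by (simp add: s)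
    finally show ?thesis .
  qed
  ultimately show ?thesis by (simp add: s_def)
qed

text \<open>The regularised integrals have two limits as the parameter tends to 0. Domination by the
  logarithm gives the left side, and the rescaled kernel concentrates at w and gives the right
  side.\<close>

theorem integral_ln_laplacian:
  assumes \<phi>: "\<phi> \<in> test_functions"
  shows "(LINT z|lborel. complex_of_real (ln (cmod (z - w))) * laplacian \<phi> z) =
    2 * complex_of_real pi * \<phi> w"
proof -
  define e where "e m = inverse (real (Suc m))" for m
  have e: "e m > 0" "e m \<le> 1" for m by (auto simp: e_def inverse_le_1_iff)
  have e0: "e \<longlonglongrightarrow> 0" unfolding e_def by (rule LIMSEQ_inverse_real_of_nat)
  let ?f = "\<lambda>m z. complex_of_real (ln ((cmod (z - w))\<^sup>2 + (e m)\<^sup>2) / 2) * laplacian \<phi> z"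
  let ?l = "\<lambda>z. complex_of_real (ln (cmod (z - w))) * laplacian \<phi> z"
  define I where "I m = (LINT z|lborel. ?f m z)" for m
  have [measurable]: "\<phi> \<in> borel_measurable borel" "laplacian \<phi> \<in> borel_measurable borel"
    using \<phi> by (auto intro!: borel_measurable_continuous_onI test_functions_continuous laplacian_test_functions)
  obtain R where R: "\<forall>z. R \<le> cmod z \<longrightarrow> laplacian \<phi> z = 0"
    using test_functions_vanish[OF laplacian_test_functions[OF \<phi>]] by auto
  obtain B where B: "B > 0" "\<And>z. cmod (laplacian \<phi> z) \<le> B"
    using test_functions_bounded[OF laplacian_test_functions[OF \<phi>]] by blast
  obtain B' where B': "B' > 0" "\<And>z. cmod (\<phi> z) \<le> B'"
    using test_functions_bounded[OF \<phi>] by blast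
  let ?h = "\<lambda>z. B * (\<bar>indicator (cball 0 R) z * ln (cmod (z - w))\<bar> + indicator (cball 0 R) z *\<^sub>R 1)"
  have "I \<longlonglongrightarrow> (LINT z|lborel. ?l z)"
    unfolding I_def
  proof (rule integral_dominated_convergence[where
        w = ?h])
    show "integrable lborel ?h"
      by (intro integrable_mult_right Bochner_Integration.integrable_add integrable_abs integrable_ln_cball
          borel_integrable_compact) auto
    have ne: "AE z in lborel. z \<noteq> w" by (rule AE_lborel_singleton)
    show "AE z in lborel. (\<lambda>m. ?f m z)
      \<longlonglongrightarrow> ?l z"
    proof (rule eventually_mono[OF ne])
      fix z assume "z \<noteq> w"
      then have "(\<lambda>m. ln ((cmod (z - w))\<^sup>2 + (e m)\<^sup>2) / 2) \<longlonglongrightarrow> ln ((cmod (z - w))\<^sup>2 + 0\<^sup>2) / 2"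
        by (intro tendsto_intros e0) auto
      also have "ln ((cmod (z - w))\<^sup>2 + 0\<^sup>2) / 2 = ln (cmod (z - w))"
        using \<open>z \<noteq> w\<close> by (simp add: ln_realpow)
      finally show "(\<lambda>m. ?f m z)
        \<longlonglongrightarrow> ?l z"
        by (intro tendsto_intros)
    qed
    fix m
    show "AE z in lborel. norm (?f m z)
      \<le> ?h z"
    proof (rule eventually_mono[OF ne])
      fix z assume "z \<noteq> w"
      then have *: "\<bar>ln ((cmod (z - w))\<^sup>2 + (e m)\<^sup>2) / 2\<bar> \<le> \<bar>ln (cmod (z - w))\<bar> + 1"
        using e[of m] by (intro regularised_ln_bound) auto
      show "norm (?f m z)
        \<le> ?h z"
      proof (cases "cmod z \<le> R")
        case True
        have "norm (?f m z) \<le>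
            (\<bar>ln (cmod (z - w))\<bar> + 1) * B"
          unfolding norm_mult norm_of_real using * B(2)[of z] by (intro mult_mono) auto
        then show ?thesis using True by (simp add: mult.commute)
      next
        case False
        with R B show ?thesis by simp
      qed
    qed
  qed measurable
  moreover have "I \<longlonglongrightarrow> (LINT v|lborel. complex_of_real (plane_kernel v) * \<phi> w)"
  proof -
    have I: "I m = (LINT v|lborel. complex_of_real (plane_kernel v) * \<phi> (w + e m *\<^sub>R v))" for m
      unfolding I_def using e \<phi>
      by (simp only: integral_regularised_ln_laplacian integral_kernel_scaled \<open>\<phi> \<in> borel_measurable borel\<close>)
    have [measurable]: "plane_kernel \<in> borel_measurable borel"
      unfolding plane_kernel_def[abs_def] by measurable
    show ?thesis
      unfolding I
    proof (rule integral_dominated_convergence[where w = "\<lambda>v. B' * plane_kernel v"])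
      show "integrable lborel (\<lambda>v. B' * plane_kernel v)"
        using has_bochner_integral_plane_kernel by (simp add: has_bochner_integral_iff)
      have "isCont \<phi> w"
        using test_functions_continuous[OF \<phi>] by (simp add: continuous_on_eq_continuous_at)
      moreover have "(\<lambda>m. w + e m *\<^sub>R v) \<longlonglongrightarrow> w" for v
      proof -
        have "(\<lambda>m. w + e m *\<^sub>R v) \<longlonglongrightarrow> w + 0 *\<^sub>R v"
          by (intro tendsto_intros e0)
        then show ?thesis by simp
      qed
      ultimately have "(\<lambda>m. \<phi> (w + e m *\<^sub>R v)) \<longlonglongrightarrow> \<phi> w" for v
        by (rule isCont_tendsto_compose)
      then show "AE v in lborel. (\<lambda>m. complex_of_real (plane_kernel v) * \<phi> (w + e m *\<^sub>R v))
          \<longlonglongrightarrow> complex_of_real (plane_kernel v) * \<phi> w"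
        by (intro AE_I2 tendsto_intros)
      fix m
      have "norm (complex_of_real (plane_kernel v) * \<phi> (w + e m *\<^sub>R v)) \<le> B' * plane_kernel v" for v
      proof -
        have pos: "0 \<le> plane_kernel v" by (simp add: plane_kernel_def)
        have "norm (complex_of_real (plane_kernel v) * \<phi> (w + e m *\<^sub>R v)) = cmod (\<phi> (w + e m *\<^sub>R v)) * plane_kernel v"
          using pos by (simp add: norm_mult)
        also have "\<dots> \<le> B' * plane_kernel v" using B'(2) pos by (rule mult_right_mono)
        finally show ?thesis .
      qed
      then show "AE v in lborel. norm (complex_of_real (plane_kernel v) * \<phi> (w + e m *\<^sub>R v)) \<le> B' * plane_kernel v"
        by simp
    qed measurable
  qed
  moreover have "(LINT v|lborel. complex_of_real (plane_kernel v) * \<phi> w) = 2 * complex_of_real pi * \<phi> w"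
    using has_bochner_integral_integral_eq[OF has_bochner_integral_plane_kernel] by simp
  ultimately show ?thesis
    using LIMSEQ_unique by metis
qed

section \<open>Weak convergence from convergence on test functions\<close>

text \<open>The powers of t in the denominator make the family closed under differentiation up to
  linear combinations, so a single induction proves smoothness of all members at once.\<close>

definition flat_exp :: "nat \<Rightarrow> real \<Rightarrow> real" where
  "flat_exp j t = (if t > 0 then exp (- (1 / t)) / t ^ j else 0)"

lemma flat_exp_tendsto_0: "(flat_exp j \<longlongrightarrow> 0) (at 0)"
proof (rule filterlim_split_at)
  show "(flat_exp j \<longlongrightarrow> 0) (at_left 0)"
    by (rule tendsto_eventually) (auto simp: flat_exp_def eventually_at_filter)
  have "((\<lambda>t::real. inverse t ^ j / exp (inverse t)) \<longlongrightarrow> 0) (at_right 0)"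
    by (rule filterlim_compose[OF tendsto_power_div_exp_0 filterlim_inverse_at_top_right])
  then show "(flat_exp j \<longlongrightarrow> 0) (at_right 0)"
  proof (rule Lim_transform_eventually)
    show "eventually (\<lambda>t. inverse t ^ j / exp (inverse t) = flat_exp j t) (at_right 0)"
      by (auto simp: eventually_at_filter flat_exp_def exp_minus divide_inverse power_inverse mult.commute)
  qed
qed

lemma flat_exp_has_derivative:
  "(flat_exp j has_real_derivative flat_exp (j + 2) t - real j * flat_exp (j + 1) t) (at t)"
proof -
  consider "t < 0" | "t = 0" | "t > 0" by linarith
  then show ?thesis
  proof cases
    case 1
    have "(flat_exp j has_real_derivative 0) (at t)"
      by (rule DERIV_cong_ev[THEN iffD2, of t t _ "\<lambda>_. 0" 0 0])
         (use 1 in \<open>auto simp: flat_exp_def eventually_nhds_metric dist_real_def intro!: exI[of _ "-t"]\<close>)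
    with 1 show ?thesis by (simp add: flat_exp_def)
  next
    case 2
    \<comment> \<open>The difference quotient at 0 is again a member of the family, with index
      \<open>Suc j\<close>, and hence tends to 0.\<close>
    have "((\<lambda>h. (flat_exp j (0 + h) - flat_exp j 0) / h) \<longlongrightarrow> 0) (at 0)"
      by (rule Lim_transform_eventually[OF flat_exp_tendsto_0[of "Suc j"]])
         (auto simp: flat_exp_def eventually_at_filter)
    with 2 show ?thesis by (simp add: DERIV_def flat_exp_def)
  next
    case 3
    have "((\<lambda>t. exp (- (1 / t)) / t ^ j) has_real_derivative flat_exp (j + 2) t - real j * flat_exp (j + 1) t) (at t)"
    proof -
      \<comment> \<open>For j = 0 the truncated exponent is harmless, since the factor
        \<open>real j\<close> kills both sides.\<close>
      have p: "real j * t ^ (j - 1) = real j * t ^ j / t" using 3 by (cases j) auto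
      have "((\<lambda>t. exp (- (1 / t)) / t ^ j) has_real_derivative
          (exp (- (1 / t)) * (1 / (t * t)) * t ^ j - exp (- (1 / t)) * (real j * t ^ (j - 1))) / (t ^ j * t ^ j)) (at t)"
        by (rule DERIV_divide) (use 3 in \<open>auto intro!: derivative_eq_intros simp: power2_eq_square\<close>)
      also have "(exp (- (1 / t)) * (1 / (t * t)) * t ^ j - exp (- (1 / t)) * (real j * t ^ (j - 1))) / (t ^ j * t ^ j)
          = flat_exp (j + 2) t - real j * flat_exp (j + 1) t"
        unfolding p using 3 by (simp add: flat_exp_def field_simps power2_eq_square)
      finally show ?thesis .
    qed
    moreover have "eventually (\<lambda>s. flat_exp j s = exp (- (1 / s)) / s ^ j) (nhds t)"
      using 3 by (auto simp: flat_exp_def eventually_nhds_metric dist_real_def intro!: exI[of _ t])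
    ultimately show ?thesis
      using DERIV_cong_ev[of t t "flat_exp j" "\<lambda>s. exp (- (1 / s)) / s ^ j"] by simp
  qed
qed

text \<open>A partial derivative raises the index j and contributes a factor linear in Re z or Im z.
  The induction on the order therefore needs j arbitrary.\<close>

lemma times_continuously_differentiable_flat:
  "times_continuously_differentiable m (\<lambda>z. complex_of_real (flat_exp j (1 - c * ((Re z)\<^sup>2 + (Im z)\<^sup>2))))"
proof (induction m arbitrary: j)
  define q where "q z = 1 - c * ((Re z)\<^sup>2 + (Im z)\<^sup>2)" for z
  define q' where "q' z v = - (c * (2 * Re z * Re v + 2 * Im z * Im v))" for z v
  have q: "(q has_derivative q' z) (at z)" for z
    unfolding q_def q'_def[abs_def] by (auto intro!: derivative_eq_intros simp: algebra_simps)
  have D: "((\<lambda>z. complex_of_real (flat_exp j (q z))) has_derivative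
      (\<lambda>v. complex_of_real ((flat_exp (j + 2) (q z) - real j * flat_exp (j + 1) (q z)) * q' z v))) (at z)" for j z
    using flat_exp_has_derivative[of j "q z"]
    by (intro has_derivative_of_real has_derivative_compose[OF q, of "flat_exp j"])
       (simp add: has_field_derivative_def)
  {
    case 0
    have "continuous_on UNIV (\<lambda>z. complex_of_real (flat_exp j (q z)))"
      using D by (intro has_derivative_continuous_on[of UNIV]) (auto intro: has_derivative_at_withinI)
    then show ?case by (simp add: q_def)
  next
    case (Suc m)
    have px: "partial_x (\<lambda>z. complex_of_real (flat_exp j (q z))) =
      (\<lambda>z. (complex_of_real (flat_exp (j + 2) (q z)) + - of_nat j * complex_of_real (flat_exp (j + 1) (q z))) *
         complex_of_real (- 2 * c * Re z))"
      and py: "partial_y (\<lambda>z. complex_of_real (flat_exp j (q z))) =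
      (\<lambda>z. (complex_of_real (flat_exp (j + 2) (q z)) + - of_nat j * complex_of_real (flat_exp (j + 1) (q z))) *
         complex_of_real (- 2 * c * Im z))"
      by (auto simp: partial_x_eq[OF D] partial_y_eq[OF D] q'_def)
    have F: "times_continuously_differentiable m (\<lambda>z. complex_of_real (flat_exp (j + 2) (q z)) +
        - of_nat j * complex_of_real (flat_exp (j + 1) (q z)))" for j
      unfolding q_def by (intro times_continuously_differentiable_add times_continuously_differentiable_mult
          times_continuously_differentiable_const Suc.IH)
    have lin: "times_continuously_differentiable m (\<lambda>z. complex_of_real (- 2 * c * Re z))"
      "times_continuously_differentiable m (\<lambda>z. complex_of_real (- 2 * c * Im z))"
      by (intro times_continuously_differentiable_real_polynomial real_polynomial_function.intros
          bounded_linear_Re bounded_linear_Im)+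
    have diff: "(\<lambda>z. complex_of_real (flat_exp j (q z))) differentiable (at z)" for z
      using D by (auto simp: differentiable_def)
    show ?case
      unfolding q_def[symmetric] times_continuously_differentiable.simps(2) px py
      by (intro conjI allI times_continuously_differentiable_mult F lin diff)
  }
qed

text \<open>For positive R the argument of \<open>flat_exp\<close> is positive exactly inside the
  disc of radius R. The factor \<open>exp 1\<close> normalises the value at the origin to 1, so the
  bumps increase to the constant 1 as R grows.\<close>

definition bump :: "real \<Rightarrow> complex \<Rightarrow> real" where
  "bump R z = exp 1 * flat_exp 0 (1 - (1 / R\<^sup>2) * ((Re z)\<^sup>2 + (Im z)\<^sup>2))"

lemma bump_altdef: "bump R z = exp 1 * flat_exp 0 (1 - (cmod z)\<^sup>2 / R\<^sup>2)"
  by (simp add: bump_def cmod_power2)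

lemma bump_vanish: "R > 0 \<Longrightarrow> R \<le> cmod z \<Longrightarrow> bump R z = 0"
proof -
  assume "R > 0" "R \<le> cmod z"
  then have "R\<^sup>2 \<le> (cmod z)\<^sup>2" by (intro power_mono) auto
  then have "1 \<le> (cmod z)\<^sup>2 / R\<^sup>2" using \<open>R > 0\<close> by simp
  then show "bump R z = 0" by (simp add: bump_altdef flat_exp_def)
qed

lemma bump_range: "0 \<le> bump R z" "bump R z \<le> 1"
proof -
  show "0 \<le> bump R z" by (simp add: bump_altdef flat_exp_def)
  define t where "t = 1 - (cmod z)\<^sup>2 / R\<^sup>2"
  have "t \<le> 1" by (simp add: t_def)
  have "exp 1 * exp (- (1 / t)) \<le> 1" if "t > 0"
  proof -
    have "1 \<le> 1 / t" using that \<open>t \<le> 1\<close> by simp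
    then show ?thesis by (simp add: exp_add[symmetric])
  qed
  then show "bump R z \<le> 1" by (simp add: bump_altdef flat_exp_def t_def[symmetric])
qed

lemma bump_test_function:
  assumes "R > 0"
  shows "(\<lambda>z. complex_of_real (bump R z)) \<in> test_functions"
proof -
  have "times_continuously_differentiable m (\<lambda>z. complex_of_real (exp 1) *
      complex_of_real (flat_exp 0 (1 - (1 / R\<^sup>2) * ((Re z)\<^sup>2 + (Im z)\<^sup>2))))" for m
    by (intro times_continuously_differentiable_mult times_continuously_differentiable_const
        times_continuously_differentiable_flat)
  then have "times_continuously_differentiable m (\<lambda>z. complex_of_real (bump R z))" for m
    by (simp add: bump_def)
  moreover have "\<forall>z. R \<le> cmod z \<longrightarrow> complex_of_real (bump R z) = 0"
    using bump_vanish[OF assms] by simp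
  ultimately show ?thesis unfolding test_functions_iff by blast
qed

lemma continuous_on_bump: "R > 0 \<Longrightarrow> continuous_on UNIV (bump R)"
  using continuous_on_Re[OF test_functions_continuous[OF bump_test_function]] by simp

lemma bump_tendsto_1: "(\<lambda>m. bump (real (Suc m)) z) \<longlonglongrightarrow> 1"
proof -
  have "(\<lambda>m. (cmod z)\<^sup>2 / (real (Suc m))\<^sup>2) \<longlonglongrightarrow> 0"
    by real_asymp
  then have t: "(\<lambda>m. 1 - (cmod z)\<^sup>2 / (real (Suc m))\<^sup>2) \<longlonglongrightarrow> 1 - 0"
    by (intro tendsto_intros)
  have "isCont (flat_exp 0) 1"
    by (rule DERIV_isCont[OF flat_exp_has_derivative])
  then have "(\<lambda>m. exp 1 * flat_exp 0 (1 - (cmod z)\<^sup>2 / (real (Suc m))\<^sup>2)) \<longlonglongrightarrow> exp 1 * flat_exp 0 1"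
    using t by (intro tendsto_intros isCont_tendsto_compose[of 1 "flat_exp 0"]) auto
  then show ?thesis
    by (simp add: bump_altdef flat_exp_def exp_add[symmetric])
qed

section \<open>From test functions to bounded continuous functions\<close>

text \<open>No mass escapes: some bump carries almost all of the probability measure
  \<open>\<mu>\<close>, and as a test function it eventually carries almost all of
  \<open>\<nu> k\<close>. On its disc f is replaced by a polynomial times the bump. The restriction
  to positive k matters because the empirical spectral distribution at k = 0 is the zero
  measure.\<close>

lemma weakly_convergesI_test_functions:
  assumes \<mu>: "prob_space \<mu>" "sets \<mu> = sets borel"
    and \<nu>: "\<And>k. k \<ge> 1 \<Longrightarrow> prob_space (\<nu> k)" "\<And>k. k \<ge> 1 \<Longrightarrow> sets (\<nu> k) = sets borel"
    and lim: "\<And>\<phi>. \<phi> \<in> test_functions \<Longrightarrow>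
      (\<lambda>k. measure_distribution (\<nu> k) \<phi>) \<longlonglongrightarrow> measure_distribution \<mu> \<phi>"
  shows "weakly_converges \<nu> \<mu>"
  unfolding weakly_converges_def
proof (intro allI impI)
  fix f :: "complex \<Rightarrow> real"
  assume f: "continuous_on UNIV f \<and> bounded (range f)"
  then obtain B where B: "B > 0" "\<And>z. \<bar>f z\<bar> \<le> B"
    by (auto simp: bounded_pos)
  have real_lim: "(\<lambda>k. LINT z|\<nu> k. g z) \<longlonglongrightarrow> (LINT z|\<mu>. g z)"
    if "(\<lambda>z. complex_of_real (g z)) \<in> test_functions" for g
    using lim[OF that] unfolding measure_distribution_def integral_complex_of_real tendsto_of_real_iff .
  have integrable: "integrable \<rho> g" if "prob_space \<rho>" "sets \<rho> = sets borel" "continuous_on UNIV g" "\<And>z. \<bar>g z\<bar> \<le> c"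
    for \<rho> and g :: "complex \<Rightarrow> real" and c
  proof -
    interpret prob_space \<rho> by fact
    have "g \<in> borel_measurable \<rho>"
      using borel_measurable_continuous_onI[OF that(3)] measurable_cong_sets[OF that(2) refl] by blast
    then show ?thesis using that(4) by (intro integrable_const_bound[of _ c]) auto
  qed
  show "(\<lambda>k. LINT z|\<nu> k. f z) \<longlonglongrightarrow> (LINT z|\<mu>. f z)"
  proof (rule LIMSEQ_I)
    fix r :: real assume "r > 0"
    \<comment> \<open>Each of the two measures contributes \<open>B * e + e\<close>, and the test
      function contributes e, which adds up to r.\<close>
    define e where "e = r / (2 * B + 3)"
    have e: "e > 0" using \<open>r > 0\<close> B by (simp add: e_def)
    interpret \<mu>: prob_space \<mu> by (rule \<mu>)
    have "(\<lambda>m. LINT z|\<mu>. bump (real (Suc m)) z) \<longlonglongrightarrow> (LINT z|\<mu>. 1)"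
      by (rule integral_dominated_convergence[where w = "\<lambda>_. 1"])
         (use bump_range bump_tendsto_1 in \<open>auto simp: abs_le_iff intro!: borel_measurable_integrable integrable[OF \<mu>, where c = 1] continuous_on_bump
            order_trans[OF bump_range(2)] \<close>)
    then have "eventually (\<lambda>m. (LINT z|\<mu>. bump (real (Suc m)) z) > 1 - e) sequentially"
      using e by (intro order_tendstoD(1)) (auto simp: \<mu>.prob_space)
    then obtain m where m: "(LINT z|\<mu>. bump (real (Suc m)) z) > 1 - e"
      by (auto simp: eventually_sequentially)
    define R where "R = real (Suc m)"
    have R: "R > 0" by (simp add: R_def)
    define b where "b = bump R"
    have b: "0 \<le> b z" "b z \<le> 1" "continuous_on UNIV b" for z
      using bump_range continuous_on_bump[OF R] by (auto simp: b_def)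
    obtain p where p: "real_polynomial_function p" "\<And>z. z \<in> cball 0 R \<Longrightarrow> \<bar>f z - p z\<bar> < e"
      using Stone_Weierstrass_real_polynomial_function[of "cball 0 R" f e] e f
        continuous_on_subset[of UNIV f "cball 0 R"] by auto
    have pb: "(\<lambda>z. complex_of_real (p z * b z)) \<in> test_functions"
      using test_functions_mult[OF times_continuously_differentiable_real_polynomial[OF p(1)] bump_test_function[OF R]]
      by (simp add: b_def)
    have cpb: "continuous_on UNIV (\<lambda>z. p z * b z)"
      using continuous_on_Re[OF test_functions_continuous[OF pb]] by simp
    have near: "\<bar>f z * b z - p z * b z\<bar> \<le> e" for z
    proof (cases "cmod z \<le> R")
      case True
      have "\<bar>f z - p z\<bar> * b z \<le> e * 1"
        using p(2)[of z] True b by (intro mult_mono) auto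
      then show ?thesis using b(1)[of z] by (simp add: left_diff_distrib[symmetric] abs_mult)
    next
      case False
      then show ?thesis using bump_vanish[OF R, of z] e by (simp add: b_def)
    qed
    have bound: "\<bar>(LINT z|\<rho>. f z) - (LINT z|\<rho>. p z * b z)\<bar> \<le> B * (1 - (LINT z|\<rho>. b z)) + e"
      if \<rho>: "prob_space \<rho>" "sets \<rho> = sets borel" for \<rho>
    proof -
      interpret prob_space \<rho> by fact
      have ib: "integrable \<rho> b" using integrable[OF \<rho> b(3), of 1] b by (auto simp: abs_le_iff intro: order_trans)
      have if': "integrable \<rho> f" using integrable[OF \<rho>, of f B] f B by auto
      have "\<bar>p z * b z\<bar> \<le> B + e" for z
      proof -
        have "\<bar>f z * b z\<bar> \<le> B * 1"
          unfolding abs_mult using b(1,2)[of z] B by (intro mult_mono) auto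
        then show ?thesis using near[of z] by linarith
      qed
      then have ip: "integrable \<rho> (\<lambda>z. p z * b z)" using integrable[OF \<rho> cpb] by auto
      have "\<bar>(LINT z|\<rho>. f z) - (LINT z|\<rho>. p z * b z)\<bar> = \<bar>LINT z|\<rho>. f z - p z * b z\<bar>"
        using if' ip by simp
      also have "\<dots> \<le> (LINT z|\<rho>. \<bar>f z - p z * b z\<bar>)"
        by (rule integral_abs_bound)
      also have "\<dots> \<le> (LINT z|\<rho>. B * (1 - b z) + e)"
      proof (rule integral_mono)
        fix z
        have "\<bar>f z * (1 - b z)\<bar> \<le> B * (1 - b z)"
          unfolding abs_mult using b(1,2)[of z] B by (intro mult_mono) auto
        moreover have "f z - p z * b z = f z * (1 - b z) + (f z * b z - p z * b z)"
          by (simp add: algebra_simps)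
        ultimately show "\<bar>f z - p z * b z\<bar> \<le> B * (1 - b z) + e"
          using near[of z] by linarith
      qed (use if' ip ib in auto)
      also have "\<dots> = B * (1 - (LINT z|\<rho>. b z)) + e"
        using ib by (simp add: prob_space)
      finally show ?thesis .
    qed
    have "(\<lambda>k. LINT z|\<nu> k. b z) \<longlonglongrightarrow> (LINT z|\<mu>. b z)"
      using real_lim bump_test_function[OF R] by (simp add: b_def)
    then have ev1: "eventually (\<lambda>k. (LINT z|\<nu> k. b z) > 1 - e) sequentially"
      using m by (intro order_tendstoD(1)) (auto simp: b_def R_def)
    have ev2: "eventually (\<lambda>k. dist (LINT z|\<nu> k. p z * b z) (LINT z|\<mu>. p z * b z) < e) sequentially"
      using real_lim[OF pb] e by (rule tendstoD)
    have "eventually (\<lambda>k. norm ((LINT z|\<nu> k. f z) - (LINT z|\<mu>. f z)) < r) sequentially"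
      using ev1 ev2 eventually_ge_at_top[of 1]
    proof eventually_elim
      case (elim k)
      have "B * (1 - (LINT z|\<nu> k. b z)) \<le> B * e" "B * (1 - (LINT z|\<mu>. b z)) \<le> B * e"
        using elim m B by (auto intro!: mult_left_mono simp: b_def R_def)
      moreover have "\<bar>(LINT z|\<nu> k. f z) - (LINT z|\<nu> k. p z * b z)\<bar> \<le> B * (1 - (LINT z|\<nu> k. b z)) + e"
        using elim \<nu> by (intro bound) auto
      moreover have "\<bar>(LINT z|\<mu>. f z) - (LINT z|\<mu>. p z * b z)\<bar> \<le> B * (1 - (LINT z|\<mu>. b z)) + e"
        using \<mu> by (intro bound) auto
      moreover have "(2 * B + 3) * e = r" using B by (simp add: e_def)
      then have "2 * (B * e) + 3 * e = r" by (simp add: algebra_simps)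
      ultimately show ?case using elim(2) unfolding dist_real_def real_norm_def by linarith
    qed
    then show "\<exists>k0. \<forall>k\<ge>k0. norm ((LINT z|\<nu> k. f z) - (LINT z|\<mu>. f z)) < r"
      by (simp add: eventually_sequentially)
  qed
qed

section \<open>Roots of the determinant of a matrix polynomial\<close>

text \<open>Stated with degree bounds instead of degrees, because entries of the matrix polynomial
  may have degree below k.\<close>

lemma coeff_mult_degree_bounds:
  fixes p q :: "'a::comm_semiring_1 poly"
  assumes "degree p \<le> m" "degree q \<le> l"
  shows "coeff (p * q) (m + l) = coeff p m * coeff q l"
proof -
  have "coeff (p * q) (m + l) = (\<Sum>i\<le>m + l. coeff p i * coeff q (m + l - i))"
    by (rule coeff_mult)
  also have "\<dots> = (\<Sum>i\<in>{m}. coeff p i * coeff q (m + l - i))"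
  proof (rule sum.mono_neutral_right)
    show "\<forall>i\<in>{..m + l} - {m}. coeff p i * coeff q (m + l - i) = 0"
    proof
      fix i assume "i \<in> {..m + l} - {m}"
      then consider "i > m" | "m + l - i > l" by fastforce
      then show "coeff p i * coeff q (m + l - i) = 0"
        using assms by cases (auto simp: coeff_eq_0)
    qed
  qed auto
  finally show ?thesis by simp
qed

lemma
  fixes f :: "'b \<Rightarrow> 'a::comm_semiring_1 poly"
  assumes "finite I" "\<And>i. i \<in> I \<Longrightarrow> degree (f i) \<le> k"
  shows degree_prod_le_card: "degree (\<Prod>i\<in>I. f i) \<le> k * card I"
    and coeff_prod_card: "coeff (\<Prod>i\<in>I. f i) (k * card I) = (\<Prod>i\<in>I. coeff (f i) k)"
proof -
  have "degree (\<Prod>i\<in>I. f i) \<le> k * card I \<and> coeff (\<Prod>i\<in>I. f i) (k * card I) = (\<Prod>i\<in>I. coeff (f i) k)"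
    using assms
  proof (induction I)
    case (insert i I)
    have "degree (f i * (\<Prod>i\<in>I. f i)) \<le> k + k * card I"
      using insert by (intro order_trans[OF degree_mult_le] add_mono) auto
    moreover have "coeff (f i * (\<Prod>i\<in>I. f i)) (k + k * card I) = coeff (f i) k * coeff (\<Prod>i\<in>I. f i) (k * card I)"
      using insert by (intro coeff_mult_degree_bounds) auto
    ultimately show ?case using insert by simp
  qed auto
  then show "degree (\<Prod>i\<in>I. f i) \<le> k * card I"
    "coeff (\<Prod>i\<in>I. f i) (k * card I) = (\<Prod>i\<in>I. coeff (f i) k)" by auto
qed

lemma matrix_polynomial_carrier: "matrix_polynomial n k B \<in> carrier_mat n n"
  by (simp add: matrix_polynomial_def)

lemma poly_det_matrix_polynomial:
  "poly (Determinant.det (matrix_polynomial n k B)) z =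
    Determinant.det (Matrix.mat n n (\<lambda>(a, b). \<Sum>j\<le>k. B j $$ (a, b) * z ^ j))"
  by (rule poly_det_cong[OF _ matrix_polynomial_carrier])
     (auto simp: matrix_polynomial_def poly_sum poly_monom)

lemma degree_matrix_polynomial_entry:
  assumes "a < n" "b < n"
  shows "degree (matrix_polynomial n k B $$ (a, b)) \<le> k"
    and "coeff (matrix_polynomial n k B $$ (a, b)) k = B k $$ (a, b)"
proof -
  show "degree (matrix_polynomial n k B $$ (a, b)) \<le> k"
    using assms by (auto simp: matrix_polynomial_def intro!: degree_sum_le order_trans[OF degree_monom_le])
  show "coeff (matrix_polynomial n k B $$ (a, b)) k = B k $$ (a, b)"
    using assms by (simp add: matrix_polynomial_def coeff_sum)
qed

text \<open>In the Leibniz formula each product has n factors of degree at most k, and the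
  coefficient of exponent k n in it is the corresponding product of entries of
  \<open>B k\<close>.\<close>

lemma
  assumes "B k \<in> carrier_mat n n"
  shows degree_det_matrix_polynomial: "degree (Determinant.det (matrix_polynomial n k B)) \<le> k * n"
    and coeff_det_matrix_polynomial:
      "coeff (Determinant.det (matrix_polynomial n k B)) (k * n) = Determinant.det (B k)"
proof -
  let ?M = "matrix_polynomial n k B"
  have det: "Determinant.det ?M = (\<Sum>p\<in>{p. p permutes {0..<n}}. signof p * (\<Prod>i = 0..<n. ?M $$ (i, p i)))"
    by (rule det_def'[OF matrix_polynomial_carrier])
  have signof: "(signof p :: complex poly) = [:signof p:]" for p
    by (simp add: sign_def one_pCons)
  have perm: "i < n \<Longrightarrow> p i < n" if "p permutes {0..<n}" for p i
    using permutes_in_image[OF that, of i] by auto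
  have *: "degree (\<Prod>i = 0..<n. ?M $$ (i, p i)) \<le> k * n"
    "coeff (\<Prod>i = 0..<n. ?M $$ (i, p i)) (k * n) = (\<Prod>i = 0..<n. B k $$ (i, p i))"
    if "p permutes {0..<n}" for p
    using degree_prod_le_card[of "{0..<n}" "\<lambda>i. ?M $$ (i, p i)" k]
      coeff_prod_card[of "{0..<n}" "\<lambda>i. ?M $$ (i, p i)" k]
      degree_matrix_polynomial_entry[of _ n _ k B] perm[OF that]
    by (auto intro!: prod.cong)
  show "degree (Determinant.det ?M) \<le> k * n"
    unfolding det signof using * by (auto intro!: degree_sum_le finite_permutations order_trans[OF degree_smult_le])
  show "coeff (Determinant.det ?M) (k * n) = Determinant.det (B k)"
    unfolding det det_def'[OF assms] coeff_sum signof using * by (auto intro!: sum.cong)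
qed

text \<open>A nonsingular leading coefficient forces the determinant to have degree exactly k n, so
  its roots can be enumerated by that many indices and integrals become averages over them.\<close>

lemma esd_roots:
  fixes B :: "nat \<Rightarrow> complex mat"
  assumes B: "B k \<in> carrier_mat n n" and nz: "Determinant.det (B k) \<noteq> 0" and kn: "k * n > 0"
  obtains r where
    "\<And>z. poly (Determinant.det (matrix_polynomial n k B)) z = Determinant.det (B k) * (\<Prod>i<k * n. z - r i)"
    "prob_space (empirical_spectral_distribution n k B)"
    "\<And>\<phi> :: complex \<Rightarrow> complex. \<phi> \<in> borel_measurable borel \<Longrightarrow>
      measure_distribution (empirical_spectral_distribution n k B) \<phi> = (\<Sum>i<k * n. \<phi> (r i)) / of_nat (k * n)"
proof -
  define D where "D = Determinant.det (matrix_polynomial n k B)"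
  define N where "N = k * n"
  have N: "N > 0" "{..<N} \<noteq> {}" "finite {..<N}" using kn by (auto simp: N_def lessThan_empty_iff)
  have coeff: "coeff D N = Determinant.det (B k)"
    unfolding D_def N_def by (rule coeff_det_matrix_polynomial[where B = B, OF B])
  then have deg: "degree D = N"
    using degree_det_matrix_polynomial[where B = B, OF B] nz le_degree[of D N] by (auto simp: D_def N_def)
  obtain xs where xs: "mset xs = proots D" using ex_mset by blast
  have len: "length xs = N"
    using size_proots_complex[of D] deg by (simp add: xs[symmetric])
  define r where "r = (!) xs"
  have prod: "(\<Prod>x\<in>#mset xs. [:- x, 1:]) = (\<Prod>i<N. [:- r i, 1:])"
  proof -
    have "(\<Prod>x\<in>#mset xs. [:- x, 1:]) = (\<Prod>x\<leftarrow>xs. [:- x, 1:])"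
      by (metis mset_map prod_mset_prod_list)
    also have "\<dots> = (\<Prod>i<N. [:- r i, 1:])"
      by (simp add: prod.list_conv_set_nth atLeast0LessThan len r_def)
    finally show ?thesis .
  qed
  have D: "D = Polynomial.smult (Determinant.det (B k)) (\<Prod>i<N. [:- r i, 1:])"
    using complex_poly_decompose_multiset[of D] prod deg coeff by (simp add: xs)
  have poly: "poly D z = Determinant.det (B k) * (\<Prod>i<N. z - r i)" for z
    by (subst D) (simp add: poly_prod)
  have sum_mset: "(\<Sum>l\<in>#mset xs. g l) = (\<Sum>i<N. g (r i))" for g :: "complex \<Rightarrow> ennreal"
  proof -
    have "(\<Sum>l\<in>#mset xs. g l) = (\<Sum>l\<leftarrow>xs. g l)"
      by (metis mset_map sum_mset_sum_list)
    also have "\<dots> = (\<Sum>i<N. g (r i))"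
      by (simp add: sum.list_conv_set_nth atLeast0LessThan len r_def)
    finally show ?thesis .
  qed
  \<comment> \<open>Listing the roots with multiplicity turns the distribution into the image of the
    uniform distribution on indices.\<close>
  have esd: "empirical_spectral_distribution n k B = distr (measure_pmf (pmf_of_set {..<N})) borel r"
  proof (rule measure_eqI)
    fix A assume "A \<in> sets (empirical_spectral_distribution n k B)"
    then have A: "A \<in> sets borel" by simp
    have "emeasure (empirical_spectral_distribution n k B) A =
        ennreal (1 / real N) * (\<Sum>i<N. indicator A (r i))"
      using A by (simp add: emeasure_esd finite_eigenvalues_def D_def[symmetric] xs[symmetric] sum_mset N_def[symmetric])
    also have "(\<Sum>i<N. indicator A (r i)) = (of_nat (card ({..<N} \<inter> r -` A)) :: ennreal)"
      by (simp add: indicator_def sum.If_cases vimage_def)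
    also have "ennreal (1 / real N) * of_nat (card ({..<N} \<inter> r -` A)) = ennreal (real (card ({..<N} \<inter> r -` A)) / real N)"
      by (simp add: ennreal_of_nat_eq_real_of_nat ennreal_mult[symmetric])
    also have "\<dots> = emeasure (distr (measure_pmf (pmf_of_set {..<N})) borel r) A"
      using A N by (simp add: emeasure_distr emeasure_pmf_of_set)
    finally show "emeasure (empirical_spectral_distribution n k B) A =
        emeasure (distr (measure_pmf (pmf_of_set {..<N})) borel r) A" .
  qed simp
  have "prob_space (empirical_spectral_distribution n k B)"
    unfolding esd by (intro measure_pmf.prob_space_distr) simp
  moreover have "measure_distribution (empirical_spectral_distribution n k B) \<phi> = (\<Sum>i<N. \<phi> (r i)) / of_nat N"
    if "\<phi> \<in> borel_measurable borel" for \<phi>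
  proof -
    have "measure_distribution (empirical_spectral_distribution n k B) \<phi> = (LINT i|pmf_of_set {..<N}. \<phi> (r i))"
      unfolding measure_distribution_def esd using that by (intro integral_distr) auto
    also have "\<dots> = (\<Sum>i<N. pmf (pmf_of_set {..<N}) i *\<^sub>R \<phi> (r i))"
      using N by (intro integral_measure_pmf) auto
    also have "\<dots> = (\<Sum>i<N. \<phi> (r i) / of_nat N)"
      using N by (intro sum.cong) (auto simp: scaleR_conv_of_real indicator_def)
    finally show ?thesis by (simp add: sum_divide_distrib)
  qed
  ultimately show thesis
    using that[of r] poly unfolding D_def N_def by blast
qed

section \<open>Determinants of random linear combinations of matrices\<close>

definition disc_const :: real where
  "disc_const = enn2real (\<integral>\<^sup>+z. indicator (cball 0 1) z * ennreal (1 / cmod z) \<partial>lborel)"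

lemma disc_const_nonneg: "0 \<le> disc_const"
  by (simp add: disc_const_def)

lemma ennreal_disc_const:
  "(\<integral>\<^sup>+z. indicator (cball w 1) z * ennreal (1 / cmod (z - w)) \<partial>lborel) = ennreal disc_const"
  unfolding nn_integral_inverse_norm_disc disc_const_def
  using nn_integral_inverse_norm_unit_disc by simp

text \<open>Split at the unit disc around the root w = -b/a. Inside, the density is at most M and
  1/|z - w| integrates to \<open>disc_const\<close>; outside, 1/|z - w| is at most 1 and the density
  has mass 1. The bound is uniform in b.\<close>

lemma nn_integral_inverse_affine_le:
  assumes f[measurable]: "f \<in> borel_measurable borel"
    and bound: "AE z in lborel. f z \<le> ennreal M" and "M \<ge> 0"
    and prob: "(\<integral>\<^sup>+z. f z \<partial>lborel) = 1"
  shows "(\<integral>\<^sup>+z. inverse (ennreal (cmod (a * z + b))) \<partial>density lborel f) \<le>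
    ennreal (1 + M * disc_const) * inverse (ennreal (cmod a))"
proof (cases "a = 0")
  \<comment> \<open>The right side is infinite here: \<open>inverse 0\<close> is infinite in
    \<open>ennreal\<close> and its factor is positive.\<close>
  case True
  have "0 < 1 + M * disc_const"
    using \<open>M \<ge> 0\<close> disc_const_nonneg by (simp add: add_pos_nonneg)
  with True show ?thesis by (simp add: ennreal_mult_top)
next
  case False
  define w where "w = - b / a"
  let ?g = "\<lambda>z. indicator (cball w 1) z * ennreal (1 / cmod (z - w))"
  have [measurable]: "cball w 1 \<in> sets borel" by simp
  have "(\<integral>\<^sup>+z. inverse (ennreal (cmod (a * z + b))) \<partial>density lborel f) =
      (\<integral>\<^sup>+z. f z * inverse (ennreal (cmod (a * z + b))) \<partial>lborel)"
    by (subst nn_integral_density) auto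
  also have "\<dots> \<le> (\<integral>\<^sup>+z. inverse (ennreal (cmod a)) *
      (ennreal M * ?g z + f z) \<partial>lborel)"
  proof (rule nn_integral_mono_AE)
    have "AE z in lborel. z \<noteq> w" by (rule AE_lborel_singleton)
    with bound show "AE z in lborel. f z * inverse (ennreal (cmod (a * z + b))) \<le> inverse (ennreal (cmod a)) *
      (ennreal M * ?g z + f z)"
    proof eventually_elim
      case (elim z)
      have "a * z + b = a * (z - w)" using False by (simp add: w_def field_simps)
      then have "inverse (ennreal (cmod (a * z + b))) = inverse (ennreal (cmod a)) * ennreal (1 / cmod (z - w))"
        using elim(2) by (simp add: norm_mult ennreal_mult ennreal_inverse_mult inverse_ennreal inverse_eq_divide)
      moreover have "f z * ennreal (1 / cmod (z - w)) \<le>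
          ennreal M * ?g z + f z"
      proof (cases "z \<in> cball w 1")
        case True
        then have "f z * ennreal (1 / cmod (z - w)) \<le> ennreal M * ?g z"
          using elim(1) by (simp add: mult_right_mono)
        then show ?thesis by (rule add_increasing2[rotated]) simp
      next
        case False
        then have "1 < cmod (z - w)" by (simp add: dist_norm norm_minus_commute)
        then have "ennreal (1 / cmod (z - w)) \<le> 1" by (simp add: divide_le_eq_1)
        then have "f z * ennreal (1 / cmod (z - w)) \<le> f z * 1" by (intro mult_left_mono) auto
        then show ?thesis by (simp add: add_increasing)
      qed
      ultimately show ?case
        by (metis mult.left_commute mult_left_mono zero_le)
    qed
  qed
  also have "\<dots> = inverse (ennreal (cmod a)) *
      (ennreal M * (\<integral>\<^sup>+z. ?g z \<partial>lborel) + (\<integral>\<^sup>+z. f z \<partial>lborel))"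
    by (subst nn_integral_cmult, measurable, subst nn_integral_add, measurable, subst nn_integral_cmult) auto
  also have "\<dots> = ennreal (1 + M * disc_const) * inverse (ennreal (cmod a))"
    using \<open>M \<ge> 0\<close> disc_const_nonneg
    by (simp add: ennreal_disc_const prob ennreal_mult[symmetric] ennreal_1[symmetric] ennreal_plus[symmetric]
        mult.commute add.commute del: ennreal_1 ennreal_plus)
  finally show ?thesis .
qed

text \<open>Expansion along the last row: its cofactors do not see that row, so only the corner term
  changes, and its cofactor is the leading principal minor.\<close>

lemma det_add_corner:
  fixes f :: "nat \<times> nat \<Rightarrow> 'a::comm_ring_1"
  shows "Determinant.det (Matrix.mat (Suc m) (Suc m) (\<lambda>p. f p + (if p = (m, m) then t else 0))) =
    t * Determinant.det (Matrix.mat m m f) + Determinant.det (Matrix.mat (Suc m) (Suc m) f)"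
proof -
  define A where "A = Matrix.mat (Suc m) (Suc m) (\<lambda>p. f p + (if p = (m, m) then t else 0))"
  define A0 where "A0 = Matrix.mat (Suc m) (Suc m) f"
  have car: "A \<in> carrier_mat (Suc m) (Suc m)" "A0 \<in> carrier_mat (Suc m) (Suc m)"
    by (simp_all add: A_def A0_def)
  have cof: "cofactor A m j = cofactor A0 m j" if "j < Suc m" for j
    unfolding cofactor_def
    by (intro arg_cong2[where f = "(*)"] arg_cong[where f = Determinant.det] refl eq_matI)
       (auto simp: mat_delete_def A_def A0_def)
  have corner: "cofactor A0 m m = Determinant.det (Matrix.mat m m f)"
  proof -
    have "mat_delete A0 m m = Matrix.mat m m f"
      by (rule eq_matI) (auto simp: mat_delete_def A0_def)
    then show ?thesis by (simp add: cofactor_def)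
  qed
  have "Determinant.det A = (\<Sum>j<Suc m. A $$ (m, j) * cofactor A m j)"
    by (rule laplace_expansion_row[OF car(1)]) simp
  also have "\<dots> = (\<Sum>j<Suc m. A0 $$ (m, j) * cofactor A0 m j + (if j = m then t * cofactor A0 m j else 0))"
  proof (rule sum.cong)
    fix j assume "j \<in> {..<Suc m}"
    then have "A $$ (m, j) = A0 $$ (m, j) + (if j = m then t else 0)"
      by (simp add: A_def A0_def)
    then show "A $$ (m, j) * cofactor A m j =
        A0 $$ (m, j) * cofactor A0 m j + (if j = m then t * cofactor A0 m j else 0)"
      using cof \<open>j \<in> {..<Suc m}\<close> by (simp add: algebra_simps)
  qed simp
  also have "\<dots> = Determinant.det A0 + t * cofactor A0 m m"
    by (simp only: sum.distrib laplace_expansion_row[OF car(2), of m, symmetric]) simp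
  finally show ?thesis
    by (simp add: corner[unfolded A0_def] A_def A0_def add.commute)
qed

definition combination_entry :: "nat \<Rightarrow> (nat \<Rightarrow> complex) \<Rightarrow> (nat \<times> nat \<times> nat \<Rightarrow> complex) \<Rightarrow> nat \<times> nat \<Rightarrow> complex" where
  "combination_entry k c x p = (\<Sum>j\<le>k. c j * x (j, p))"

text \<open>The size m is separate from the size of the sampled matrices, so that all leading
  principal minors are functions of one family x. The determinant of P at z is the case of full size
  with \<open>c j\<close> equal to alpha_j z^j.\<close>

definition combination_det :: "nat \<Rightarrow> (nat \<Rightarrow> complex) \<Rightarrow> nat \<Rightarrow> (nat \<times> nat \<times> nat \<Rightarrow> complex) \<Rightarrow> complex" where
  "combination_det k c m x = Determinant.det (Matrix.mat m m (combination_entry k c x))"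

text \<open>The index \<open>(j, (a, b))\<close> stands for the \<open>(a, b)\<close> entry of the \<open>j\<close>-th coefficient matrix.\<close>

definition entry_indices :: "nat \<Rightarrow> nat \<Rightarrow> (nat \<times> nat \<times> nat) set" where
  "entry_indices n k = {..k} \<times> ({..<n} \<times> {..<n})"

lemma finite_entry_indices [simp]: "finite (entry_indices n k)"
  by (simp add: entry_indices_def)

lemma combination_det_altdef:
  "combination_det k c m x =
    (\<Sum>p\<in>{p. p permutes {0..<m}}. signof p * (\<Prod>i = 0..<m. combination_entry k c x (i, p i)))"
proof -
  have "i < m \<Longrightarrow> p i < m" if "p permutes {0..<m}" for p i
    using permutes_in_image[OF that, of i] by auto
  then show ?thesis
    unfolding combination_det_def by (subst det_def'[of _ m]) (auto intro!: sum.cong prod.cong)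
qed

text \<open>Both coefficients and entries may vary, which covers dependence on the sample at fixed
  z, on z at a fixed sample, and on both jointly.\<close>

lemma measurable_combination_det:
  assumes "\<And>j p. j \<le> k \<Longrightarrow> p \<in> {..<m} \<times> {..<m} \<Longrightarrow> (\<lambda>\<omega>. c \<omega> j * x \<omega> (j, p)) \<in> borel_measurable N"
  shows "(\<lambda>\<omega>. combination_det k (c \<omega>) m (x \<omega>)) \<in> borel_measurable N"
proof -
  have "i < m \<Longrightarrow> p i < m" if "p permutes {0..<m}" for p i
    using permutes_in_image[OF that, of i] by auto
  moreover have "(\<lambda>\<omega>. combination_entry k (c \<omega>) (x \<omega>) q) \<in> borel_measurable N" if "q \<in> {..<m} \<times> {..<m}" for q
    unfolding combination_entry_def using assms[OF _ that] by (intro borel_measurable_sum) auto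
  ultimately show ?thesis
    unfolding combination_det_altdef
    by (intro borel_measurable_sum borel_measurable_times borel_measurable_const borel_measurable_prod) auto
qed

text \<open>The coordinate y enters only the corner entry, where it is multiplied by
  \<open>c j0\<close>; hence the determinant is affine in y with slope \<open>c j0\<close> times the
  previous minor.\<close>

lemma combination_det_corner:
  assumes "j0 \<le> k"
  shows "combination_det k c (Suc m) (x((j0, m, m) := y)) =
    c j0 * y * combination_det k c m x + combination_det k c (Suc m) (x((j0, m, m) := 0))"
proof -
  have e: "combination_entry k c (x((j0, m, m) := y)) =
     (\<lambda>p. combination_entry k c (x((j0, m, m) := 0)) p + (if p = (m, m) then c j0 * y else 0))"
  proof
    fix p
    have "combination_entry k c (x((j0, m, m) := y)) p =
        (\<Sum>j\<le>k. c j * (x((j0, m, m) := 0)) (j, p) + (if j = j0 then if p = (m, m) then c j * y else 0 else 0))"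
      unfolding combination_entry_def by (intro sum.cong) auto
    also have "\<dots> = combination_entry k c (x((j0, m, m) := 0)) p + (if p = (m, m) then c j0 * y else 0)"
      using assms by (simp add: sum.distrib combination_entry_def)
    finally show "combination_entry k c (x((j0, m, m) := y)) p =
      combination_entry k c (x((j0, m, m) := 0)) p + (if p = (m, m) then c j0 * y else 0)" .
  qed
  have "Matrix.mat m m (combination_entry k c (x((j0, m, m) := 0))) = Matrix.mat m m (combination_entry k c x)"
    by (rule eq_matI) (auto simp: combination_entry_def intro!: sum.cong)
  then show ?thesis
    unfolding combination_det_def e det_add_corner by simp
qed

text \<open>Indices start at 0, so position (m, m) lies just outside the leading m by m block. The
  slope in the affine formula is thus independent of the coordinate that is integrated out.\<close>

lemma combination_det_irrelevant:
  "combination_det k c m (x((j0, m, m) := y)) = combination_det k c m x"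
proof -
  have "Matrix.mat m m (combination_entry k c (x((j0, m, m) := y))) = Matrix.mat m m (combination_entry k c x)"
    by (rule eq_matI) (auto simp: combination_entry_def intro!: sum.cong)
  then show ?thesis by (simp add: combination_det_def)
qed

text \<open>Induction on the size of the minor over a fixed product space. Fubini isolates the
  corner coordinate of the matrix j0, the affine bound applies with the other coordinates frozen,
  and one factor is gained per step. The empty determinant is 1.\<close>

lemma nn_integral_inverse_combination_det_le:
  fixes \<nu> :: "nat \<times> nat \<times> nat \<Rightarrow> complex measure"
  assumes prob: "\<And>i. prob_space (\<nu> i)" and sets: "\<And>i. sets (\<nu> i) = sets borel"
    and anti: "\<And>i a b. i \<in> entry_indices n k \<Longrightarrow>
      (\<integral>\<^sup>+y. inverse (ennreal (cmod (a * y + b))) \<partial>\<nu> i) \<le> K * inverse (ennreal (cmod a))"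
    and j0: "j0 \<le> k" and "m \<le> n"
  shows "(\<integral>\<^sup>+x. inverse (ennreal (cmod (combination_det k c m x))) \<partial>PiM (entry_indices n k) \<nu>) \<le>
    (K * inverse (ennreal (cmod (c j0)))) ^ m"
  using \<open>m \<le> n\<close>
proof (induction m)
  interpret product_prob_space \<nu> "entry_indices n k"
    by (rule product_prob_spaceI[OF prob])
  have space: "space (\<nu> i) = UNIV" for i using sets_eq_imp_space_eq[OF sets[of i]] by simp
  have meas: "combination_det k c m \<in> borel_measurable (PiM (entry_indices n k) \<nu>)" if "m \<le> n" for m
  proof (rule measurable_combination_det)
    fix j p assume "j \<le> k" "p \<in> {..<m} \<times> {..<m}"
    then have "(j, p) \<in> entry_indices n k" using that by (auto simp: entry_indices_def)
    then have "(\<lambda>x. x (j, p)) \<in> borel_measurable (PiM (entry_indices n k) \<nu>)"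
      using measurable_component_singleton[of "(j, p)" "entry_indices n k" \<nu>]
        measurable_cong_sets[OF refl sets[of "(j, p)"]] by blast
    then show "(\<lambda>x. c j * x (j, p)) \<in> borel_measurable (PiM (entry_indices n k) \<nu>)"
      by (intro borel_measurable_times) auto
  qed
  {
    case 0
    show ?case by (simp add: combination_det_def emeasure_space_1)
  next
    case (Suc m)
    define i where "i = (j0, m, m)"
    have i: "i \<in> entry_indices n k" using Suc.prems j0 by (simp add: i_def entry_indices_def)
    define J where "J = entry_indices n k - {i}"
    have J: "finite J" "i \<notin> J" "insert i J = entry_indices n k" using i by (auto simp: J_def)
    define F where "F m x = inverse (ennreal (cmod (combination_det k c m x)))" for m x
    have F: "F m \<in> borel_measurable (PiM (insert i J) \<nu>)" if "m \<le> n" for m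
      using meas[OF that] unfolding J F_def by measurable
    have "(\<integral>\<^sup>+x. F (Suc m) x \<partial>PiM (insert i J) \<nu>) =
        (\<integral>\<^sup>+x. (\<integral>\<^sup>+y. F (Suc m) (x(i := y)) \<partial>\<nu> i) \<partial>PiM J \<nu>)"
      using J F Suc.prems by (intro product_nn_integral_insert) auto
    also have "\<dots> \<le> (\<integral>\<^sup>+x. K * inverse (ennreal (cmod (c j0))) * (\<integral>\<^sup>+y. F m (x(i := y)) \<partial>\<nu> i) \<partial>PiM J \<nu>)"
    proof (rule nn_integral_mono)
      fix x
      have eq: "combination_det k c (Suc m) (x(i := y)) =
          (c j0 * combination_det k c m x) * y + combination_det k c (Suc m) (x(i := 0))" for y
        unfolding i_def by (subst combination_det_corner[OF j0]) (simp only: mult_ac)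
      have "(\<integral>\<^sup>+y. F (Suc m) (x(i := y)) \<partial>\<nu> i) =
          (\<integral>\<^sup>+y. inverse (ennreal (cmod ((c j0 * combination_det k c m x) * y + combination_det k c (Suc m) (x(i := 0))))) \<partial>\<nu> i)"
        unfolding F_def by (intro nn_integral_cong arg_cong[where f = "\<lambda>t. inverse (ennreal (cmod t))"] eq)
      also have "\<dots> \<le> K * inverse (ennreal (cmod (c j0 * combination_det k c m x)))"
        by (rule anti[OF i])
      also have "\<dots> = K * inverse (ennreal (cmod (c j0))) * F m x"
        by (simp add: norm_mult ennreal_mult ennreal_inverse_mult F_def mult.assoc)
      \<comment> \<open>The smaller minor ignores this coordinate, so averaging over a probability
        measure changes nothing. It restores the full product measure in which the induction
        hypothesis is stated.\<close>
      also have "F m x = (\<integral>\<^sup>+y. F m (x(i := y)) \<partial>\<nu> i)"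
        by (simp add: F_def i_def combination_det_irrelevant prob_space.emeasure_space_1[OF prob])
      finally show "(\<integral>\<^sup>+y. F (Suc m) (x(i := y)) \<partial>\<nu> i) \<le>
        K * inverse (ennreal (cmod (c j0))) * (\<integral>\<^sup>+y. F m (x(i := y)) \<partial>\<nu> i)" .
    qed
    also have "\<dots> = K * inverse (ennreal (cmod (c j0))) * (\<integral>\<^sup>+x. (\<integral>\<^sup>+y. F m (x(i := y)) \<partial>\<nu> i) \<partial>PiM J \<nu>)"
    proof (rule nn_integral_cmult)
      have "F m \<in> borel_measurable (PiM (insert i J) \<nu>)" using Suc.prems by (intro F) auto
      then have "(\<lambda>(x, y). F m (x(i := y))) \<in> borel_measurable (PiM J \<nu> \<Otimes>\<^sub>M \<nu> i)"
        using measurable_compose[OF measurable_add_dim[of i J \<nu>], of "F m" borel] by (simp add: case_prod_unfold)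
      then show "(\<lambda>x. \<integral>\<^sup>+y. F m (x(i := y)) \<partial>\<nu> i) \<in> borel_measurable (PiM J \<nu>)"
        by (rule sigma_finite_measure.borel_measurable_nn_integral[OF prob_space_imp_sigma_finite[OF prob]])
    qed
    also have "(\<integral>\<^sup>+x. (\<integral>\<^sup>+y. F m (x(i := y)) \<partial>\<nu> i) \<partial>PiM J \<nu>) = (\<integral>\<^sup>+x. F m x \<partial>PiM (insert i J) \<nu>)"
      using J F Suc.prems by (intro product_nn_integral_insert[symmetric]) auto
    also have "K * inverse (ennreal (cmod (c j0))) * (\<integral>\<^sup>+x. F m x \<partial>PiM (insert i J) \<nu>) \<le>
        K * inverse (ennreal (cmod (c j0))) * (K * inverse (ennreal (cmod (c j0)))) ^ m"
      using Suc.IH Suc.prems unfolding J F_def by (intro mult_left_mono) auto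
    finally show ?case unfolding J F_def by simp
  }
qed

section \<open>From determinants to logarithms\<close>

text \<open>The Leibniz formula has n! terms, and n! is at most n^n. The loss is a factor n per row,
  which costs only ln n after (1/n) ln.\<close>

lemma cmod_det_le:
  fixes f :: "nat \<times> nat \<Rightarrow> complex"
  assumes "\<And>p. p \<in> {..<n} \<times> {..<n} \<Longrightarrow> cmod (f p) \<le> s"
  shows "cmod (Determinant.det (Matrix.mat n n f)) \<le> (real n * s) ^ n"
proof (cases "n = 0")
  case False
  then have "0 \<le> s" using assms[of "(0, 0)"] by (auto intro: order_trans[OF norm_ge_zero])
  have perm: "i < n \<Longrightarrow> p i < n" if "p permutes {0..<n}" for p i
    using permutes_in_image[OF that, of i] by auto
  have "cmod (signof p * (\<Prod>i = 0..<n. Matrix.mat n n f $$ (i, p i))) \<le> s ^ n" if "p permutes {0..<n}" for p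
  proof -
    have "cmod (signof p * (\<Prod>i = 0..<n. Matrix.mat n n f $$ (i, p i))) = (\<Prod>i = 0..<n. cmod (f (i, p i)))"
      using perm[OF that] by (simp add: norm_mult prod_norm[symmetric] sign_def)
    also have "\<dots> \<le> (\<Prod>i = 0..<n. s)"
      using assms perm[OF that] by (intro prod_mono) auto
    finally show ?thesis by simp
  qed
  then have "cmod (Determinant.det (Matrix.mat n n f)) \<le> real (card {p. p permutes {0..<n}}) * s ^ n"
    unfolding det_def'[OF mat_carrier] by (intro sum_norm_bound) auto
  also have "card {p. p permutes {0..<n}} = fact n"
    by (rule card_permutations) auto
  also have "real (fact n) * s ^ n \<le> real n ^ n * s ^ n"
  proof (rule mult_right_mono)
    have "(fact n :: real) \<le> of_nat (n ^ n)" by (rule fact_le_power)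
    then show "real (fact n) \<le> real n ^ n" by simp
  qed (use \<open>0 \<le> s\<close> in simp)
  finally show ?thesis by (simp add: power_mult_distrib)
qed simp

text \<open>With y the square root of x the claim reduces to ln x = 2 ln y being at most y.\<close>

lemma max_ln_square_le:
  fixes x :: real
  assumes "x > 0"
  shows "(max 0 (ln x))\<^sup>2 \<le> x"
proof (cases "x \<le> 1")
  case True
  with assms show ?thesis by (simp add: max_def)
next
  case False
  define y where "y = sqrt x"
  have y: "y > 0" "x = y\<^sup>2" using assms by (auto simp: y_def)
  \<comment> \<open>The tangent inequality is used at y/2 instead of y to obtain slope 1/2; the
    leftover constant ln 2 - 1 is negative.\<close>
  have "ln (y / 2) \<le> y / 2 - 1" using y by (intro ln_le_minus_one) auto
  moreover have "ln (y / 2) = ln y - ln 2" using y by (simp add: ln_div)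
  moreover have "ln 2 < (1::real)" by (rule ln_2_less_1)
  moreover have "ln x = 2 * ln y" using y by (simp add: ln_realpow)
  ultimately have "ln x \<le> y" by linarith
  moreover have "0 \<le> ln x" using False by simp
  ultimately have "(ln x)\<^sup>2 \<le> y\<^sup>2" by (intro power_mono)
  with \<open>0 \<le> ln x\<close> show ?thesis by (simp add: y(2)[symmetric] max_def)
qed

text \<open>A pointwise bound prepared for taking expectations: d is the modulus of the determinant,
  s the sum of the moduli of the N entries, and b^n / \<open>\<sigma>\<close>^n bounds the
  expectation of 1/d. Both s/N and (\<open>\<sigma>\<close>/b)^n / d then have expectation at most
  1. The first controls positive errors, the second negative ones.\<close>

lemma normalised_ln_square_le:
  fixes d s \<sigma> b N :: real and n :: nat
  assumes n: "n \<ge> 1" and pos: "d > 0" "s \<ge> 0" "\<sigma> > 0" "b \<ge> 1" "N \<ge> 1"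
    and d: "d \<le> (real n * (\<sigma> * s)) ^ n"
  shows "(ln d / n - ln \<sigma>)\<^sup>2 \<le>
    2 * (ln (n * N))\<^sup>2 + 2 * (ln b)\<^sup>2 + (2 * (s / N) + 2 * (\<sigma> ^ n / b ^ n * (1 / d)))"
proof -
  define V where "V = ln d / n - ln \<sigma>"
  have sq: "v\<^sup>2 \<le> 2 * p\<^sup>2 + 2 * w" if "0 \<le> v" "v \<le> p + max 0 (ln w)" "w > 0" for v p w :: real
  proof -
    have "v\<^sup>2 \<le> (p + max 0 (ln w))\<^sup>2" using that by (intro power_mono) auto
    also have "\<dots> \<le> 2 * p\<^sup>2 + 2 * (max 0 (ln w))\<^sup>2"
      using zero_le_power2[of "p - max 0 (ln w)"] by (simp add: power2_sum power2_diff)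
    finally show ?thesis using max_ln_square_le[OF that(3)] by linarith
  qed
  have s: "s > 0"
    using d pos n by (cases "s = 0") (auto simp: power_0_left)
  have rest: "0 \<le> 2 * (s / N)" "0 \<le> 2 * (\<sigma> ^ n / b ^ n * (1 / d))" "0 \<le> (ln (n * N))\<^sup>2" "0 \<le> (ln b)\<^sup>2"
    using pos by auto
  show ?thesis
  proof (cases "V \<ge> 0")
    case True
    have "ln d \<le> ln ((real n * (\<sigma> * s)) ^ n)"
      using d pos n s by (subst ln_le_cancel_iff) auto
    also have "\<dots> = n * ln (real n * (\<sigma> * s))" using pos n s by (simp add: ln_realpow)
    finally have "ln d / n \<le> ln (real n * (\<sigma> * s))" using n by (simp add: field_simps)
    also have "real n * (\<sigma> * s) = \<sigma> * ((n * N) * (s / N))" using pos by simp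
    also have "ln (\<sigma> * ((n * N) * (s / N))) = ln \<sigma> + (ln (n * N) + ln (s / N))"
      using pos n s by (subst ln_mult_pos, simp, simp, subst ln_mult_pos) auto
    finally have "V \<le> ln (n * N) + max 0 (ln (s / N))" by (simp add: V_def)
    from sq[OF True this] s pos have "V\<^sup>2 \<le> 2 * (ln (n * N))\<^sup>2 + 2 * (s / N)" by simp
    with rest show ?thesis unfolding V_def by linarith
  next
    case False
    define W where "W = \<sigma> ^ n / b ^ n * (1 / d)"
    have W: "W > 0" using pos by (simp add: W_def)
    have "ln W = n * ln \<sigma> - n * ln b - ln d"
      unfolding W_def using pos by (simp add: ln_mult_pos ln_div ln_realpow)
    then have "ln W / n = ln \<sigma> - ln b - ln d / n" using n by (simp add: diff_divide_distrib)
    then have "- V = ln b + ln W / n" by (simp add: V_def)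
    \<comment> \<open>Division by n only shrinks a positive logarithm, and a negative one is
      absorbed by the maximum.\<close>
    moreover have "ln W / n \<le> max 0 (ln W)"
    proof (cases "ln W \<ge> 0")
      case True
      then have "ln W / n \<le> ln W / 1" using n by (intro divide_left_mono) auto
      then show ?thesis by simp
    next
      case False
      then have "ln W / n \<le> 0" using n by (simp add: divide_nonpos_pos)
      then show ?thesis by simp
    qed
    ultimately have "(- V)\<^sup>2 \<le> 2 * (ln b)\<^sup>2 + 2 * W" using False W by (intro sq) auto
    then have "V\<^sup>2 \<le> 2 * (ln b)\<^sup>2 + 2 * W" by simp
    with rest show ?thesis unfolding V_def[symmetric] W_def[symmetric] by linarith
  qed
qed

section \<open>Second moment of the logarithmic error\<close>

definition coefficient_norm :: "nat \<Rightarrow> (nat \<Rightarrow> complex) \<Rightarrow> real" where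
  "coefficient_norm k c = sqrt (\<Sum>j\<le>k. (cmod (c j))\<^sup>2)"

lemma coefficient_norm_ge: "j \<le> k \<Longrightarrow> cmod (c j) \<le> coefficient_norm k c"
  unfolding coefficient_norm_def
  by (intro real_le_rsqrt member_le_sum[of j _ "\<lambda>j. (cmod (c j))\<^sup>2"]) auto

text \<open>Supplies the matrix whose entries are integrated out. Passing from the Euclidean norm to
  the largest coefficient costs a factor sqrt (k + 1), hence only a logarithm of k.\<close>

lemma coefficient_norm_le_Max:
  obtains j where "j \<le> k" "coefficient_norm k c \<le> sqrt (real (k + 1)) * cmod (c j)"
proof -
  define m where "m = Max ((\<lambda>j. cmod (c j)) ` {..k})"
  have "m \<in> (\<lambda>j. cmod (c j)) ` {..k}" unfolding m_def by (intro Max_in) auto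
  then obtain j where j: "j \<le> k" "cmod (c j) = m" by auto
  have "cmod (c i) \<le> m" if "i \<le> k" for i using that unfolding m_def by (intro Max_ge) auto
  then have "(\<Sum>i\<le>k. (cmod (c i))\<^sup>2) \<le> of_nat (card {..k}) * m\<^sup>2"
    by (intro sum_bounded_above power_mono) auto
  then have "coefficient_norm k c \<le> sqrt (real (k + 1) * m\<^sup>2)"
    unfolding coefficient_norm_def by (intro real_sqrt_le_mono) simp
  also have "\<dots> = sqrt (real (k + 1)) * m" using j by (auto simp: real_sqrt_mult)
  finally show thesis using that j by simp
qed

definition random_det ::
    "(nat \<times> nat \<times> nat \<Rightarrow> 'w \<Rightarrow> complex) \<Rightarrow> nat \<Rightarrow> nat \<Rightarrow> (nat \<Rightarrow> complex) \<Rightarrow> 'w \<Rightarrow> complex" where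
  "random_det Y n k c \<omega> = combination_det k c n (\<lambda>i. Y i \<omega>)"

definition log_error ::
    "(nat \<times> nat \<times> nat \<Rightarrow> 'w \<Rightarrow> complex) \<Rightarrow> nat \<Rightarrow> nat \<Rightarrow> (nat \<Rightarrow> complex) \<Rightarrow> 'w \<Rightarrow> real" where
  "log_error Y n k c \<omega> = ln (cmod (random_det Y n k c \<omega>)) / n - ln (coefficient_norm k c)"

text \<open>Here (k + 1) n^2 counts the random entries and K sqrt (k + 1) is the loss per row in the
  inverse moment. The summand 4 is twice 1 + 1, from the two normalised expectations.\<close>

definition error_bound :: "nat \<Rightarrow> nat \<Rightarrow> real \<Rightarrow> real" where
  "error_bound n k K =
    2 * (ln (real n * (real (k + 1) * (real n)\<^sup>2)))\<^sup>2 + 2 * (ln (K * sqrt (real (k + 1))))\<^sup>2 + 4"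

text \<open>Isolates what the estimates take from the entries: joint independence, first moments at
  most 1, and an inverse moment bound with one constant \<open>K\<close> for all of them. With
  \<open>K \<ge> 1\<close> the logarithms in the error bound are nonnegative.\<close>

locale random_coefficients = prob_space \<Omega> for \<Omega> :: "'w measure" +
  fixes Y :: "nat \<times> nat \<times> nat \<Rightarrow> 'w \<Rightarrow> complex" and n k :: nat and K :: real
  assumes n: "n \<ge> 1" and K: "K \<ge> 1"
    and indep: "indep_vars (\<lambda>_. borel) Y (entry_indices n k)"
    and moment: "i \<in> entry_indices n k \<Longrightarrow> (\<integral>\<^sup>+\<omega>. ennreal (cmod (Y i \<omega>)) \<partial>\<Omega>) \<le> 1"
    and anti: "i \<in> entry_indices n k \<Longrightarrow>
      (\<integral>\<^sup>+\<omega>. inverse (ennreal (cmod (a * Y i \<omega> + b))) \<partial>\<Omega>) \<le> ennreal K * inverse (ennreal (cmod a))"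
begin

lemma Y_measurable: "i \<in> entry_indices n k \<Longrightarrow> Y i \<in> borel_measurable \<Omega>"
  using indep by (auto simp: indep_vars_def)

lemma random_det_measurable [measurable]: "random_det Y n k c \<in> borel_measurable \<Omega>"
  unfolding random_det_def[abs_def]
  by (intro measurable_combination_det borel_measurable_times borel_measurable_const Y_measurable)
     (auto simp: entry_indices_def)

lemma nn_integral_inverse_random_det_le_power:
  assumes "j \<le> k"
  shows "(\<integral>\<^sup>+\<omega>. inverse (ennreal (cmod (random_det Y n k c \<omega>))) \<partial>\<Omega>) \<le>
    (ennreal K * inverse (ennreal (cmod (c j)))) ^ n"
proof -
  define I where "I = entry_indices n k"
  have I: "I \<noteq> {}" "finite I" using n by (auto simp: I_def entry_indices_def lessThan_empty_iff)
  \<comment> \<open>Outside the index set a point mass serves as a dummy, because the product lemma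
    asks for a probability measure at every index.\<close>
  define \<nu> where "\<nu> i = (if i \<in> I then distr \<Omega> borel (Y i) else return borel 0)" for i
  define g where "g x = inverse (ennreal (cmod (combination_det k c n x)))" for x
  define T where "T \<omega> = (\<lambda>i\<in>I. Y i \<omega>)" for \<omega>
  have T: "T \<in> measurable \<Omega> (PiM I (\<lambda>_. borel))"
    unfolding T_def[abs_def] by (intro measurable_restrict Y_measurable) (simp add: I_def)
  have "combination_det k c n \<in> borel_measurable (PiM I (\<lambda>_. borel))"
  proof (rule measurable_combination_det)
    fix j p assume "j \<le> k" "p \<in> {..<n} \<times> {..<n}"
    then have "(j, p) \<in> I" by (auto simp: I_def entry_indices_def)
    then show "(\<lambda>x. c j * x (j, p)) \<in> borel_measurable (PiM I (\<lambda>_. borel))"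
      by (intro borel_measurable_times measurable_component_singleton) auto
  qed
  then have g: "g \<in> borel_measurable (PiM I (\<lambda>_. borel))"
    unfolding g_def[abs_def] by measurable
  have law: "distr \<Omega> (PiM I (\<lambda>_. borel)) T = PiM I \<nu>"
  proof -
    have "distr \<Omega> (PiM I (\<lambda>_. borel)) T = PiM I (\<lambda>i. distr \<Omega> borel (Y i))"
      using indep_vars_iff_distr_eq_PiM'[OF I(1), where M' = "\<lambda>_. borel" and X = Y] indep Y_measurable
      by (simp add: I_def T_def[abs_def])
    also have "\<dots> = PiM I \<nu>" by (intro PiM_cong) (auto simp: \<nu>_def)
    finally show ?thesis .
  qed
  have "random_det Y n k c \<omega> = combination_det k c n (T \<omega>)" for \<omega>
  proof -
    have "Matrix.mat n n (combination_entry k c (\<lambda>i. Y i \<omega>)) = Matrix.mat n n (combination_entry k c (T \<omega>))"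
      by (rule eq_matI) (auto simp: combination_entry_def T_def I_def entry_indices_def intro!: sum.cong)
    then show ?thesis by (simp add: random_det_def combination_det_def)
  qed
  then have "(\<integral>\<^sup>+\<omega>. inverse (ennreal (cmod (random_det Y n k c \<omega>))) \<partial>\<Omega>) = (\<integral>\<^sup>+\<omega>. g (T \<omega>) \<partial>\<Omega>)"
    by (simp add: g_def)
  also have "\<dots> = (\<integral>\<^sup>+x. g x \<partial>PiM I \<nu>)"
    unfolding law[symmetric] by (rule nn_integral_distr[symmetric, OF T]) (simp add: g)
  also have "\<dots> \<le> (ennreal K * inverse (ennreal (cmod (c j)))) ^ n"
    unfolding g_def I_def
  proof (rule nn_integral_inverse_combination_det_le)
    show "prob_space (\<nu> i)" for i
      using Y_measurable[of i] by (cases "i \<in> I") (simp_all add: \<nu>_def I_def prob_space_distr prob_space_return)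
    show "sets (\<nu> i) = sets borel" for i by (simp add: \<nu>_def)
    show "(\<integral>\<^sup>+y. inverse (ennreal (cmod (a * y + b))) \<partial>\<nu> i) \<le> ennreal K * inverse (ennreal (cmod a))"
      if "i \<in> entry_indices n k" for i a b
      using anti[OF that] that Y_measurable[OF that] by (simp add: \<nu>_def I_def nn_integral_distr)
  qed (use assms in auto)
  finally show ?thesis .
qed

lemma nn_integral_inverse_random_det_le:
  assumes "coefficient_norm k c > 0"
  shows "(\<integral>\<^sup>+\<omega>. inverse (ennreal (cmod (random_det Y n k c \<omega>))) \<partial>\<Omega>) \<le>
    ennreal ((K * sqrt (real (k + 1)) / coefficient_norm k c) ^ n)"
proof -
  obtain j where j: "j \<le> k" "coefficient_norm k c \<le> sqrt (real (k + 1)) * cmod (c j)"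
    using coefficient_norm_le_Max by blast
  have "0 < sqrt (real (k + 1)) * cmod (c j)" using assms j(2) by linarith
  then have pos: "cmod (c j) > 0" by (simp add: zero_less_mult_iff)
  have "ennreal K * inverse (ennreal (cmod (c j))) = ennreal (K / cmod (c j))"
    using pos K by (simp add: inverse_ennreal ennreal_mult[symmetric] divide_inverse)
  also have "\<dots> \<le> ennreal (K * sqrt (real (k + 1)) / coefficient_norm k c)"
  proof (rule ennreal_leI)
    have "K * coefficient_norm k c \<le> K * (sqrt (real (k + 1)) * cmod (c j))"
      using K j(2) by (intro mult_left_mono) auto
    then show "K / cmod (c j) \<le> K * sqrt (real (k + 1)) / coefficient_norm k c"
      using pos assms by (simp add: field_simps)
  qed
  finally have "(ennreal K * inverse (ennreal (cmod (c j)))) ^ n \<le>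
      ennreal (K * sqrt (real (k + 1)) / coefficient_norm k c) ^ n"
    by (intro power_mono) auto
  also have "\<dots> = ennreal ((K * sqrt (real (k + 1)) / coefficient_norm k c) ^ n)"
    using K assms by (intro ennreal_power) auto
  finally show ?thesis using nn_integral_inverse_random_det_le_power[OF j(1), of c] by (rule order_trans[rotated])
qed

text \<open>A finite integral forces the integrand to be finite almost everywhere, and
  \<open>inverse 0\<close> is infinite.\<close>

lemma AE_random_det_nonzero:
  assumes "coefficient_norm k c > 0"
  shows "AE \<omega> in \<Omega>. random_det Y n k c \<omega> \<noteq> 0"
proof -
  have "(\<integral>\<^sup>+\<omega>. inverse (ennreal (cmod (random_det Y n k c \<omega>))) \<partial>\<Omega>) \<noteq> \<infinity>"
    using nn_integral_inverse_random_det_le[OF assms] by (auto simp: top_unique)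
  then have "AE \<omega> in \<Omega>. inverse (ennreal (cmod (random_det Y n k c \<omega>))) \<noteq> \<infinity>"
    by (intro nn_integral_PInf_AE) auto
  then show ?thesis by eventually_elim auto
qed

text \<open>The maximum of the entries is replaced by their sum, whose expectation follows from the
  first moments alone.\<close>

lemma cmod_random_det_le:
  "cmod (random_det Y n k c \<omega>) \<le> (real n * (coefficient_norm k c * (\<Sum>i\<in>entry_indices n k. cmod (Y i \<omega>)))) ^ n"
  unfolding random_det_def combination_det_def
proof (rule cmod_det_le)
  fix p assume p: "p \<in> {..<n} \<times> {..<n}"
  have "cmod (combination_entry k c (\<lambda>i. Y i \<omega>) p) \<le> (\<Sum>j\<le>k. cmod (c j * Y (j, p) \<omega>))"
    unfolding combination_entry_def by (rule norm_sum)
  also have "\<dots> \<le> (\<Sum>j\<le>k. coefficient_norm k c * cmod (Y (j, p) \<omega>))"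
    unfolding norm_mult by (intro sum_mono mult_right_mono coefficient_norm_ge) auto
  also have "\<dots> = coefficient_norm k c * (\<Sum>i\<in>(\<lambda>j. (j, p)) ` {..k}. cmod (Y i \<omega>))"
    by (subst sum.reindex) (auto simp: inj_on_def sum_distrib_left)
  also have "\<dots> \<le> coefficient_norm k c * (\<Sum>i\<in>entry_indices n k. cmod (Y i \<omega>))"
    using p by (intro mult_left_mono sum_mono2)
      (auto simp: entry_indices_def coefficient_norm_def sum_nonneg)
  finally show "cmod (combination_entry k c (\<lambda>i. Y i \<omega>) p) \<le>
    coefficient_norm k c * (\<Sum>i\<in>entry_indices n k. cmod (Y i \<omega>))" .
qed

theorem log_error_second_moment:
  assumes \<sigma>: "coefficient_norm k c > 0"
  shows "(\<integral>\<^sup>+\<omega>. ennreal ((log_error Y n k c \<omega>)\<^sup>2) \<partial>\<Omega>) \<le> ennreal (error_bound n k K)"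
proof -
  define I where "I = entry_indices n k"
  define \<sigma> where "\<sigma> = coefficient_norm k c"
  define b where "b = K * sqrt (real (k + 1))"
  define N where "N = real (k + 1) * (real n)\<^sup>2"
  have "1 \<le> real (k + 1) * (real n)\<^sup>2"
    using n by (simp add: mult_ge1_I)
  then have N: "N \<ge> 1" by (simp add: N_def)
  have b: "b \<ge> 1" unfolding b_def using K by (intro mult_ge1_I) auto
  have "\<sigma> > 0" using assms by (simp add: \<sigma>_def)
  have card: "real (card I) = N" by (simp add: I_def entry_indices_def N_def power2_eq_square algebra_simps)
  define q where "q = 2 * (ln (n * N))\<^sup>2 + 2 * (ln b)\<^sup>2"
  have q: "q \<ge> 0" by (simp add: q_def)
  have [measurable]: "i \<in> I \<Longrightarrow> Y i \<in> borel_measurable \<Omega>" for i using Y_measurable by (simp add: I_def)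
  have le: "ennreal ((log_error Y n k c \<omega>)\<^sup>2) \<le> ennreal q + (ennreal (2 / N) * (\<Sum>i\<in>I. ennreal (cmod (Y i \<omega>))) +
      ennreal (2 * (\<sigma> ^ n / b ^ n)) * inverse (ennreal (cmod (random_det Y n k c \<omega>))))" for \<omega>
  proof (cases "random_det Y n k c \<omega> = 0")
    \<comment> \<open>At a zero of the determinant the last summand on the right is infinite, so the
      convention \<open>ln 0 = 0\<close> on the left does no harm.\<close>
    case True
    then show ?thesis using \<open>\<sigma> > 0\<close> b by (simp add: ennreal_mult_top)
  next
    case False
    define d where "d = cmod (random_det Y n k c \<omega>)"
    define s where "s = (\<Sum>i\<in>I. cmod (Y i \<omega>))"
    have d: "d > 0" using False by (simp add: d_def)
    have s: "s \<ge> 0" by (simp add: s_def sum_nonneg)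
    have "(log_error Y n k c \<omega>)\<^sup>2 \<le> q + (2 * (s / N) + 2 * (\<sigma> ^ n / b ^ n * (1 / d)))"
      unfolding log_error_def q_def d_def[symmetric] \<sigma>_def[symmetric]
      using cmod_random_det_le[of c \<omega>] n d s \<open>\<sigma> > 0\<close> b N
      by (intro normalised_ln_square_le) (auto simp: d_def s_def \<sigma>_def I_def)
    then have "ennreal ((log_error Y n k c \<omega>)\<^sup>2) \<le> ennreal (q + (2 / N * s + 2 * (\<sigma> ^ n / b ^ n) * inverse d))"
      by (intro ennreal_leI) (simp add: divide_inverse mult_ac)
    also have "\<dots> = ennreal q + (ennreal (2 / N) * ennreal s + ennreal (2 * (\<sigma> ^ n / b ^ n)) * ennreal (inverse d))"
      using q N s \<open>\<sigma> > 0\<close> b d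
      by (subst ennreal_plus, simp, simp, subst ennreal_plus, simp, simp, subst (1 2) ennreal_mult) auto
    also have "ennreal s = (\<Sum>i\<in>I. ennreal (cmod (Y i \<omega>)))" by (simp add: s_def sum_ennreal)
    also have "ennreal (inverse d) = inverse (ennreal d)" using d by (rule inverse_ennreal[symmetric])
    finally show ?thesis by (simp add: d_def)
  qed
  have "(\<integral>\<^sup>+\<omega>. ennreal ((log_error Y n k c \<omega>)\<^sup>2) \<partial>\<Omega>) \<le>
    (\<integral>\<^sup>+\<omega>. ennreal q + (ennreal (2 / N) * (\<Sum>i\<in>I. ennreal (cmod (Y i \<omega>))) +
      ennreal (2 * (\<sigma> ^ n / b ^ n)) * inverse (ennreal (cmod (random_det Y n k c \<omega>)))) \<partial>\<Omega>)"
    by (intro nn_integral_mono le)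
  also have "\<dots> = ennreal q + (ennreal (2 / N) * (\<Sum>i\<in>I. \<integral>\<^sup>+\<omega>. ennreal (cmod (Y i \<omega>)) \<partial>\<Omega>) +
      ennreal (2 * (\<sigma> ^ n / b ^ n)) * (\<integral>\<^sup>+\<omega>. inverse (ennreal (cmod (random_det Y n k c \<omega>))) \<partial>\<Omega>))"
    by (subst nn_integral_add, simp, measurable, subst nn_integral_add, measurable,
        subst nn_integral_cmult, measurable, subst nn_integral_sum, measurable, subst nn_integral_cmult)
       (auto simp: emeasure_space_1)
  also have "\<dots> \<le> ennreal q + (ennreal (2 / N) * ennreal N +
      ennreal (2 * (\<sigma> ^ n / b ^ n)) * ennreal ((b / \<sigma>) ^ n))"
  proof (intro add_mono mult_left_mono order_refl)
    have "(\<Sum>i\<in>I. \<integral>\<^sup>+\<omega>. ennreal (cmod (Y i \<omega>)) \<partial>\<Omega>) \<le> (\<Sum>i\<in>I. 1)"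
      using moment by (intro sum_mono) (simp add: I_def)
    also have "\<dots> = ennreal N" by (simp add: card[symmetric] ennreal_of_nat_eq_real_of_nat)
    finally show "(\<Sum>i\<in>I. \<integral>\<^sup>+\<omega>. ennreal (cmod (Y i \<omega>)) \<partial>\<Omega>) \<le> ennreal N" .
    show "(\<integral>\<^sup>+\<omega>. inverse (ennreal (cmod (random_det Y n k c \<omega>))) \<partial>\<Omega>) \<le> ennreal ((b / \<sigma>) ^ n)"
      using nn_integral_inverse_random_det_le[OF assms] by (simp add: b_def \<sigma>_def)
  qed auto
  also have "\<dots> = ennreal (q + (2 / N * N + 2 * (\<sigma> ^ n / b ^ n) * (b / \<sigma>) ^ n))"
  proof -
    have "ennreal (2 / N) * ennreal N = ennreal (2 / N * N)"
      using N by (intro ennreal_mult[symmetric]) auto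
    moreover have "ennreal (2 * (\<sigma> ^ n / b ^ n)) * ennreal ((b / \<sigma>) ^ n) = ennreal (2 * (\<sigma> ^ n / b ^ n) * (b / \<sigma>) ^ n)"
      using \<open>\<sigma> > 0\<close> b by (intro ennreal_mult[symmetric]) auto
    moreover have "0 \<le> 2 / N * N" "0 \<le> 2 * (\<sigma> ^ n / b ^ n) * (b / \<sigma>) ^ n"
      using N \<open>\<sigma> > 0\<close> b by auto
    ultimately show ?thesis using q by (simp only: ennreal_plus[symmetric] add_nonneg_nonneg)
  qed
  also have "q + (2 / N * N + 2 * (\<sigma> ^ n / b ^ n) * (b / \<sigma>) ^ n) = error_bound n k K"
    unfolding error_bound_def q_def N_def[symmetric] b_def[symmetric]
    using N \<open>\<sigma> > 0\<close> b by (simp add: power_divide)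
  finally show ?thesis .
qed

end

section \<open>From matrices with i.i.d. entries to independent coefficients\<close>

text \<open>Independence is tested on finite families of Borel sets. The sets belonging to one j
  form a rectangle, which is an event for the whole matrix; independence of the matrices factors
  over j, and independence within each matrix factors the rectangle.\<close>

lemma (in prob_space) indep_entries:
  fixes C :: "nat \<Rightarrow> 'a \<Rightarrow> complex mat"
  assumes n: "n \<ge> 1"
    and rows: "indep_vars (\<lambda>_. PiM ({..<n} \<times> {..<n}) (\<lambda>_. borel)) (\<lambda>j \<omega>. \<lambda>i\<in>{..<n} \<times> {..<n}. C j \<omega> $$ i) {..k}"
    and entries: "\<And>j. j \<le> k \<Longrightarrow> indep_vars (\<lambda>_. borel) (\<lambda>i \<omega>. C j \<omega> $$ i) ({..<n} \<times> {..<n})"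
  shows "indep_vars (\<lambda>_. borel) (\<lambda>(j, i) \<omega>. C j \<omega> $$ i) (entry_indices n k)"
proof -
  define Q where "Q = {..<n} \<times> {..<n}"
  have Q: "Q \<noteq> {}" "finite Q" using n by (auto simp: Q_def lessThan_empty_iff)
  have I: "entry_indices n k = {..k} \<times> Q" by (simp add: entry_indices_def Q_def)
  have rv: "random_variable borel (\<lambda>\<omega>. C j \<omega> $$ i)" if "j \<le> k" "i \<in> Q" for i j
    using entries[OF that(1)] that(2) by (auto simp: indep_vars_def Q_def)
  have "indep_vars (\<lambda>_. borel) (\<lambda>p \<omega>. C (fst p) \<omega> $$ snd p) ({..k} \<times> Q)"
  proof (subst indep_vars_finite[where E = "\<lambda>_. sets borel"])
    show "{..k} \<times> Q \<noteq> {}" "finite ({..k} \<times> Q)" using Q by auto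
    show "Int_stable (sets borel)" by (rule sets.Int_stable)
    show "random_variable borel (\<lambda>\<omega>. C (fst p) \<omega> $$ snd p)" if "p \<in> {..k} \<times> Q" for p
      using that by (intro rv) auto
    show "\<forall>A\<in>{..k} \<times> Q \<rightarrow> sets borel.
      prob (\<Inter>p\<in>{..k} \<times> Q. (\<lambda>\<omega>. C (fst p) \<omega> $$ snd p) -` A p \<inter> space M) =
      (\<Prod>p\<in>{..k} \<times> Q. prob ((\<lambda>\<omega>. C (fst p) \<omega> $$ snd p) -` A p \<inter> space M))"
    proof
      fix A assume A: "A \<in> {..k} \<times> Q \<rightarrow> sets (borel :: complex measure)"
      define Z where "Z j \<omega> = (\<lambda>i\<in>Q. C j \<omega> $$ i)" for j \<omega>
      define B where "B j = PiE Q (\<lambda>i. A (j, i))" for j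
      have ZB: "Z j -` B j \<inter> space M = (\<Inter>i\<in>Q. (\<lambda>\<omega>. C j \<omega> $$ i) -` A (j, i) \<inter> space M)" for j
        using Q by (auto simp: Z_def B_def PiE_iff)
      have "(\<Inter>p\<in>{..k} \<times> Q. (\<lambda>\<omega>. C (fst p) \<omega> $$ snd p) -` A p \<inter> space M) = (\<Inter>j\<in>{..k}. Z j -` B j \<inter> space M)"
        unfolding ZB by auto
      also have "prob \<dots> = (\<Prod>j\<in>{..k}. prob (Z j -` B j \<inter> space M))"
      proof (rule indep_varsD_finite)
        show "indep_vars (\<lambda>_. PiM Q (\<lambda>_. borel)) Z {..k}"
          using rows by (simp add: Z_def[abs_def] Q_def)
        show "B j \<in> sets (PiM Q (\<lambda>_. borel))" if "j \<in> {..k}" for j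
          unfolding B_def using Q A that by (intro sets_PiM_I_finite) auto
      qed auto
      also have "\<dots> = (\<Prod>j\<in>{..k}. \<Prod>i\<in>Q. prob ((\<lambda>\<omega>. C j \<omega> $$ i) -` A (j, i) \<inter> space M))"
      proof (rule prod.cong)
        fix j assume j: "j \<in> {..k}"
        show "prob (Z j -` B j \<inter> space M) = (\<Prod>i\<in>Q. prob ((\<lambda>\<omega>. C j \<omega> $$ i) -` A (j, i) \<inter> space M))"
          unfolding ZB using entries[of j] j Q A
          by (intro indep_varsD_finite[where M' = "\<lambda>_. borel"]) (auto simp: Q_def)
      qed simp
      also have "\<dots> = (\<Prod>p\<in>{..k} \<times> Q. prob ((\<lambda>\<omega>. C (fst p) \<omega> $$ snd p) -` A p \<inter> space M))"
        by (simp add: prod.cartesian_product case_prod_unfold)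
      finally show "prob (\<Inter>p\<in>{..k} \<times> Q. (\<lambda>\<omega>. C (fst p) \<omega> $$ snd p) -` A p \<inter> space M) =
        (\<Prod>p\<in>{..k} \<times> Q. prob ((\<lambda>\<omega>. C (fst p) \<omega> $$ snd p) -` A p \<inter> space M))" .
    qed
  qed (auto simp: sets.sigma_sets_eq[of borel, simplified])
  then show ?thesis by (simp add: I case_prod_unfold)
qed

lemma random_coefficients_iid:
  fixes \<Omega> :: "'w measure" and X :: "nat \<Rightarrow> 'w \<Rightarrow> complex" and C :: "nat \<Rightarrow> 'w \<Rightarrow> complex mat"
  assumes "prob_space \<Omega>" and M: "M > 0" and n: "n \<ge> 1"
    and X_indep: "prob_space.indep_vars \<Omega> (\<lambda>_. borel) X {..k}"
    and X_variance: "\<And>j. j \<le> k \<Longrightarrow>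
        integrable \<Omega> (\<lambda>\<omega>. (cmod (X j \<omega>))\<^sup>2) \<and> (LINT \<omega>|\<Omega>. (cmod (X j \<omega>))\<^sup>2) = 1"
    and X_density: "\<And>j. j \<le> k \<Longrightarrow> bounded_density \<Omega> M (X j)"
    and C_iid: "\<And>j. j \<le> k \<Longrightarrow> iid_copies_matrix \<Omega> n (X j) (C j)"
    and C_indep: "indep_matrices \<Omega> n C {..k}"
  shows "random_coefficients \<Omega> (\<lambda>(j, i) \<omega>. C j \<omega> $$ i) n k (1 + M * disc_const)"
proof -
  interpret prob_space \<Omega> by fact
  have indep: "indep_vars (\<lambda>_. borel) (\<lambda>(j, i) \<omega>. C j \<omega> $$ i) (entry_indices n k)"
    using n C_indep C_iid by (intro indep_entries) (auto simp: indep_matrices_def iid_copies_matrix_def)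
  have X: "X j \<in> borel_measurable \<Omega>" if "j \<le> k" for j
    using X_indep that by (auto simp: indep_vars_def)
  have Y: "(\<lambda>\<omega>. C j \<omega> $$ i) \<in> borel_measurable \<Omega>" if "(j, i) \<in> entry_indices n k" for j i
    using indep that by (auto simp: indep_vars_def)
  have transfer: "(\<integral>\<^sup>+\<omega>. g (C j \<omega> $$ i) \<partial>\<Omega>) = (\<integral>\<^sup>+\<omega>. g (X j \<omega>) \<partial>\<Omega>)"
    if ji: "(j, i) \<in> entry_indices n k" and g[measurable]: "g \<in> borel_measurable borel" for j i and g :: "complex \<Rightarrow> ennreal"
  proof -
    have j: "j \<le> k" "i \<in> {..<n} \<times> {..<n}" using ji by (auto simp: entry_indices_def)
    have "(\<integral>\<^sup>+\<omega>. g (C j \<omega> $$ i) \<partial>\<Omega>) = (\<integral>\<^sup>+z. g z \<partial>distr \<Omega> borel (\<lambda>\<omega>. C j \<omega> $$ i))"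
      by (rule nn_integral_distr[symmetric, OF Y[OF ji]]) (simp add: g)
    also have "distr \<Omega> borel (\<lambda>\<omega>. C j \<omega> $$ i) = distr \<Omega> borel (X j)"
      using C_iid[OF j(1)] j(2) unfolding iid_copies_matrix_def by blast
    also have "(\<integral>\<^sup>+z. g z \<partial>distr \<Omega> borel (X j)) = (\<integral>\<^sup>+\<omega>. g (X j \<omega>) \<partial>\<Omega>)"
      by (rule nn_integral_distr[OF X[OF j(1)]]) (simp add: g)
    finally show ?thesis .
  qed
  show ?thesis
  proof unfold_locales
    show "1 \<le> 1 + M * disc_const" using M disc_const_nonneg by simp
    show "indep_vars (\<lambda>_. borel) (\<lambda>(j, i) \<omega>. C j \<omega> $$ i) (entry_indices n k)" by fact
  next
    fix p assume p: "p \<in> entry_indices n k"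
    obtain j i where ji: "p = (j, i)" by (cases p)
    have j: "j \<le> k" using p ji by (auto simp: entry_indices_def)
    have "(\<integral>\<^sup>+\<omega>. ennreal (cmod (C j \<omega> $$ i)) \<partial>\<Omega>) = (\<integral>\<^sup>+\<omega>. ennreal (cmod (X j \<omega>)) \<partial>\<Omega>)"
      using p ji by (intro transfer) auto
    \<comment> \<open>The first moment is at most 1/2 plus half the second moment, which is 1 for
      unit variance.\<close>
    also have "\<dots> \<le> (\<integral>\<^sup>+\<omega>. ennreal (1 / 2 + (cmod (X j \<omega>))\<^sup>2 / 2) \<partial>\<Omega>)"
    proof (intro nn_integral_mono ennreal_leI)
      fix \<omega>
      have "0 \<le> (cmod (X j \<omega>) - 1)\<^sup>2" by simp
      then show "cmod (X j \<omega>) \<le> 1 / 2 + (cmod (X j \<omega>))\<^sup>2 / 2" by (simp add: power2_diff field_simps)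
    qed
    also have "\<dots> = ennreal (LINT \<omega>|\<Omega>. 1 / 2 + (cmod (X j \<omega>))\<^sup>2 / 2)"
      using X_variance[OF j] by (intro nn_integral_eq_integral) auto
    also have "(LINT \<omega>|\<Omega>. 1 / 2 + (cmod (X j \<omega>))\<^sup>2 / 2) = 1"
      using X_variance[OF j] by (simp add: prob_space)
    finally show "(\<integral>\<^sup>+\<omega>. ennreal (cmod ((case p of (j, i) \<Rightarrow> \<lambda>\<omega>. C j \<omega> $$ i) \<omega>)) \<partial>\<Omega>) \<le> 1"
      by (simp add: ji)
  next
    fix p and a b :: complex
    assume p: "p \<in> entry_indices n k"
    obtain j i where ji: "p = (j, i)" by (cases p)
    have j: "j \<le> k" using p ji by (auto simp: entry_indices_def)
    obtain f where f: "distributed \<Omega> lborel (X j) f" "AE z in lborel. f z \<le> ennreal M"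
      using X_density[OF j] by (auto simp: bounded_density_def)
    have fm: "f \<in> borel_measurable borel" using f(1) by (auto simp: distributed_def)
    have law: "distr \<Omega> borel (X j) = density lborel f"
    proof -
      have "distr \<Omega> borel (X j) = distr \<Omega> lborel (X j)" by (rule distr_cong) auto
      then show ?thesis using f(1) by (simp add: distributed_def)
    qed
    have f1: "(\<integral>\<^sup>+z. f z \<partial>lborel) = 1"
    proof -
      have "(\<integral>\<^sup>+z. f z \<partial>lborel) = emeasure (density lborel f) UNIV"
        using fm by (subst emeasure_density) auto
      also have "\<dots> = 1"
        unfolding law[symmetric] using X[OF j] emeasure_space_1 by (simp add: emeasure_distr)
      finally show ?thesis .
    qed
    have "(\<integral>\<^sup>+\<omega>. inverse (ennreal (cmod (a * (C j \<omega> $$ i) + b))) \<partial>\<Omega>) =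
        (\<integral>\<^sup>+\<omega>. inverse (ennreal (cmod (a * X j \<omega> + b))) \<partial>\<Omega>)"
      using p ji by (intro transfer) auto
    also have "\<dots> = (\<integral>\<^sup>+z. inverse (ennreal (cmod (a * z + b))) \<partial>distr \<Omega> borel (X j))"
      by (rule nn_integral_distr[symmetric, OF X[OF j]]) auto
    also have "\<dots> \<le> ennreal (1 + M * disc_const) * inverse (ennreal (cmod a))"
      unfolding law using M by (intro nn_integral_inverse_affine_le fm f f1) auto
    finally show "(\<integral>\<^sup>+\<omega>. inverse (ennreal (cmod (a * (case p of (j, i) \<Rightarrow> \<lambda>\<omega>. C j \<omega> $$ i) \<omega> + b))) \<partial>\<Omega>) \<le>
        ennreal (1 + M * disc_const) * inverse (ennreal (cmod a))"
      by (simp add: ji)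
  qed (use n in auto)
qed

section \<open>Almost sure convergence and summability\<close>

text \<open>The series of the functions has finite integral, so it converges almost surely and its
  terms tend to 0. No independence between different indices enters.\<close>

lemma (in prob_space) AE_tendsto_0_if_suminf_finite:
  fixes f :: "nat \<Rightarrow> 'a \<Rightarrow> ennreal"
  assumes f[measurable]: "\<And>m. f m \<in> borel_measurable M"
    and fin: "(\<Sum>m. \<integral>\<^sup>+\<omega>. f m \<omega> \<partial>M) \<noteq> \<infinity>"
  shows "AE \<omega> in M. (\<lambda>m. f m \<omega>) \<longlonglongrightarrow> 0"
proof -
  have "(\<integral>\<^sup>+\<omega>. (\<Sum>m. f m \<omega>) \<partial>M) \<noteq> \<infinity>"
    using fin by (subst nn_integral_suminf) auto
  then have "AE \<omega> in M. (\<Sum>m. f m \<omega>) \<noteq> \<infinity>"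
    by (intro nn_integral_PInf_AE) auto
  then show ?thesis
  proof eventually_elim
    case (elim \<omega>)
    have le: "f m \<omega> \<le> (\<Sum>m. f m \<omega>)" for m
      using sum_le_suminf[of "\<lambda>m. f m \<omega>" "{m}"] by simp
    have eq: "f m \<omega> = ennreal (enn2real (f m \<omega>))" for m
      using le[of m] elim by (intro ennreal_enn2real[symmetric]) (metis infinity_ennreal_def le_less_trans less_top)
    have "(\<Sum>m. ennreal (enn2real (f m \<omega>))) \<noteq> \<infinity>"
      using elim by (simp only: eq[symmetric] not_False_eq_True)
    then have "summable (\<lambda>m. enn2real (f m \<omega>))"
      by (intro summable_suminf_not_top) auto
    then have "(\<lambda>m. ennreal (enn2real (f m \<omega>))) \<longlonglongrightarrow> ennreal 0"
      by (intro tendsto_ennrealI summable_LIMSEQ_zero)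
    then show ?case by (simp add: eq[symmetric])
  qed
qed

text \<open>Polynomial growth of n makes every logarithm in the bound O(1 + ln k), so the summands
  are O((ln k / k)^2).\<close>

lemma summable_error_bound:
  fixes n :: "nat \<Rightarrow> nat" and K P :: real
  assumes K: "K \<ge> 1" and P: "P > 0" and n_pos: "\<And>k. k \<ge> 1 \<Longrightarrow> n k \<ge> 1"
    and growth: "(\<lambda>k. real (n k)) \<in> O(\<lambda>k. real k powr P)"
  shows "summable (\<lambda>k. error_bound (n k) k K / (real k)\<^sup>2)"
proof -
  obtain c0 where c0: "eventually (\<lambda>k. norm (real (n k)) \<le> c0 * norm (real k powr P)) sequentially"
    using growth by (elim landau_o.bigE)
  define c where "c = max 1 c0"
  define A where "A = ln c"
  define B where "B = ln K"
  \<comment> \<open>Collects the coefficients of (1 + ln k)^2: the first logarithm is 3 ln n + ln (k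
    + 1) with ln n at most A + P ln k, the second is ln K plus half of ln (k + 1).\<close>
  define E where "E = 2 * (3 * A + 3 * P + 1)\<^sup>2 + 2 * (B + 1)\<^sup>2 + 4"
  have AB: "A \<ge> 0" "B \<ge> 0" using K by (auto simp: A_def B_def c_def)
  define g where "g k = E * (1 + ln (real k))\<^sup>2" for k
  \<comment> \<open>Any exponent strictly between -2 and -1 would do: it absorbs the squared
    logarithm and stays summable.\<close>
  have "(\<lambda>k. (1 + ln (real k))\<^sup>2 / (real k)\<^sup>2) \<in> O(\<lambda>k. real k powr (-3 / 2))"
    by real_asymp
  moreover have "summable (\<lambda>k. norm (real k powr (-3 / 2)))"
    by (simp add: summable_real_powr_iff)
  ultimately have "summable (\<lambda>k. (1 + ln (real k))\<^sup>2 / (real k)\<^sup>2)"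
    by (rule summable_comparison_test_bigo[rotated])
  then have "summable (\<lambda>k. g k / (real k)\<^sup>2)"
    unfolding g_def times_divide_eq_right[symmetric] by (rule summable_mult)
  moreover have "eventually (\<lambda>k. norm (error_bound (n k) k K / (real k)\<^sup>2) \<le> g k / (real k)\<^sup>2) sequentially"
    using c0 eventually_ge_at_top[of 1]
  proof eventually_elim
    case (elim k)
    have k: "real k \<ge> 1" "real (n k) \<ge> 1" using elim(2) n_pos by auto
    have "real (n k) \<le> c * real k powr P"
    proof -
      have "real (n k) \<le> c0 * real k powr P" using elim(1) by simp
      also have "\<dots> \<le> c * real k powr P" by (intro mult_right_mono) (auto simp: c_def)
      finally show ?thesis .
    qed
    then have "ln (real (n k)) \<le> ln (c * real k powr P)"
      using k by (subst ln_le_cancel_iff) (auto simp: c_def)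
    also have "\<dots> = A + P * ln (real k)"
      using k by (subst ln_mult_pos) (auto simp: c_def A_def ln_powr)
    finally have ln_n: "ln (real (n k)) \<le> A + P * ln (real k)" .
    have ln_N: "ln (real (n k) * (real (k + 1) * (real (n k))\<^sup>2)) = 3 * ln (real (n k)) + ln (real k + 1)"
      using k by (simp add: ln_mult_pos ln_realpow add.commute)
    have l0: "0 \<le> ln (real (n k))" "0 \<le> ln (real k + 1)" using k by auto
    have l1: "0 \<le> ln (real k)" "ln (real k + 1) \<le> 1 + ln (real k)"
    proof -
      have "ln (real k + 1) \<le> ln (2 * real k)" using k by (subst ln_le_cancel_iff) auto
      also have "\<dots> = ln 2 + ln (real k)" using k by (simp add: ln_mult_pos)
      finally show "ln (real k + 1) \<le> 1 + ln (real k)" using ln_2_less_1 by linarith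
    qed (use k in auto)
    have lA: "3 * (A + P * ln (real k)) + (1 + ln (real k)) \<le> (3 * A + 3 * P + 1) * (1 + ln (real k))"
      using AB P l1 by (simp add: algebra_simps)
    have "(ln (real (n k) * (real (k + 1) * (real (n k))\<^sup>2)))\<^sup>2 \<le> ((3 * A + 3 * P + 1) * (1 + ln (real k)))\<^sup>2"
      unfolding ln_N
    proof (rule power_mono)
      show "3 * ln (real (n k)) + ln (real k + 1) \<le> (3 * A + 3 * P + 1) * (1 + ln (real k))"
        by (rule order_trans[OF _ lA]) (use ln_n l1 in simp)
      show "0 \<le> 3 * ln (real (n k)) + ln (real k + 1)" using l0 by simp
    qed
    moreover have "(ln (K * sqrt (real (k + 1))))\<^sup>2 \<le> ((B + 1) * (1 + ln (real k)))\<^sup>2"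
    proof (rule power_mono)
      have *: "ln (K * sqrt (real (k + 1))) = B + ln (real k + 1) / 2"
        using K by (simp add: ln_mult_pos B_def ln_sqrt add.commute)
      have "(B + 1) * (1 + ln (real k)) = B + B * ln (real k) + 1 + ln (real k)"
        by (simp add: algebra_simps)
      moreover have "0 \<le> B * ln (real k)" using AB l1 by simp
      ultimately show "ln (K * sqrt (real (k + 1))) \<le> (B + 1) * (1 + ln (real k))"
        unfolding * using l1 by linarith
      show "0 \<le> ln (K * sqrt (real (k + 1)))" unfolding * using AB k by simp
    qed
    moreover have "4 \<le> 4 * (1 + ln (real k))\<^sup>2" using l1 by simp
    ultimately have "error_bound (n k) k K \<le> 2 * ((3 * A + 3 * P + 1) * (1 + ln (real k)))\<^sup>2 +
        2 * ((B + 1) * (1 + ln (real k)))\<^sup>2 + 4 * (1 + ln (real k))\<^sup>2"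
      unfolding error_bound_def by linarith
    also have "\<dots> = g k"
      unfolding g_def E_def power_mult_distrib by (simp only: distrib_right mult.assoc)
    finally have "error_bound (n k) k K \<le> g k" .
    moreover have "0 \<le> error_bound (n k) k K" by (simp add: error_bound_def)
    ultimately show ?case by (simp add: divide_right_mono)
  qed
  ultimately show ?thesis by (rule summable_comparison_test_ev[rotated])
qed

section \<open>Deterministic potentials and their pairing with test functions\<close>

lemma log_potential_sum_pos:
  assumes "\<alpha> k k \<noteq> 0" "z \<noteq> 0"
  shows "0 < (\<Sum>i\<le>k. (cmod (\<alpha> k i))\<^sup>2 / (cmod (\<alpha> k k))\<^sup>2 * cmod z ^ (2 * i))"
proof -
  have "0 < (cmod (\<alpha> k k))\<^sup>2 / (cmod (\<alpha> k k))\<^sup>2 * cmod z ^ (2 * k)"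
    using assms by simp
  also have "\<dots> \<le> (\<Sum>i\<le>k. (cmod (\<alpha> k i))\<^sup>2 / (cmod (\<alpha> k k))\<^sup>2 * cmod z ^ (2 * i))"
    by (intro member_le_sum[of k "{..k}" "\<lambda>i. (cmod (\<alpha> k i))\<^sup>2 / (cmod (\<alpha> k k))\<^sup>2 * cmod z ^ (2 * i)"]) auto
  finally show ?thesis .
qed

text \<open>Replacing w by z multiplies each term of the sum by at most e^(2kh), where h is the
  distance of the logarithms of the moduli, and the prefactor 1/(2k) returns exactly h. Thus a bound
  at one point yields bounds everywhere, uniformly in k.\<close>

lemma log_potential_le:
  assumes \<alpha>: "\<alpha> k k \<noteq> 0" and k: "k \<ge> 1" and z: "z \<noteq> 0" "w \<noteq> 0"
  shows "log_potential \<alpha> k z \<le> log_potential \<alpha> k w + \<bar>ln (cmod z) - ln (cmod w)\<bar>"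
proof -
  define a where "a i = (cmod (\<alpha> k i))\<^sup>2 / (cmod (\<alpha> k k))\<^sup>2" for i
  define h where "h = \<bar>ln (cmod z) - ln (cmod w)\<bar>"
  let ?S = "\<lambda>z. \<Sum>i\<le>k. a i * cmod z ^ (2 * i)"
  have pos: "0 < (?S z)" "0 < (?S w)"
    unfolding a_def using log_potential_sum_pos[where \<alpha> = \<alpha>, OF \<alpha>] z by auto
  have "(?S z) \<le> (\<Sum>i\<le>k. exp (2 * k * h) * (a i * cmod w ^ (2 * i)))"
  proof (rule sum_mono)
    fix i assume "i \<in> {..k}"
    have "cmod z = cmod w * exp (ln (cmod z) - ln (cmod w))" using z by (simp add: exp_diff)
    then have "cmod z ^ (2 * i) = cmod w ^ (2 * i) * exp (real (2 * i) * (ln (cmod z) - ln (cmod w)))"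
      by (metis exp_of_nat_mult power_mult_distrib)
    also have "\<dots> \<le> cmod w ^ (2 * i) * exp (2 * k * h)"
    proof -
      have "real (2 * i) * (ln (cmod z) - ln (cmod w)) \<le> real (2 * i) * h"
        by (intro mult_left_mono) (auto simp: h_def)
      also have "\<dots> \<le> 2 * k * h"
        using \<open>i \<in> {..k}\<close> by (intro mult_right_mono) (auto simp: h_def)
      finally show ?thesis by (intro mult_left_mono) auto
    qed
    finally have "a i * cmod z ^ (2 * i) \<le> a i * (cmod w ^ (2 * i) * exp (2 * k * h))"
      by (intro mult_left_mono) (auto simp: a_def)
    then show "a i * cmod z ^ (2 * i) \<le> exp (2 * k * h) * (a i * cmod w ^ (2 * i))"
      by (simp add: mult_ac)
  qed
  also have "\<dots> = exp (2 * k * h) * (?S w)"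
    by (simp add: sum_distrib_left)
  finally have "ln (?S z) \<le> ln (exp (2 * k * h) * (?S w))"
    using pos by (subst ln_le_cancel_iff) auto
  also have "\<dots> = 2 * k * h + ln (?S w)"
    using pos by (subst ln_mult_pos) auto
  finally have "1 / (2 * real k) * ln (?S z) \<le>
      1 / (2 * real k) * (2 * k * h + ln (?S w))"
    by (intro mult_left_mono) auto
  also have "\<dots> = h + 1 / (2 * real k) * ln (?S w)"
    using k by (simp add: distrib_left)
  finally show ?thesis by (simp add: log_potential_def a_def h_def)
qed

lemma log_potential_measurable [measurable]: "log_potential \<alpha> k \<in> borel_measurable borel"
  unfolding log_potential_def[abs_def] by measurable

lemma integrable_log_bound:
  "integrable lborel (\<lambda>z::complex. B * (indicator (cball 0 R) z * c + \<bar>indicator (cball 0 R) z * ln (cmod z)\<bar>))"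
proof -
  have "integrable lborel (\<lambda>z::complex. indicator (cball 0 R) z *\<^sub>R c)"
    by (rule borel_integrable_compact) auto
  moreover have "integrable lborel (\<lambda>z::complex. indicator (cball 0 R) z * ln (cmod (z - 0)))"
    by (rule integrable_ln_cball)
  ultimately show ?thesis
    by (intro integrable_mult_right Bochner_Integration.integrable_add integrable_abs) simp_all
qed

text \<open>Packages the dominating function with the constant c as a parameter, so that one F
  serves both integrability for fixed k and dominated convergence in k.\<close>

lemma log_bound_test_function:
  assumes \<psi>: "\<psi> \<in> test_functions"
  obtains F where "\<And>c. integrable lborel (F c)"
    "\<And>c z (t :: real). \<bar>t\<bar> \<le> c + \<bar>ln (cmod z)\<bar> \<Longrightarrow> cmod (complex_of_real t * \<psi> z) \<le> F c z"
proof -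
  obtain R where R: "\<forall>z. R \<le> cmod z \<longrightarrow> \<psi> z = 0" using test_functions_vanish[OF \<psi>] by auto
  obtain B where B: "B > 0" "\<And>z. cmod (\<psi> z) \<le> B" using test_functions_bounded[OF \<psi>] by blast
  define F where "F c z = B * (indicator (cball 0 R) z * c + \<bar>indicator (cball 0 R) z * ln (cmod z)\<bar>)" for c z
  have "cmod (complex_of_real t * \<psi> z) \<le> F c z" if "\<bar>t\<bar> \<le> c + \<bar>ln (cmod z)\<bar>" for c z t
  proof (cases "cmod z \<le> R")
    case True
    have "cmod (complex_of_real t * \<psi> z) \<le> (c + \<bar>ln (cmod z)\<bar>) * B"
      unfolding norm_mult norm_of_real using that B(2)[of z] by (intro mult_mono) auto
    then show ?thesis using True by (simp add: F_def mult.commute)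
  next
    case False
    then show ?thesis using R by (simp add: F_def)
  qed
  moreover have "integrable lborel (F c)" for c
    unfolding F_def by (rule integrable_log_bound)
  ultimately show thesis by (rule that[rotated])
qed

lemma test_functions_measurable: "\<psi> \<in> test_functions \<Longrightarrow> \<psi> \<in> borel_measurable borel"
  by (intro borel_measurable_continuous_onI test_functions_continuous)

lemma integrable_log_potential:
  assumes \<alpha>: "\<alpha> k k \<noteq> 0" and k: "k \<ge> 1" and \<psi>: "\<psi> \<in> test_functions"
  shows "integrable lborel (\<lambda>z. complex_of_real (log_potential \<alpha> k z) * \<psi> z)"
proof -
  obtain F where F: "\<And>c. integrable lborel (F c)"
    "\<And>c z (t :: real). \<bar>t\<bar> \<le> c + \<bar>ln (cmod z)\<bar> \<Longrightarrow> cmod (complex_of_real t * \<psi> z) \<le> F c z"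
    using log_bound_test_function[OF \<psi>] by metis
  have [measurable]: "\<psi> \<in> borel_measurable borel" using \<psi> by (rule test_functions_measurable)
  show ?thesis
  proof (rule Bochner_Integration.integrable_bound[OF F(1)[of "\<bar>log_potential \<alpha> k 1\<bar>"]])
    have "AE z in lborel. z \<noteq> (0::complex)" by (rule AE_lborel_singleton)
    then show "AE z in lborel. norm (complex_of_real (log_potential \<alpha> k z) * \<psi> z) \<le> norm (F \<bar>log_potential \<alpha> k 1\<bar> z)"
    proof eventually_elim
      case (elim z)
      have "\<bar>log_potential \<alpha> k z\<bar> \<le> \<bar>log_potential \<alpha> k 1\<bar> + \<bar>ln (cmod z)\<bar>"
        using log_potential_le[where \<alpha> = \<alpha>, OF \<alpha> k elim, of 1] log_potential_le[where \<alpha> = \<alpha>, OF \<alpha> k _ elim, of 1] by simp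
      from F(2)[OF this] show ?case by simp
    qed
  qed measurable
qed

lemma function_distribution_log_potential_tendsto:
  assumes \<alpha>: "\<And>k. k \<ge> 1 \<Longrightarrow> \<alpha> k k \<noteq> 0" and \<psi>: "\<psi> \<in> test_functions"
    and U: "limit_as_L1loc_function (log_potential \<alpha>) U \<or> limit_as_distribution (log_potential \<alpha>) U"
  shows "(\<lambda>k. function_distribution (log_potential \<alpha> k) \<psi>) \<longlonglongrightarrow> U \<psi>"
proof (cases "limit_as_distribution (log_potential \<alpha>) U")
  case True
  with \<psi> show ?thesis by (simp add: limit_as_distribution_def)
next
  case False
  then obtain g where g: "locally_integrable g" "AE z in lborel. (\<lambda>k. log_potential \<alpha> k z) \<longlonglongrightarrow> g z"
      "U \<psi> = function_distribution g \<psi>"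
    using U \<psi> unfolding limit_as_L1loc_function_def by blast
  have ne: "AE z in lborel. z \<noteq> (0::complex)" by (rule AE_lborel_singleton)
  \<comment> \<open>A single point of convergence bounds the potentials there for all k; the
    Lipschitz estimate spreads this to a common dominating function.\<close>
  have "\<exists>w. w \<noteq> 0 \<and> (\<lambda>k. log_potential \<alpha> k w) \<longlonglongrightarrow> g w"
  proof -
    have "ae_filter (lborel :: complex measure) \<noteq> bot"
      by (simp add: ae_filter_eq_bot_iff)
    moreover have "AE w in lborel. w \<noteq> 0 \<and> (\<lambda>k. log_potential \<alpha> k w) \<longlonglongrightarrow> g w"
      using ne g(2) by eventually_elim auto
    ultimately show ?thesis by (rule eventually_happens')
  qed
  then obtain w where w: "w \<noteq> 0" "(\<lambda>k. log_potential \<alpha> k w) \<longlonglongrightarrow> g w" by blast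
  obtain c where c: "\<And>k. \<bar>log_potential \<alpha> k w\<bar> \<le> c"
    using convergent_imp_Bseq[OF convergentI[OF w(2)]] by (auto simp: Bseq_def)
  obtain F where F: "\<And>c. integrable lborel (F c)"
    "\<And>c z (t :: real). \<bar>t\<bar> \<le> c + \<bar>ln (cmod z)\<bar> \<Longrightarrow> cmod (complex_of_real t * \<psi> z) \<le> F c z"
    using log_bound_test_function[OF \<psi>] by metis
  have [measurable]: "\<psi> \<in> borel_measurable borel" using \<psi> by (rule test_functions_measurable)
  \<comment> \<open>Shifted by one, since the leading coefficient is known to be nonzero only for
    positive k.\<close>
  define v where "v k z = complex_of_real (log_potential \<alpha> (Suc k) z) * \<psi> z" for k z
  \<comment> \<open>Only restrictions of g to compact sets are known to be measurable; the cutoff is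
    invisible after multiplication by \<open>\<psi>\<close>.\<close>
  have g_meas: "(\<lambda>z. complex_of_real (g z) * \<psi> z) \<in> borel_measurable lborel"
  proof -
    obtain R where R: "\<forall>z. R \<le> cmod z \<longrightarrow> \<psi> z = 0" using test_functions_vanish[OF \<psi>] by auto
    have "integrable lborel (\<lambda>z. indicator (cball 0 R) z *\<^sub>R g z)"
      using g(1)[unfolded locally_integrable_def set_integrable_def, rule_format, OF compact_cball] .
    then have "(\<lambda>z. indicator (cball 0 R) z *\<^sub>R g z) \<in> borel_measurable lborel"
      by (rule borel_measurable_integrable)
    then have "(\<lambda>z. complex_of_real (indicator (cball 0 R) z *\<^sub>R g z) * \<psi> z) \<in> borel_measurable lborel"
      by measurable
    also have "(\<lambda>z. complex_of_real (indicator (cball 0 R) z *\<^sub>R g z) * \<psi> z) = (\<lambda>z. complex_of_real (g z) * \<psi> z)"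
      using R by (auto simp: fun_eq_iff indicator_def)
    finally show ?thesis .
  qed
  have "(\<lambda>k. LINT z|lborel. v k z) \<longlonglongrightarrow> (LINT z|lborel. complex_of_real (g z) * \<psi> z)"
  proof (rule integral_dominated_convergence[where w = "F (c + \<bar>ln (cmod w)\<bar>)"])
    show "integrable lborel (F (c + \<bar>ln (cmod w)\<bar>))" by (rule F)
    show "AE z in lborel. (\<lambda>k. v k z) \<longlonglongrightarrow> complex_of_real (g z) * \<psi> z"
      using g(2)
    proof eventually_elim
      case (elim z)
      from LIMSEQ_Suc[OF elim] show ?case unfolding v_def by (intro tendsto_intros)
    qed
    fix k
    show "AE z in lborel. norm (v k z) \<le> F (c + \<bar>ln (cmod w)\<bar>) z"
      using ne
    proof eventually_elim
      case (elim z)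
      have "\<bar>log_potential \<alpha> (Suc k) z\<bar> \<le> c + \<bar>ln (cmod w)\<bar> + \<bar>ln (cmod z)\<bar>"
        using log_potential_le[where \<alpha> = \<alpha>, OF \<alpha>[of "Suc k"] _ elim w(1)] log_potential_le[where \<alpha> = \<alpha>, OF \<alpha>[of "Suc k"] _ w(1) elim] c[of "Suc k"]
        by simp
      then show ?case unfolding v_def by (rule F(2))
    qed
  qed (use g_meas in \<open>auto simp: v_def[abs_def]\<close>)
  then show ?thesis
    unfolding g(3) function_distribution_def v_def by (rule LIMSEQ_imp_Suc)
qed

text \<open>In place of Cauchy-Schwarz, |s| is at most \<open>\<delta>\<close> + s^2 /
  \<open>\<delta>\<close>. The integral is then bounded by a multiple of \<open>\<delta>\<close>
  plus a multiple of the mean square, which tends to 0 for each fixed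
  \<open>\<delta>\<close>.\<close>

lemma integral_tendsto_0_if_square:
  fixes t :: "nat \<Rightarrow> complex \<Rightarrow> real"
  assumes \<psi>: "\<psi> \<in> test_functions" and R: "\<And>z. R \<le> cmod z \<Longrightarrow> \<psi> z = 0"
    and t[measurable]: "\<And>k. t k \<in> borel_measurable borel"
    and int: "\<And>k. integrable lborel (\<lambda>z. complex_of_real (t k z) * \<psi> z)"
    and lim: "(\<lambda>k. \<integral>\<^sup>+z. indicator (cball 0 R) z * ennreal ((t k z)\<^sup>2) \<partial>lborel) \<longlonglongrightarrow> 0"
  shows "(\<lambda>k. LINT z|lborel. complex_of_real (t k z) * \<psi> z) \<longlonglongrightarrow> 0"
proof -
  let ?I = "\<lambda>k. LINT z|lborel. complex_of_real (t k z) * \<psi> z"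
  obtain B where B: "B > 0" "\<And>z. cmod (\<psi> z) \<le> B" using test_functions_bounded[OF \<psi>] by blast
  define T where "T k = (\<integral>\<^sup>+z. indicator (cball 0 R) z * ennreal ((t k z)\<^sup>2) \<partial>lborel)" for k
  define v where "v = measure lborel (cball 0 R :: complex set)"
  have v: "emeasure lborel (cball 0 R :: complex set) = ennreal v"
    unfolding v_def using emeasure_bounded_finite[of "cball 0 R :: complex set"]
    by (intro emeasure_eq_ennreal_measure) auto
  have "v \<ge> 0" by (simp add: v_def)
  have [measurable]: "cball 0 R \<in> sets (borel :: complex measure)" by simp
  have bound: "ennreal (cmod (?I k)) \<le>
      ennreal (B * \<delta> * v) + ennreal (B / \<delta>) * T k" if "\<delta> > 0" for k \<delta>
  proof -
    have "ennreal (cmod (?I k)) \<le>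
        (\<integral>\<^sup>+z. norm (complex_of_real (t k z) * \<psi> z) \<partial>lborel)"
      by (rule integral_norm_bound_ennreal[OF int])
    also have "\<dots> \<le> (\<integral>\<^sup>+z. ennreal (B * \<delta>) * indicator (cball 0 R) z +
        ennreal (B / \<delta>) * (indicator (cball 0 R) z * ennreal ((t k z)\<^sup>2)) \<partial>lborel)"
    proof (rule nn_integral_mono)
      fix z :: complex
      have *: "\<bar>s\<bar> \<le> \<delta> + s\<^sup>2 / \<delta>" for s :: real
      proof -
        have "0 \<le> (\<bar>s\<bar> - \<delta>)\<^sup>2" by simp
        then have "2 * (\<bar>s\<bar> * \<delta>) \<le> \<delta> * \<delta> + s\<^sup>2"
          by (simp add: power2_diff power2_eq_square[of \<delta>])
        moreover have "0 \<le> \<bar>s\<bar> * \<delta>" using \<open>\<delta> > 0\<close> by simp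
        ultimately have "\<bar>s\<bar> * \<delta> \<le> \<delta> * \<delta> + s\<^sup>2" by linarith
        then show ?thesis using \<open>\<delta> > 0\<close> by (simp add: field_simps)
      qed
      show "ennreal (norm (complex_of_real (t k z) * \<psi> z)) \<le> ennreal (B * \<delta>) * indicator (cball 0 R) z +
        ennreal (B / \<delta>) * (indicator (cball 0 R) z * ennreal ((t k z)\<^sup>2))"
      proof (cases "z \<in> cball 0 R")
        case True
        have "norm (complex_of_real (t k z) * \<psi> z) \<le> (\<delta> + (t k z)\<^sup>2 / \<delta>) * B"
          unfolding norm_mult norm_of_real using *[of "t k z"] B \<open>\<delta> > 0\<close> by (intro mult_mono) auto
        also have "\<dots> = B * \<delta> + B / \<delta> * (t k z)\<^sup>2" by (simp add: algebra_simps)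
        finally have "ennreal (norm (complex_of_real (t k z) * \<psi> z)) \<le> ennreal (B * \<delta> + B / \<delta> * (t k z)\<^sup>2)"
          by (rule ennreal_leI)
        also have "\<dots> = ennreal (B * \<delta>) + ennreal (B / \<delta>) * ennreal ((t k z)\<^sup>2)"
        proof -
          have "ennreal (B / \<delta> * (t k z)\<^sup>2) = ennreal (B / \<delta>) * ennreal ((t k z)\<^sup>2)"
            using B \<open>\<delta> > 0\<close> by (intro ennreal_mult) auto
          moreover have "ennreal (B * \<delta> + B / \<delta> * (t k z)\<^sup>2) = ennreal (B * \<delta>) + ennreal (B / \<delta> * (t k z)\<^sup>2)"
            using B \<open>\<delta> > 0\<close> by (intro ennreal_plus) auto
          ultimately show ?thesis by simp
        qed
        finally show ?thesis using True by simp
      next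
        case False
        then show ?thesis using R[of z] by simp
      qed
    qed
    also have "\<dots> = ennreal (B * \<delta>) * ennreal v + ennreal (B / \<delta>) * T k"
      unfolding T_def by (subst nn_integral_add, measurable, subst nn_integral_cmult, measurable,
          subst nn_integral_cmult) (auto simp: v)
    also have "ennreal (B * \<delta>) * ennreal v = ennreal (B * \<delta> * v)"
      using B \<open>\<delta> > 0\<close> \<open>v \<ge> 0\<close> by (intro ennreal_mult[symmetric]) auto
    finally show ?thesis .
  qed
  have T: "T \<longlonglongrightarrow> 0" using lim by (simp add: T_def[abs_def])
  show ?thesis
  proof (rule tendstoI)
    fix e :: real assume "e > 0"
    \<comment> \<open>Makes the part independent of k at most e/2. Dividing by v + 1 keeps the
      choice valid when the disc has area 0.\<close>
    define \<delta> where "\<delta> = e / (2 * B * (v + 1))"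
    have \<delta>: "\<delta> > 0" using \<open>e > 0\<close> B \<open>v \<ge> 0\<close> by (simp add: \<delta>_def)
    have "b * (e / (2 * b * s)) * s = e / 2" if "b > 0" "s > 0" for b s using that by simp
    from this[of B "v + 1"] have "B * \<delta> * (v + 1) = e / 2" using B \<open>v \<ge> 0\<close> by (simp add: \<delta>_def)
    moreover have "B * \<delta> * v \<le> B * \<delta> * (v + 1)" using B \<delta> by (intro mult_left_mono) auto
    ultimately have "B * \<delta> * v < e" using \<open>e > 0\<close> by linarith
    have "(\<lambda>k. ennreal (B * \<delta> * v) + ennreal (B / \<delta>) * T k) \<longlonglongrightarrow> ennreal (B * \<delta> * v) + ennreal (B / \<delta>) * 0"
      by (intro tendsto_add tendsto_const ennreal_tendsto_cmult T) auto
    then have "eventually (\<lambda>k. ennreal (B * \<delta> * v) + ennreal (B / \<delta>) * T k < ennreal e) sequentially"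
      using \<open>B * \<delta> * v < e\<close> \<open>e > 0\<close> B \<delta> \<open>v \<ge> 0\<close> by (intro order_tendstoD(2)) (auto intro: ennreal_lessI)
    then show "eventually (\<lambda>k. dist (?I k) 0 < e) sequentially"
    proof eventually_elim
      case (elim k)
      then have "ennreal (cmod (?I k)) < ennreal e"
        using bound[OF \<delta>] by (rule le_less_trans[rotated])
      then show ?case by (simp add: ennreal_less_iff)
    qed
  qed
qed

section \<open>Convergence of the empirical spectral distributions\<close>

abbreviation entry_family :: "(nat \<Rightarrow> 'w \<Rightarrow> complex mat) \<Rightarrow> nat \<times> nat \<times> nat \<Rightarrow> 'w \<Rightarrow> complex" where
  "entry_family C \<equiv> (\<lambda>(j, i) \<omega>. C j \<omega> $$ i)"

text \<open>With these coefficients the random determinant is that of the leading matrix, so its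
  logarithm falls under the same moment bounds.\<close>

abbreviation leading_unit :: "nat \<Rightarrow> nat \<Rightarrow> complex" where
  "leading_unit k \<equiv> (\<lambda>j. if j = k then 1 else 0)"

lemma poly_det_eq_random_det:
  assumes "\<And>j. j \<le> k \<Longrightarrow> C j \<omega> \<in> carrier_mat n n"
  shows "poly (Determinant.det (matrix_polynomial n k (\<lambda>j. \<alpha> j \<cdot>\<^sub>m C j \<omega>))) z =
    random_det (entry_family C) n k (\<lambda>j. \<alpha> j * z ^ j) \<omega>"
  unfolding poly_det_matrix_polynomial random_det_def combination_det_def
proof (intro arg_cong[where f = Determinant.det] eq_matI)
  fix a b
  assume "a < dim_row (Matrix.mat n n (combination_entry k (\<lambda>j. \<alpha> j * z ^ j) (\<lambda>i. entry_family C i \<omega>)))"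
    "b < dim_col (Matrix.mat n n (combination_entry k (\<lambda>j. \<alpha> j * z ^ j) (\<lambda>i. entry_family C i \<omega>)))"
  then have ab: "a < n" "b < n" by auto
  have "(\<alpha> j \<cdot>\<^sub>m C j \<omega>) $$ (a, b) * z ^ j = \<alpha> j * z ^ j * (C j \<omega> $$ (a, b))" if "j \<le> k" for j
    using assms[OF that] ab by (auto simp: mult_ac)
  then have "(\<Sum>j\<le>k. (\<alpha> j \<cdot>\<^sub>m C j \<omega>) $$ (a, b) * z ^ j) = (\<Sum>j\<le>k. \<alpha> j * z ^ j * (C j \<omega> $$ (a, b)))"
    by (intro sum.cong) auto
  with ab show "Matrix.mat n n (\<lambda>(a, b). \<Sum>j\<le>k. (\<alpha> j \<cdot>\<^sub>m C j \<omega>) $$ (a, b) * z ^ j) $$ (a, b) =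
      Matrix.mat n n (combination_entry k (\<lambda>j. \<alpha> j * z ^ j) (\<lambda>i. entry_family C i \<omega>)) $$ (a, b)"
    by (simp add: combination_entry_def)
qed auto

lemma det_leading_coefficient:
  assumes "C k \<omega> \<in> carrier_mat n n"
  shows "Determinant.det (a \<cdot>\<^sub>m C k \<omega>) = a ^ n * random_det (entry_family C) n k (leading_unit k) \<omega>"
proof -
  have "(\<Sum>j\<le>k. (if j = k then 1 else 0) * (C j \<omega> $$ p)) = C k \<omega> $$ p" for p
    by (subst sum.mono_neutral_right[of "{..k}" "{k}"]) auto
  then have "C k \<omega> = Matrix.mat n n (combination_entry k (leading_unit k) (\<lambda>i. entry_family C i \<omega>))"
    using assms by (intro eq_matI) (auto simp: combination_entry_def)
  then have "Determinant.det (C k \<omega>) = random_det (entry_family C) n k (leading_unit k) \<omega>"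
    by (simp add: random_det_def combination_det_def)
  with assms show ?thesis by simp
qed

lemma coefficient_norm_pos: "c k \<noteq> 0 \<Longrightarrow> 0 < coefficient_norm k c"
  using coefficient_norm_ge[of k k c] by (metis le_refl less_le_trans zero_less_norm_iff)

lemma coefficient_norm_leading_unit: "coefficient_norm k (leading_unit k) = 1"
proof -
  have "(\<Sum>j\<le>k. (cmod (if j = k then 1 else 0))\<^sup>2) = 1"
    by (subst sum.mono_neutral_right[of "{..k}" "{k}"]) auto
  then show ?thesis by (simp add: coefficient_norm_def)
qed

text \<open>Rewrites the hypothesis on U in the normalisation used by \<open>log_error\<close>, so
  that the two can be subtracted.\<close>

lemma log_potential_eq_coefficient_norm:
  assumes \<alpha>: "\<alpha> k k \<noteq> 0" and z: "z \<noteq> 0"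
  shows "log_potential \<alpha> k z =
    (ln (coefficient_norm k (\<lambda>j. \<alpha> k j * z ^ j)) - ln (cmod (\<alpha> k k))) / k"
proof -
  define S where "S = (\<Sum>i\<le>k. (cmod (\<alpha> k i * z ^ i))\<^sup>2)"
  have "coefficient_norm k (\<lambda>j. \<alpha> k j * z ^ j) > 0"
    using \<alpha> z by (intro coefficient_norm_pos) simp
  then have S: "S > 0" by (simp add: S_def coefficient_norm_def)
  have "(\<Sum>i\<le>k. (cmod (\<alpha> k i))\<^sup>2 / (cmod (\<alpha> k k))\<^sup>2 * cmod z ^ (2 * i)) = S / (cmod (\<alpha> k k))\<^sup>2"
    unfolding S_def sum_divide_distrib
    by (intro sum.cong refl) (simp add: norm_mult norm_power power_mult_distrib power_even_eq)
  moreover have "ln (S / (cmod (\<alpha> k k))\<^sup>2) = 2 * (ln (sqrt S) - ln (cmod (\<alpha> k k)))"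
    using S \<alpha> by (simp add: ln_div ln_sqrt ln_realpow)
  ultimately have "log_potential \<alpha> k z = 1 / (2 * real k) * (2 * (ln (sqrt S) - ln (cmod (\<alpha> k k))))"
    by (simp only: log_potential_def)
  also have "\<dots> = (ln (sqrt S) - ln (cmod (\<alpha> k k))) / k" by (simp add: diff_divide_distrib)
  finally show ?thesis by (simp only: coefficient_norm_def S_def)
qed

text \<open>Joint measurability in sample and point is what the exchange of expectation and area
  integral requires.\<close>

lemma measurable_log_error:
  assumes Y: "\<And>i. i \<in> entry_indices n k \<Longrightarrow> Y i \<in> borel_measurable \<Omega>"
  shows "(\<lambda>p. log_error Y n k (\<lambda>j. \<alpha> j * snd p ^ j) (fst p)) \<in> borel_measurable (\<Omega> \<Otimes>\<^sub>M lborel)"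
proof -
  have "(\<lambda>p. random_det Y n k (\<lambda>j. \<alpha> j * snd p ^ j) (fst p)) \<in> borel_measurable (\<Omega> \<Otimes>\<^sub>M lborel)"
    unfolding random_det_def
  proof (rule measurable_combination_det)
    fix j q assume "j \<le> k" "q \<in> {..<n} \<times> {..<n}"
    then have [measurable]: "Y (j, q) \<in> borel_measurable \<Omega>"
      by (intro Y) (simp add: entry_indices_def)
    have [measurable]: "snd \<in> borel_measurable (\<Omega> \<Otimes>\<^sub>M (lborel :: complex measure))"
      by (rule measurable_compose[OF measurable_snd]) simp
    show "(\<lambda>p. \<alpha> j * snd p ^ j * Y (j, q) (fst p)) \<in> borel_measurable (\<Omega> \<Otimes>\<^sub>M lborel)"
      by measurable
  qed
  moreover have "(\<lambda>p. coefficient_norm k (\<lambda>j. \<alpha> j * snd p ^ j)) \<in> borel_measurable (\<Omega> \<Otimes>\<^sub>M lborel)"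
  proof -
    have [measurable]: "snd \<in> borel_measurable (\<Omega> \<Otimes>\<^sub>M (lborel :: complex measure))"
      by (rule measurable_compose[OF measurable_snd]) simp
    show ?thesis unfolding coefficient_norm_def by measurable
  qed
  ultimately show ?thesis unfolding log_error_def by measurable
qed

lemma (in random_coefficients) log_error_measurable [measurable]:
  "log_error Y n k c \<in> borel_measurable \<Omega>"
  unfolding log_error_def[abs_def] by measurable

lemma (in random_coefficients) scaled_log_error_second_moment:
  assumes "coefficient_norm k c > 0"
  shows "(\<integral>\<^sup>+\<omega>. ennreal ((log_error Y n k c \<omega> / k)\<^sup>2) \<partial>\<Omega>) \<le>
    ennreal (error_bound n k K / (real k)\<^sup>2)"
proof -
  have "(\<integral>\<^sup>+\<omega>. ennreal ((log_error Y n k c \<omega> / k)\<^sup>2) \<partial>\<Omega>) =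
      (\<integral>\<^sup>+\<omega>. ennreal (1 / (real k)\<^sup>2) * ennreal ((log_error Y n k c \<omega>)\<^sup>2) \<partial>\<Omega>)"
    by (intro nn_integral_cong) (simp add: ennreal_mult[symmetric] power_divide)
  also have "\<dots> = ennreal (1 / (real k)\<^sup>2) * (\<integral>\<^sup>+\<omega>. ennreal ((log_error Y n k c \<omega>)\<^sup>2) \<partial>\<Omega>)"
    by (rule nn_integral_cmult) measurable
  also have "\<dots> \<le> ennreal (1 / (real k)\<^sup>2) * ennreal (error_bound n k K)"
    by (intro mult_left_mono log_error_second_moment assms) auto
  also have "\<dots> = ennreal (error_bound n k K / (real k)\<^sup>2)"
    by (subst ennreal_mult[symmetric]) (auto simp: error_bound_def)
  finally show ?thesis .
qed

text \<open>The moment bound is uniform in z, so after exchanging the integrals the disc contributes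
  only its area.\<close>

lemma (in random_coefficients)
  fixes \<alpha> :: "nat \<Rightarrow> complex" and R :: real
  defines "f \<equiv> \<lambda>\<omega> z. indicator (cball 0 R) z * ennreal ((log_error Y n k (\<lambda>j. \<alpha> j * z ^ j) \<omega> / k)\<^sup>2)"
  assumes \<alpha>: "\<alpha> k \<noteq> 0"
  shows log_error_disc_moment: "(\<integral>\<^sup>+\<omega>. \<integral>\<^sup>+z. f \<omega> z \<partial>lborel \<partial>\<Omega>) \<le>
      emeasure lborel (cball 0 R :: complex set) * ennreal (error_bound n k K / (real k)\<^sup>2)"
    and measurable_log_error_disc: "(\<lambda>\<omega>. \<integral>\<^sup>+z. f \<omega> z \<partial>lborel) \<in> borel_measurable \<Omega>"
proof -
  interpret pair_sigma_finite \<Omega> "lborel :: complex measure" ..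
  note [measurable] = measurable_log_error[of n k Y \<Omega> \<alpha>, OF Y_measurable]
  have [measurable]: "cball 0 R \<in> sets (borel :: complex measure)" by simp
  have [measurable]: "snd \<in> borel_measurable (\<Omega> \<Otimes>\<^sub>M (lborel :: complex measure))"
    by (rule measurable_compose[OF measurable_snd]) simp
  have meas: "(\<lambda>(\<omega>, z). f \<omega> z) \<in> borel_measurable (\<Omega> \<Otimes>\<^sub>M (lborel :: complex measure))"
    unfolding case_prod_unfold f_def by measurable
  show "(\<lambda>\<omega>. \<integral>\<^sup>+z. f \<omega> z \<partial>lborel) \<in> borel_measurable \<Omega>"
    by (rule lborel.borel_measurable_nn_integral[OF meas])
  have "(\<integral>\<^sup>+\<omega>. \<integral>\<^sup>+z. f \<omega> z \<partial>lborel \<partial>\<Omega>) = (\<integral>\<^sup>+z. \<integral>\<^sup>+\<omega>. f \<omega> z \<partial>\<Omega> \<partial>lborel)"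
    by (rule Fubini'[symmetric, OF meas])
  also have "\<dots> \<le> (\<integral>\<^sup>+z. ennreal (error_bound n k K / (real k)\<^sup>2) * indicator (cball 0 R :: complex set) z \<partial>lborel)"
  proof (rule nn_integral_mono_AE)
    \<comment> \<open>At the origin only the constant coefficient survives, which may be 0, and the
      moment bound would not apply.\<close>
    have "AE z in lborel. z \<noteq> (0::complex)" by (rule AE_lborel_singleton)
    then show "AE z in lborel. (\<integral>\<^sup>+\<omega>. f \<omega> z \<partial>\<Omega>) \<le>
        ennreal (error_bound n k K / (real k)\<^sup>2) * indicator (cball 0 R) z"
    proof eventually_elim
      case (elim z)
      then have "coefficient_norm k (\<lambda>j. \<alpha> j * z ^ j) > 0"
        using \<alpha> by (intro coefficient_norm_pos) simp
      from scaled_log_error_second_moment[OF this] show ?case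
        by (cases "z \<in> cball 0 R") (simp_all add: f_def)
    qed
  qed
  also have "\<dots> = emeasure lborel (cball 0 R :: complex set) * ennreal (error_bound n k K / (real k)\<^sup>2)"
    by (subst nn_integral_cmult_indicator) (simp_all add: mult.commute)
  finally show "(\<integral>\<^sup>+\<omega>. \<integral>\<^sup>+z. f \<omega> z \<partial>lborel \<partial>\<Omega>) \<le>
      emeasure lborel (cball 0 R :: complex set) * ennreal (error_bound n k K / (real k)\<^sup>2)" .
qed

text \<open>Here \<open>t\<close> is the logarithmic potential of the empirical spectral distribution minus the
  deterministic one, up to a null set.\<close>

lemma esd_laplacian_identity:
  fixes C :: "nat \<Rightarrow> 'w \<Rightarrow> complex mat" and \<alpha> :: "nat \<Rightarrow> nat \<Rightarrow> complex"
    and n k :: nat and \<omega> :: 'w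
  defines "esd \<equiv> \<lambda>\<omega>. empirical_spectral_distribution n k (\<lambda>j. \<alpha> k j \<cdot>\<^sub>m C j \<omega>)"
    and "t \<equiv> \<lambda>\<omega> z. (log_error (entry_family C) n k (\<lambda>j. \<alpha> k j * z ^ j) \<omega> -
        log_error (entry_family C) n k (leading_unit k) \<omega>) / k"
  assumes n: "n \<ge> 1" and k: "k \<ge> 1" and \<alpha>: "\<alpha> k k \<noteq> 0"
    and C: "\<And>j. j \<le> k \<Longrightarrow> C j \<omega> \<in> carrier_mat n n"
    and nz: "random_det (entry_family C) n k (leading_unit k) \<omega> \<noteq> 0"
  shows "prob_space (esd \<omega>)"
    and "\<phi> \<in> test_functions \<Longrightarrow> integrable lborel (\<lambda>z. complex_of_real (t \<omega> z) * laplacian \<phi> z)"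
    and "\<phi> \<in> test_functions \<Longrightarrow>
      2 * complex_of_real pi * measure_distribution (esd \<omega>) \<phi> =
        function_distribution (log_potential \<alpha> k) (laplacian \<phi>) +
        (LINT z|lborel. complex_of_real (t \<omega> z) * laplacian \<phi> z)"
    and "t \<omega> \<in> borel_measurable borel"
proof -
  define N where "N = k * n"
  have N: "N > 0" using n k by (simp add: N_def)
  define B where "B j = \<alpha> k j \<cdot>\<^sub>m C j \<omega>" for j
  define L where "L = random_det (entry_family C) n k (leading_unit k) \<omega>"
  have detB: "Determinant.det (B k) = \<alpha> k k ^ n * L"
    unfolding B_def L_def by (rule det_leading_coefficient) (rule C, simp)
  have B: "B k \<in> carrier_mat n n" using C[of k] by (simp add: B_def)
  have L: "L \<noteq> 0" using nz by (simp add: L_def)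
  have "Determinant.det (B k) \<noteq> 0" using L \<alpha> by (simp add: detB)
  from esd_roots[where B = B, OF B this] N obtain r where
    r: "\<And>z. poly (Determinant.det (matrix_polynomial n k B)) z = Determinant.det (B k) * (\<Prod>i<N. z - r i)"
    and prob: "prob_space (empirical_spectral_distribution n k B)"
    and esd: "\<And>\<phi> :: complex \<Rightarrow> complex. \<phi> \<in> borel_measurable borel \<Longrightarrow>
      measure_distribution (empirical_spectral_distribution n k B) \<phi> = (\<Sum>i<N. \<phi> (r i)) / of_nat N"
    unfolding N_def by metis
  have esd_eq: "esd \<omega> = empirical_spectral_distribution n k B" by (simp add: esd_def B_def[abs_def])
  show "prob_space (esd \<omega>)" using prob by (simp add: esd_eq)
  show meas: "t \<omega> \<in> borel_measurable borel"
  proof -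
    have "(\<lambda>z. random_det (entry_family C) n k (\<lambda>j. \<alpha> k j * z ^ j) \<omega>) \<in> borel_measurable borel"
      unfolding random_det_def by (intro measurable_combination_det) measurable
    moreover have "(\<lambda>z. coefficient_norm k (\<lambda>j. \<alpha> k j * z ^ j)) \<in> borel_measurable borel"
      unfolding coefficient_norm_def by measurable
    ultimately show ?thesis unfolding t_def log_error_def by measurable
  qed
  define u where "u z = (\<Sum>i<N. ln (cmod (z - r i))) / real N" for z
  \<comment> \<open>The determinant factors as the leading determinant times the product over the
    roots. The power of alpha_k cancels against the normalisation of the potential, and the random
    leading factor against the error for \<open>leading_unit\<close>, whose coefficient norm is
    1.\<close>
  have pointwise: "u z = log_potential \<alpha> k z + t \<omega> z" if z: "z \<noteq> 0" "\<forall>i<N. z \<noteq> r i" for z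
  proof -
    let ?D = "random_det (entry_family C) n k (\<lambda>j. \<alpha> k j * z ^ j) \<omega>"
    have "?D = \<alpha> k k ^ n * L * (\<Prod>i<N. z - r i)"
      using poly_det_eq_random_det[of k C \<omega> n "\<alpha> k" z] C r[of z] detB by (simp add: B_def[abs_def])
    then have "ln (cmod (?D)) =
        real n * ln (cmod (\<alpha> k k)) + ln (cmod L) + ln (\<Prod>i<N. cmod (z - r i))"
    proof -
      have "0 < (\<Prod>i<N. cmod (z - r i))" using z by (intro prod_pos) auto
      with \<open>random_det _ _ _ _ _ = _\<close> \<alpha> L show ?thesis
        by (simp add: norm_mult norm_power prod_norm[symmetric] ln_mult_pos ln_realpow)
    qed
    also have "ln (\<Prod>i<N. cmod (z - r i)) = (\<Sum>i<N. ln (cmod (z - r i)))"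
      using z by (intro ln_prod) auto
    also have "(\<Sum>i<N. ln (cmod (z - r i))) = real n * (real k * u z)"
      using N by (simp add: u_def N_def)
    finally have D: "ln (cmod (?D)) / n =
        ln (cmod (\<alpha> k k)) + ln (cmod L) / n + real k * u z"
      using n by (simp add: field_simps)
    have "t \<omega> z = (ln (cmod (\<alpha> k k)) + real k * u z - ln (coefficient_norm k (\<lambda>j. \<alpha> k j * z ^ j))) / k"
      unfolding t_def log_error_def D by (simp add: coefficient_norm_leading_unit L_def)
    also have "\<dots> = u z - log_potential \<alpha> k z"
      unfolding log_potential_eq_coefficient_norm[where \<alpha> = \<alpha> and k = k, OF \<alpha> z(1)]
      using k by (simp add: field_simps)
    finally show ?thesis by simp
  qed
  \<comment> \<open>The exceptional set consists of the origin and the finitely many eigenvalues of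
    the fixed sample.\<close>
  have AE: "AE z in lborel. u z = log_potential \<alpha> k z + t \<omega> z"
  proof -
    have "AE z in lborel. z \<noteq> (0::complex)" by (rule AE_lborel_singleton)
    moreover have "AE z in lborel. \<forall>i\<in>{..<N}. z \<noteq> r i"
      by (intro AE_finite_allI AE_lborel_singleton) auto
    ultimately show ?thesis by eventually_elim (auto intro!: pointwise)
  qed
  {
    assume \<phi>: "\<phi> \<in> test_functions"
    define \<psi> where "\<psi> = laplacian \<phi>"
    have \<psi>: "\<psi> \<in> test_functions" using \<phi> by (simp add: \<psi>_def laplacian_test_functions)
    have [measurable]: "\<psi> \<in> borel_measurable borel" using \<psi> by (rule test_functions_measurable)
    have iu: "integrable lborel (\<lambda>z. complex_of_real (u z) * \<psi> z)"
    proof -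
      have "integrable lborel (\<lambda>z. (\<Sum>i<N. complex_of_real (ln (cmod (z - r i))) * \<psi> z) / of_nat N)"
        by (intro integrable_divide Bochner_Integration.integrable_sum integrable_ln_test_function \<psi>)
      then show ?thesis by (simp add: u_def sum_distrib_right)
    qed
    have il: "integrable lborel (\<lambda>z. complex_of_real (log_potential \<alpha> k z) * \<psi> z)"
      by (rule integrable_log_potential[where \<alpha> = \<alpha>, OF \<alpha> k \<psi>])
    have AE': "AE z in lborel. complex_of_real (u z) * \<psi> z - complex_of_real (log_potential \<alpha> k z) * \<psi> z =
        complex_of_real (t \<omega> z) * \<psi> z"
      using AE by eventually_elim (simp add: algebra_simps)
    have u_meas [measurable]: "u \<in> borel_measurable borel" unfolding u_def[abs_def] by measurable
    note meas[measurable]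
    have "integrable lborel (\<lambda>z. complex_of_real (u z) * \<psi> z - complex_of_real (log_potential \<alpha> k z) * \<psi> z)"
      using iu il by (rule Bochner_Integration.integrable_diff)
    then have it: "integrable lborel (\<lambda>z. complex_of_real (t \<omega> z) * \<psi> z)"
      by (rule integrable_cong_AE_imp) (use AE' in auto)
    then show "integrable lborel (\<lambda>z. complex_of_real (t \<omega> z) * laplacian \<phi> z)" by (simp add: \<psi>_def)
    have "(LINT z|lborel. complex_of_real (t \<omega> z) * \<psi> z) =
        (LINT z|lborel. complex_of_real (u z) * \<psi> z - complex_of_real (log_potential \<alpha> k z) * \<psi> z)"
      by (rule integral_cong_AE) (use AE' in auto)
    also have "\<dots> = (LINT z|lborel. complex_of_real (u z) * \<psi> z) - function_distribution (log_potential \<alpha> k) \<psi>"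
      using iu il by (simp add: function_distribution_def)
    also have "(LINT z|lborel. complex_of_real (u z) * \<psi> z) =
        (LINT z|lborel. (\<Sum>i<N. complex_of_real (ln (cmod (z - r i))) * \<psi> z) / of_nat N)"
      by (intro Bochner_Integration.integral_cong) (auto simp: u_def sum_distrib_right)
    also have "\<dots> = (\<Sum>i<N. LINT z|lborel. complex_of_real (ln (cmod (z - r i))) * \<psi> z) / of_nat N"
      by (subst integral_divide_zero, subst Bochner_Integration.integral_sum)
         (auto intro: integrable_ln_test_function \<psi>)
    also have "\<dots> = (\<Sum>i<N. 2 * complex_of_real pi * \<phi> (r i)) / of_nat N"
      unfolding \<psi>_def by (simp only: integral_ln_laplacian[OF \<phi>])
    also have "\<dots> = 2 * complex_of_real pi * measure_distribution (esd \<omega>) \<phi>"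
      using esd[OF test_functions_measurable[OF \<phi>]] by (simp add: esd_eq sum_distrib_left[symmetric])
    finally show "2 * complex_of_real pi * measure_distribution (esd \<omega>) \<phi> =
        function_distribution (log_potential \<alpha> k) (laplacian \<phi>) +
        (LINT z|lborel. complex_of_real (t \<omega> z) * laplacian \<phi> z)"
      by (simp add: \<psi>_def)
  }
qed

theorem theorem1p2:
  fixes \<Omega> :: "'w measure"
    and X :: "nat \<Rightarrow> nat \<Rightarrow> 'w \<Rightarrow> complex"
    and C :: "nat \<Rightarrow> nat \<Rightarrow> 'w \<Rightarrow> complex mat"
    and \<alpha> :: "nat \<Rightarrow> nat \<Rightarrow> complex"
    and n :: "nat \<Rightarrow> nat"
    and M P :: real
    and U :: "(complex \<Rightarrow> complex) \<Rightarrow> complex"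
    and \<mu> :: "complex measure"
  assumes "prob_space \<Omega>"
    and "M > 0"
    and X_indep: "\<And>k. k \<ge> 1 \<Longrightarrow> prob_space.indep_vars \<Omega> (\<lambda>_. borel) (X k) {..k}"
    and X_mean: "\<And>k j. k \<ge> 1 \<Longrightarrow> j \<le> k \<Longrightarrow>
        integrable \<Omega> (X k j) \<and> (LINT \<omega>|\<Omega>. X k j \<omega>) = 0"
    and X_variance: "\<And>k j. k \<ge> 1 \<Longrightarrow> j \<le> k \<Longrightarrow>
        integrable \<Omega> (\<lambda>\<omega>. (cmod (X k j \<omega>))\<^sup>2) \<and> (LINT \<omega>|\<Omega>. (cmod (X k j \<omega>))\<^sup>2) = 1"
    and X_density: "\<And>k j. k \<ge> 1 \<Longrightarrow> j \<le> k \<Longrightarrow> bounded_density \<Omega> M (X k j)"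
    and C_iid: "\<And>k j. k \<ge> 1 \<Longrightarrow> j \<le> k \<Longrightarrow> iid_copies_matrix \<Omega> (n k) (X k j) (C k j)"
    and C_indep: "\<And>k. k \<ge> 1 \<Longrightarrow> indep_matrices \<Omega> (n k) (C k) {..k}"
    and n_pos: "\<And>k. k \<ge> 1 \<Longrightarrow> n k \<ge> 1"
    and "P > 0"
    and n_growth: "(\<lambda>k. real (n k)) \<in> O(\<lambda>k. real k powr P)"
    and \<mu>_prob: "prob_space \<mu>" "sets \<mu> = sets borel"
    and leading: "\<And>k. k \<ge> 1 \<Longrightarrow> \<alpha> k k \<noteq> 0"
    and U_distribution: "is_distribution U"
    and U_limit: "limit_as_L1loc_function (log_potential \<alpha>) U \<or>
        limit_as_distribution (log_potential \<alpha>) U"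
    and U_laplacian: "\<forall>\<phi>\<in>test_functions.
        distribution_laplacian U \<phi> = 2 * complex_of_real pi * measure_distribution \<mu> \<phi>"
  shows "AE \<omega> in \<Omega>. weakly_converges
      (\<lambda>k. empirical_spectral_distribution (n k) k (\<lambda>j. \<alpha> k j \<cdot>\<^sub>m C k j \<omega>)) \<mu>"
proof -
  interpret prob_space \<Omega> by fact
  define K where "K = 1 + M * disc_const"
  have K: "K \<ge> 1" using \<open>M > 0\<close> disc_const_nonneg by (simp add: K_def)
  define Y where "Y k = entry_family (C k)" for k
  have rc: "random_coefficients \<Omega> (Y k) (n k) k K" if "k \<ge> 1" for k
    unfolding Y_def K_def
    using that assms(1,2) n_pos X_indep X_variance X_density C_iid C_indep
    by (intro random_coefficients_iid[where X = "X k"]) auto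
  define c where "c k z = (\<lambda>j. \<alpha> k j * z ^ j)" for k and z :: complex
  \<comment> \<open>\<open>G\<close> is the mean square error of the polynomial over a disc, and
    \<open>H\<close> the squared error of its leading determinant, which does not depend on
    z.\<close>
  define G where "G R k \<omega> = (\<integral>\<^sup>+z. indicator (cball 0 R) z *
    ennreal ((log_error (Y k) (n k) k (c k z) \<omega> / k)\<^sup>2) \<partial>lborel)" for R k \<omega>
  define H where "H k \<omega> = ennreal ((log_error (Y k) (n k) k (leading_unit k) \<omega> / k)\<^sup>2)" for k \<omega>
  define b where "b k = error_bound (n k) k K / (real k)\<^sup>2" for k
  have b_nonneg: "0 \<le> b k" for k by (simp add: b_def error_bound_def)
  have "summable b"
    unfolding b_def[abs_def] using K \<open>P > 0\<close> n_pos n_growth by (rule summable_error_bound)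
  then have "summable (\<lambda>m. b (Suc m))" by (subst summable_Suc_iff)
  then have sum_b: "(\<Sum>m. ennreal (b (Suc m))) \<noteq> \<infinity>"
    using b_nonneg by (simp add: ennreal_suminf_neq_top)
  \<comment> \<open>All limits are taken along \<open>Suc m\<close>, because the hypotheses speak of
    positive k only.\<close>
  have G_lim: "AE \<omega> in \<Omega>. (\<lambda>m. G R (Suc m) \<omega>) \<longlonglongrightarrow> 0" for R
  proof (rule AE_tendsto_0_if_suminf_finite)
    show "G R (Suc m) \<in> borel_measurable \<Omega>" for m
      unfolding G_def[abs_def] c_def
      by (rule random_coefficients.measurable_log_error_disc[OF rc leading]) auto
    have "(\<Sum>m. \<integral>\<^sup>+\<omega>. G R (Suc m) \<omega> \<partial>\<Omega>) \<le> (\<Sum>m. emeasure lborel (cball 0 R :: complex set) * ennreal (b (Suc m)))"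
      unfolding G_def c_def b_def
      by (intro suminf_le allI random_coefficients.log_error_disc_moment[OF rc leading]) auto
    also have "\<dots> = emeasure lborel (cball 0 R :: complex set) * (\<Sum>m. ennreal (b (Suc m)))"
      by (rule ennreal_suminf_cmult)
    also have "\<dots> < \<infinity>"
      using sum_b emeasure_bounded_finite[of "cball 0 R :: complex set"]
      by (auto simp: ennreal_mult_less_top less_top)
    finally show "(\<Sum>m. \<integral>\<^sup>+\<omega>. G R (Suc m) \<omega> \<partial>\<Omega>) \<noteq> \<infinity>" by simp
  qed
  have H_lim: "AE \<omega> in \<Omega>. (\<lambda>m. H (Suc m) \<omega>) \<longlonglongrightarrow> 0"
  proof (rule AE_tendsto_0_if_suminf_finite)
    show "H (Suc m) \<in> borel_measurable \<Omega>" for m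
      using random_coefficients.log_error_measurable[OF rc[of "Suc m"]]
      unfolding H_def[abs_def] by measurable
    have "(\<Sum>m. \<integral>\<^sup>+\<omega>. H (Suc m) \<omega> \<partial>\<Omega>) \<le> (\<Sum>m. ennreal (b (Suc m)))"
      unfolding H_def b_def
      by (intro suminf_le allI random_coefficients.scaled_log_error_second_moment[OF rc])
         (auto simp: coefficient_norm_leading_unit)
    also have "\<dots> < \<infinity>" using sum_b by (simp add: less_top)
    finally show "(\<Sum>m. \<integral>\<^sup>+\<omega>. H (Suc m) \<omega> \<partial>\<Omega>) \<noteq> \<infinity>" by simp
  qed
  have "AE \<omega> in \<Omega>. random_det (Y (Suc m)) (n (Suc m)) (Suc m) (leading_unit (Suc m)) \<omega> \<noteq> 0" for m
    by (rule random_coefficients.AE_random_det_nonzero[OF rc]) (simp_all add: coefficient_norm_leading_unit)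
  then have "AE \<omega> in \<Omega>. \<forall>m. random_det (Y (Suc m)) (n (Suc m)) (Suc m) (leading_unit (Suc m)) \<omega> \<noteq> 0"
    by (simp add: AE_all_countable)
  \<comment> \<open>Integer radii keep the union of null events countable and still cover the
    support of every test function. The resulting event does not depend on the test
    function.\<close>
  moreover have "AE \<omega> in \<Omega>. \<forall>N::nat. (\<lambda>m. G (real N) (Suc m) \<omega>) \<longlonglongrightarrow> 0"
    using G_lim by (simp add: AE_all_countable)
  moreover note H_lim AE_space
  ultimately show ?thesis
  proof eventually_elim
    case (elim \<omega>)
    define \<nu> where "\<nu> k = empirical_spectral_distribution (n k) k (\<lambda>j. \<alpha> k j \<cdot>\<^sub>m C k j \<omega>)" for k
    define t where "t k z = (log_error (Y k) (n k) k (c k z) \<omega> -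
      log_error (Y k) (n k) k (leading_unit k) \<omega>) / k" for k z
    have nz: "random_det (entry_family (C k)) (n k) k (leading_unit k) \<omega> \<noteq> 0" if "k \<ge> 1" for k
      using elim(1) that unfolding Y_def by (cases k) auto
    have carrier: "C k j \<omega> \<in> carrier_mat (n k) (n k)" if "k \<ge> 1" "j \<le> k" for k j
      using C_iid[OF that] elim(4) by (auto simp: iid_copies_matrix_def)
    have \<nu>_prob: "prob_space (\<nu> k)"
      and t_int: "\<phi> \<in> test_functions \<Longrightarrow> integrable lborel (\<lambda>z. complex_of_real (t k z) * laplacian \<phi> z)"
      and \<nu>_eq: "\<phi> \<in> test_functions \<Longrightarrow> 2 * complex_of_real pi * measure_distribution (\<nu> k) \<phi> =
        function_distribution (log_potential \<alpha> k) (laplacian \<phi>) +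
        (LINT z|lborel. complex_of_real (t k z) * laplacian \<phi> z)"
      and t_meas: "t k \<in> borel_measurable borel" if "k \<ge> 1" for k \<phi>
      using esd_laplacian_identity[of "n k" k \<alpha> "C k" \<omega>, OF n_pos[OF that] that leading[OF that] carrier[OF that] nz[OF that]]
      unfolding \<nu>_def t_def[abs_def] c_def Y_def by auto
    have lim: "(\<lambda>k. measure_distribution (\<nu> k) \<phi>) \<longlonglongrightarrow> measure_distribution \<mu> \<phi>"
      if \<phi>: "\<phi> \<in> test_functions" for \<phi>
    proof -
      define \<psi> where "\<psi> = laplacian \<phi>"
      have \<psi>: "\<psi> \<in> test_functions" using \<phi> by (simp add: \<psi>_def laplacian_test_functions)
      obtain R0 where R0: "\<forall>z. R0 \<le> cmod z \<longrightarrow> \<psi> z = 0" using test_functions_vanish[OF \<psi>] by auto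
      obtain N :: nat where "R0 \<le> real N" using real_arch_simple by blast
      with R0 have R: "\<psi> z = 0" if "real N \<le> cmod z" for z using that by auto
      define V where "V = emeasure lborel (cball 0 (real N) :: complex set)"
      have V: "V < \<infinity>" unfolding V_def by (rule emeasure_bounded_finite) simp
      have "(\<lambda>m. LINT z|lborel. complex_of_real (t (Suc m) z) * \<psi> z) \<longlonglongrightarrow> 0"
      proof (rule integral_tendsto_0_if_square[OF \<psi> R])
        show "t (Suc m) \<in> borel_measurable borel" for m by (rule t_meas) simp
        show "integrable lborel (\<lambda>z. complex_of_real (t (Suc m) z) * \<psi> z)" for m
          unfolding \<psi>_def by (rule t_int[OF _ \<phi>]) simp
        \<comment> \<open>Separates the two errors by (p - q)^2 being at most 2 p^2 + 2 q^2; the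
          second is constant in z and contributes the area V.\<close>
        have le: "(\<integral>\<^sup>+z. indicator (cball 0 (real N)) z * ennreal ((t (Suc m) z)\<^sup>2) \<partial>lborel) \<le>
            2 * G (real N) (Suc m) \<omega> + 2 * (H (Suc m) \<omega> * V)" for m
        proof -
          define p where "p z = log_error (Y (Suc m)) (n (Suc m)) (Suc m) (c (Suc m) z) \<omega> / Suc m" for z
          define q where "q = log_error (Y (Suc m)) (n (Suc m)) (Suc m) (leading_unit (Suc m)) \<omega> / Suc m"
          have t: "t (Suc m) z = p z - q" for z by (simp add: t_def p_def q_def diff_divide_distrib)
          have [measurable]: "p \<in> borel_measurable borel"
          proof -
            have "(\<lambda>z. t (Suc m) z + q) \<in> borel_measurable borel"
              using t_meas[of "Suc m"] by measurable
            then show ?thesis by (simp add: t)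
          qed
          have [measurable]: "cball 0 (real N) \<in> sets (borel :: complex measure)" by simp
          have "(\<integral>\<^sup>+z. indicator (cball 0 (real N)) z * ennreal ((t (Suc m) z)\<^sup>2) \<partial>lborel) \<le>
            (\<integral>\<^sup>+z. 2 * (indicator (cball 0 (real N)) z * ennreal ((p z)\<^sup>2)) +
              2 * (ennreal (q\<^sup>2) * indicator (cball 0 (real N)) z) \<partial>lborel)"
          proof (rule nn_integral_mono)
            fix z
            have "(p z - q)\<^sup>2 \<le> 2 * (p z)\<^sup>2 + 2 * q\<^sup>2"
              using zero_le_power2[of "p z + q"] by (simp add: power2_sum power2_diff)
            then have "ennreal ((p z - q)\<^sup>2) \<le> ennreal (2 * (p z)\<^sup>2 + 2 * q\<^sup>2)" by (rule ennreal_leI)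
            also have "\<dots> = 2 * ennreal ((p z)\<^sup>2) + 2 * ennreal (q\<^sup>2)"
              by (simp add: ennreal_mult)
            finally show "indicator (cball 0 (real N)) z * ennreal ((t (Suc m) z)\<^sup>2) \<le>
              2 * (indicator (cball 0 (real N)) z * ennreal ((p z)\<^sup>2)) +
              2 * (ennreal (q\<^sup>2) * indicator (cball 0 (real N)) z)"
              by (cases "z \<in> cball 0 (real N)") (simp_all add: t)
          qed
          also have "\<dots> = 2 * (\<integral>\<^sup>+z. indicator (cball 0 (real N)) z * ennreal ((p z)\<^sup>2) \<partial>lborel) +
              2 * (ennreal (q\<^sup>2) * V)"
            unfolding V_def
            by (subst nn_integral_add, measurable, subst nn_integral_cmult, measurable,
                subst nn_integral_cmult, measurable, subst nn_integral_cmult_indicator) auto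
          finally show ?thesis by (simp add: G_def H_def p_def q_def)
        qed
        have "(\<lambda>m. 2 * G (real N) (Suc m) \<omega> + 2 * (V * H (Suc m) \<omega>)) \<longlonglongrightarrow> 2 * 0 + 2 * (V * 0)"
          using elim(2,3) V by (intro tendsto_add ennreal_tendsto_cmult) auto
        then have "(\<lambda>m. 2 * G (real N) (Suc m) \<omega> + 2 * (H (Suc m) \<omega> * V)) \<longlonglongrightarrow> 0"
          by (simp add: mult.commute[of V])
        then show "(\<lambda>m. \<integral>\<^sup>+z. indicator (cball 0 (real N)) z * ennreal ((t (Suc m) z)\<^sup>2) \<partial>lborel) \<longlonglongrightarrow> 0"
          by (rule tendsto_sandwich[OF _ _ tendsto_const, rotated 2]) (use le in auto)
      qed
      moreover have "(\<lambda>m. function_distribution (log_potential \<alpha> (Suc m)) \<psi>) \<longlonglongrightarrow> U \<psi>"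
        by (rule LIMSEQ_Suc[OF function_distribution_log_potential_tendsto[OF leading \<psi> U_limit]])
      ultimately have "(\<lambda>m. function_distribution (log_potential \<alpha> (Suc m)) \<psi> +
          (LINT z|lborel. complex_of_real (t (Suc m) z) * \<psi> z)) \<longlonglongrightarrow> U \<psi> + 0"
        by (intro tendsto_add)
      \<comment> \<open>The Laplacian sits on the test function, so the potential of the empirical
        measure has already become a sum over eigenvalues, with the same factor 2 pi as in the
        hypothesis on U.\<close>
      then have "(\<lambda>m. 2 * complex_of_real pi * measure_distribution (\<nu> (Suc m)) \<phi>) \<longlonglongrightarrow> U \<psi>"
        by (simp add: \<nu>_eq[OF _ \<phi>] \<psi>_def)
      also have "U \<psi> = 2 * complex_of_real pi * measure_distribution \<mu> \<phi>"
        using U_laplacian \<phi> by (simp add: distribution_laplacian_def \<psi>_def)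
      finally have "(\<lambda>m. measure_distribution (\<nu> (Suc m)) \<phi>) \<longlonglongrightarrow> measure_distribution \<mu> \<phi>"
        by (subst (asm) tendsto_mult_left_iff) auto
      then show ?thesis by (rule LIMSEQ_imp_Suc)
    qed
    have "weakly_converges \<nu> \<mu>"
      using \<mu>_prob \<nu>_prob lim by (intro weakly_convergesI_test_functions) (auto simp: \<nu>_def)
    then show ?case by (simp add: \<nu>_def[abs_def])
  qed
qed

end
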